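(* Let $(X_i,Y_i,Z_i)$, $i=1,\dots,n$, be i.i.d. copies of $(X,Y,Z)$ with joint density $p_{X,Y,Z}$ on $\mathbb{R}^{d_X+d_Y+d_Z}$, let $a$ be a weight function, and suppose assumptions (A1), (A2), (A3) (stated in the context) hold. Then, as $n\to\infty$, $\hat\zeta_{a,n}\to\zeta_a(X,Y|Z)$ in probability, i.e. $\hat\zeta_{a,n}$ is a consistent estimator of $\zeta_a(X,Y|Z)$.
   Context: Marginals of $p_{X,Y,Z}$ are denoted $p_{X,Z},p_{Y,Z},p_Z$, etc. A weight function is a bounded measurable $a:\mathbb{R}^{d_Y}\times\mathbb{R}^{d_Z}\to[0,\infty)$ positive on the support of $p_{Y,Z}$. $\|\cdot\|$ is the Euclidean norm. Ball divergence: for probability measures $P,Q$ on $\mathbb{R}^d$, $\Theta^2(P,Q)=\int\int (P(\bar B)-Q(\bar B))^2\{dP(u)dP(v)+dQ(u)dQ(v)\}$ with $\bar B=\bar B(u,\|v-u\|)$ the closed ball of center $u$ and radius $\|v-u\|$. Conditional ball divergence: $\zeta_a(X,Y|Z)=\mathbb{E}[\Theta^2(\mathbb{P}_{X|Y,Z},\mathbb{P}_{X|Z})a(Y,Z)]$. Estimator: for a kernel $K:[0,\infty)\to[0,\infty)$ and bandwidths $h_1,h_2>0$, let, for Borel $A\subset\mathbb{R}^{d_X}$, $$\tilde{\mathbb{P}}_{X|Y=y,Z=z}(A)=\frac{\sum_{i=1}^n K(\|(y,z)-(Y_i,Z_i)\|/h_1)\mathbf 1\{X_i\in A\}}{\sum_{i=1}^n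 K(\|(y,z)-(Y_i,Z_i)\|/h_1)},\qquad \tilde{\mathbb{P}}_{X|Z=z}(A)=\frac{\sum_{i=1}^n K(\|z-Z_i\|/h_2)\mathbf 1\{X_i\in A\}}{\sum_{i=1}^n K(\|z-Z_i\|/h_2)},$$ and $\hat\zeta_{a,n}=\frac1n\sum_{s=1}^n\Theta^2(\tilde{\mathbb{P}}_{X|Y_s,Z_s},\tilde{\mathbb{P}}_{X|Z_s})\,a(Y_s,Z_s)$. Niceness: a joint density $f(x,y)$ is nice with respect to $Y$ (its second argument) if, for any sequence $\delta_n\to0$, with $$R_n(x,y;u)=\frac1{\delta_n^2}\left\{\frac{f(x,y+\delta_n u)}{f(x,y)}-1-\delta_n\Big(\frac{\frac{\partial}{\partial y}f(x,y)}{f(x,y)}\Big)u^\top\right\},$$ the quantity $\sup_{u:\|u\|=1}\limsup_{n\to\infty}\int R_n(x,y;u)^2f(x,y)\,dx$ is uniformly bounded in $y$ (vectors are rows). (A1) $p_{X,Z}$ is nice with respect to $Z$, $p_{X,Y,Z}$ is nice with respect to $(Y,Z)$, and $p_{X,Y,Z}$ and its marginals are uniformly bounded. (A2) $K$ is uniformly bounded, non-negative, symmetric about zero, compactly supported, and $\int_{\mathbb{R}^d}K(\|u\|)du=1$, $\int_{\mathbb{R}^d}u^\top u\,K(\|u\|)du=\tau I_d$ for some constant $\tau>0$, where $d=d_Y+d_Z$ or $d=d_Z$ depending on the context in which $K$ is used. (A3) $h_1,h_2$ depend on $n$ such that, with $d_1=d_Y+d_Z$, $d_2=d_Z$: $h_1^{d_1}/h_2^{d_2}\to0$,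 $nh_i^{d_i}\to\infty$ and $nh_i^{d_i+4}\to0$ for $i=1,2$, as $n\to\infty$. *)

theory Defs
  imports "HOL-Probability.Probability"
begin

definition ball_divergence :: "'x::euclidean_space measure \<Rightarrow> 'x measure \<Rightarrow> real" where
  "ball_divergence P Q =
     (LINT u|P. LINT v|P. (measure P (cball u (norm (v - u))) - measure Q (cball u (norm (v - u))))\<^sup>2)
   + (LINT u|Q. LINT v|Q. (measure P (cball u (norm (v - u))) - measure Q (cball u (norm (v - u))))\<^sup>2)"

text \<open>\<open>\<kappa>\<close> is a version of the regular conditional distribution of \<open>X\<close> given \<open>W\<close>.\<close>

definition regular_cond_dist ::
  "'w measure \<Rightarrow> ('w \<Rightarrow> 'x::euclidean_space) \<Rightarrow> ('w \<Rightarrow> 'v::euclidean_space) \<Rightarrow> ('v \<Rightarrow> 'x measure) \<Rightarrow> bool"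
where
  "regular_cond_dist M X W \<kappa> \<longleftrightarrow>
     \<kappa> \<in> borel \<rightarrow>\<^sub>M prob_algebra borel \<and>
     (\<forall>A\<in>sets borel. \<forall>B\<in>sets borel.
        measure M {\<omega> \<in> space M. X \<omega> \<in> A \<and> W \<omega> \<in> B}
          = (LINT \<omega>|M. indicator B (W \<omega>) * measure (\<kappa> (W \<omega>)) A))"

text \<open>\<open>\<kappa>1\<close> and \<open>\<kappa>2\<close> are meant to be regular conditional distributions of \<open>X\<close> given \<open>(Y, Z)\<close>
  and of \<open>X\<close> given \<open>Z\<close>; the value does not depend on the versions chosen.\<close>

definition cond_ball_divergence ::
  "'w measure \<Rightarrow> ('w \<Rightarrow> 'y) \<Rightarrow> ('w \<Rightarrow> 'z) \<Rightarrow> ('y \<times> 'z \<Rightarrow> 'x::euclidean_space measure)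
     \<Rightarrow> ('z \<Rightarrow> 'x measure) \<Rightarrow> ('y \<times> 'z \<Rightarrow> real) \<Rightarrow> real" where
  "cond_ball_divergence M Y Z \<kappa>1 \<kappa>2 a =
     (LINT \<omega>|M. ball_divergence (\<kappa>1 (Y \<omega>, Z \<omega>)) (\<kappa>2 (Z \<omega>)) * a (Y \<omega>, Z \<omega>))"

text \<open>The weighted empirical distribution of \<open>xs 1, \<dots>, xs n\<close>, with kernel weights located at \<open>w\<close>.
  If all weights vanish, division by zero makes it the null measure.\<close>

definition kernel_cond_dist ::
  "(real \<Rightarrow> real) \<Rightarrow> real \<Rightarrow> nat \<Rightarrow> (nat \<Rightarrow> 'x::euclidean_space) \<Rightarrow> (nat \<Rightarrow> 'v::euclidean_space) \<Rightarrow> 'v \<Rightarrow> 'x measure"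
where
  "kernel_cond_dist K h n xs ws w =
     distr (point_measure {1..n}
              (\<lambda>i. ennreal (K (norm (w - ws i) / h) / (\<Sum>j=1..n. K (norm (w - ws j) / h)))))
       borel xs"

lemma measure_kernel_cond_dist:
  fixes xs :: "nat \<Rightarrow> 'x::euclidean_space" and ws :: "nat \<Rightarrow> 'v::euclidean_space"
  assumes K: "\<And>t. 0 \<le> K t" and A: "A \<in> sets borel"
  shows "measure (kernel_cond_dist K h n xs ws w) A
    = (\<Sum>i=1..n. K (norm (w - ws i) / h) * indicator A (xs i)) / (\<Sum>i=1..n. K (norm (w - ws i) / h))"
proof -
  define S where "S = (\<Sum>j=1..n. K (norm (w - ws j) / h))"
  define c where "c i = K (norm (w - ws i) / h) / S" for i
  have c: "0 \<le> c i" for i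
    unfolding c_def S_def by (intro divide_nonneg_nonneg sum_nonneg K)
  have "measure (kernel_cond_dist K h n xs ws w) A
      = measure (point_measure {1..n} (\<lambda>i. ennreal (c i))) (xs -` A \<inter> {1..n})"
    unfolding kernel_cond_dist_def c_def S_def
    using A by (subst measure_distr) (auto simp: space_point_measure)
  also have "\<dots> = (\<Sum>i\<in>xs -` A \<inter> {1..n}. c i)"
    using c by (simp add: measure_def emeasure_point_measure_finite sum_nonneg)
  also have "\<dots> = (\<Sum>i=1..n. c i * indicator A (xs i))"
    by (intro sum.mono_neutral_cong_left) (auto simp: indicator_def)
  also have "\<dots> = (\<Sum>i=1..n. K (norm (w - ws i) / h) * indicator A (xs i)) / S"
    unfolding c_def sum_divide_distrib by (intro sum.cong refl) (simp only: times_divide_eq_left)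
  finally show ?thesis
    by (simp add: S_def)
qed

definition zeta_hat ::
  "(real \<Rightarrow> real) \<Rightarrow> real \<Rightarrow> real \<Rightarrow> ('y::euclidean_space \<times> 'z::euclidean_space \<Rightarrow> real) \<Rightarrow> nat
     \<Rightarrow> (nat \<Rightarrow> 'x::euclidean_space) \<Rightarrow> (nat \<Rightarrow> 'y) \<Rightarrow> (nat \<Rightarrow> 'z) \<Rightarrow> real" where
  "zeta_hat K h1 h2 a n xs ys zs =
     1 / real n * (\<Sum>s=1..n.
        ball_divergence
          (kernel_cond_dist K h1 n xs (\<lambda>i. (ys i, zs i)) (ys s, zs s))
          (kernel_cond_dist K h2 n xs zs (zs s))
        * a (ys s, zs s))"

definition marginal_XZ :: "('x \<times> 'y::euclidean_space \<times> 'z \<Rightarrow> real) \<Rightarrow> 'x \<Rightarrow> 'z \<Rightarrow> real" where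
  "marginal_XZ p x z = (LINT y|lborel. p (x, y, z))"

definition marginal_YZ :: "('x::euclidean_space \<times> 'y \<times> 'z \<Rightarrow> real) \<Rightarrow> 'y \<times> 'z \<Rightarrow> real" where
  "marginal_YZ p w = (LINT x|lborel. p (x, w))"

text \<open>The bounds are stated for integrals in \<open>[0, \<infinity>]\<close>, so that they also say that every section
  of \<open>p\<close> is integrable; the Bochner integral would be 0 on a non-integrable section.\<close>

definition bounded_with_marginals ::
  "('x::euclidean_space \<times> 'y::euclidean_space \<times> 'z::euclidean_space \<Rightarrow> real) \<Rightarrow> bool" where
  "bounded_with_marginals p \<longleftrightarrow> (\<exists>C::real.
     (\<forall>v. p v \<le> C) \<and>
     (\<forall>x y. (\<integral>\<^sup>+z. ennreal (p (x, y, z)) \<partial>lborel) \<le> ennreal C) \<and>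
     (\<forall>x z. (\<integral>\<^sup>+y. ennreal (p (x, y, z)) \<partial>lborel) \<le> ennreal C) \<and>
     (\<forall>y z. (\<integral>\<^sup>+x. ennreal (p (x, y, z)) \<partial>lborel) \<le> ennreal C) \<and>
     (\<forall>x. (\<integral>\<^sup>+w. ennreal (p (x, fst w, snd w)) \<partial>lborel) \<le> ennreal C) \<and>
     (\<forall>y. (\<integral>\<^sup>+w. ennreal (p (fst w, y, snd w)) \<partial>lborel) \<le> ennreal C) \<and>
     (\<forall>z. (\<integral>\<^sup>+w. ennreal (p (fst w, snd w, z)) \<partial>lborel) \<le> ennreal C))"

definition partial_gradient :: "('v::euclidean_space \<Rightarrow> real) \<Rightarrow> 'v \<Rightarrow> 'v" where
  "partial_gradient g y = (\<Sum>i\<in>Basis. deriv (\<lambda>t::real. g (y + t *\<^sub>R i)) 0 *\<^sub>R i)"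

definition nice_remainder ::
  "('x \<Rightarrow> 'v::euclidean_space \<Rightarrow> real) \<Rightarrow> real \<Rightarrow> 'x \<Rightarrow> 'v \<Rightarrow> 'v \<Rightarrow> real" where
  "nice_remainder f \<delta> x y u =
     1 / \<delta>\<^sup>2 * (f x (y + \<delta> *\<^sub>R u) / f x y - 1
              - \<delta> * ((partial_gradient (f x) y /\<^sub>R f x y) \<bullet> u))"

text \<open>Niceness with respect to the second argument. The partial derivatives are required to exist
  wherever the remainder is meaningful, i.e. where \<open>f x y \<noteq> 0\<close>; points with \<open>f x y = 0\<close> contribute
  nothing to the integral, which is taken in \<open>[0, \<infinity>]\<close>, as are its limsup and supremum.
  The bound may depend on the sequence \<open>\<delta>\<close>, but not on \<open>y\<close>.\<close>

definition nice_density ::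
  "('x::euclidean_space \<Rightarrow> 'v::euclidean_space \<Rightarrow> real) \<Rightarrow> bool" where
  "nice_density f \<longleftrightarrow>
     (\<forall>x y. f x y \<noteq> 0 \<longrightarrow>
        (\<forall>i\<in>Basis. (\<lambda>t::real. f x (y + t *\<^sub>R i)) differentiable (at 0))) \<and>
     (\<forall>\<delta>::nat \<Rightarrow> real. (\<forall>n. \<delta> n \<noteq> 0) \<longrightarrow> \<delta> \<longlonglongrightarrow> 0 \<longrightarrow>
        (\<exists>C::real. \<forall>y.
           (SUP u\<in>{u. norm u = 1}.
              limsup (\<lambda>n. \<integral>\<^sup>+x. ennreal ((nice_remainder f (\<delta> n) x y u)\<^sup>2 * f x y) \<partial>lborel))
           \<le> ennreal C))"

definition assumption_A1 ::
  "('x::euclidean_space \<times> 'y::euclidean_space \<times> 'z::euclidean_space \<Rightarrow> real) \<Rightarrow> bool" where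
  "assumption_A1 p \<longleftrightarrow>
     nice_density (marginal_XZ p) \<and>
     nice_density (\<lambda>x w. p (x, w)) \<and>
     bounded_with_marginals p"

text \<open>A kernel on \<open>[0, \<infinity>)\<close> is represented by its even extension to the real line.\<close>

definition kernel_normalized :: "'v::euclidean_space itself \<Rightarrow> (real \<Rightarrow> real) \<Rightarrow> bool" where
  "kernel_normalized TYPE('v) K \<longleftrightarrow>
     has_bochner_integral lborel (\<lambda>u::'v. K (norm u)) 1 \<and>
     (\<exists>\<tau>>0. \<forall>i\<in>(Basis :: 'v set). \<forall>j\<in>Basis.
        has_bochner_integral lborel (\<lambda>u::'v. (u \<bullet> i) * (u \<bullet> j) * K (norm u)) (if i = j then \<tau> else 0))"

definition assumption_A2 ::
  "'y::euclidean_space itself \<Rightarrow> 'z::euclidean_space itself \<Rightarrow> (real \<Rightarrow> real) \<Rightarrow> bool" where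
  "assumption_A2 TYPE('y) TYPE('z) K \<longleftrightarrow>
     (\<exists>C. \<forall>t. K t \<le> C) \<and> (\<forall>t. 0 \<le> K t) \<and> (\<forall>t. K (- t) = K t) \<and>
     compact (closure {t. K t \<noteq> 0}) \<and>
     kernel_normalized TYPE('y \<times> 'z) K \<and> kernel_normalized TYPE('z) K"

definition assumption_A3 :: "nat \<Rightarrow> nat \<Rightarrow> (nat \<Rightarrow> real) \<Rightarrow> (nat \<Rightarrow> real) \<Rightarrow> bool" where
  "assumption_A3 d1 d2 h1 h2 \<longleftrightarrow>
     (\<lambda>n. h1 n ^ d1 / h2 n ^ d2) \<longlonglongrightarrow> 0 \<and>
     filterlim (\<lambda>n. real n * h1 n ^ d1) at_top sequentially \<and>
     filterlim (\<lambda>n. real n * h2 n ^ d2) at_top sequentially \<and>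
     (\<lambda>n. real n * h1 n ^ (d1 + 4)) \<longlonglongrightarrow> 0 \<and>
     (\<lambda>n. real n * h2 n ^ (d2 + 4)) \<longlonglongrightarrow> 0"

text \<open>The support of \<open>q\<close> is read as \<open>{w. q w \<noteq> 0}\<close>; positivity on the closure of this set would be
  a stronger requirement on the weight.\<close>

definition weight_function ::
  "('v::euclidean_space \<Rightarrow> real) \<Rightarrow> ('v \<Rightarrow> real) \<Rightarrow> bool" where
  "weight_function q a \<longleftrightarrow>
     a \<in> borel_measurable borel \<and> (\<forall>w. 0 \<le> a w) \<and> (\<exists>C. \<forall>w. a w \<le> C) \<and>
     (\<forall>w. q w \<noteq> 0 \<longrightarrow> 0 < a w)"

definition tendsto_in_prob :: "'w measure \<Rightarrow> (nat \<Rightarrow> 'w \<Rightarrow> real) \<Rightarrow> real \<Rightarrow> bool" where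
  "tendsto_in_prob M T c \<longleftrightarrow>
     (\<forall>n. T n \<in> borel_measurable M) \<and>
     (\<forall>\<epsilon>>0. (\<lambda>n. measure M {\<omega> \<in> space M. \<epsilon> < \<bar>T n \<omega> - c\<bar>}) \<longlonglongrightarrow> 0)"

end

theory Submission
  imports Defs "HOL-Library.Diagonal_Subsequence"
begin

text \<open>Write \<open>g\<^sub>A(v)\<close> for the integral of \<open>f(x, v)\<close> over \<open>x \<in> A\<close>, where \<open>f\<close> is the joint density of
  \<open>X\<close> and the conditioning variable \<open>V\<close>. For a fixed Borel set \<open>A\<close>, the kernel average at \<open>V\<^sub>1\<close> converges
  to \<open>g\<^sub>A(V\<^sub>1)\<close> in \<open>L\<^sup>1\<close>: the bias tends to 0 because translations are continuous in \<open>L\<^sup>1\<close>,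
  and the variance is \<open>O(1 / (n h\<^sup>d))\<close>. Along a subsequence the
  convergence is almost sure simultaneously for countably many \<open>A\<close>, and quotients give the
  conditional probabilities. The ball divergence is a polynomial of degree four in its two arguments
  whose kernels are indicators of closed sets with boundaries that are null sets for absolutely
  continuous limits, so it is continuous along such sequences by a portmanteau argument. Dominated
  convergence gives the \<open>L\<^sup>1\<close> limit of a single summand, exchangeability transfers it to all summands,
  and the law of large numbers concludes.\<close>

section \<open>Convergence on countable partitions\<close>

text \<open>Estimates in mean are obtained for one Borel set at a time, and almost sure statements
  drawn from them survive only for countable families. This dictates the mode of convergence: masses
  of the cells of countable partitions that shrink to points. Unlike convergence on a fixed
  countable family of sets, it passes to product measures, because cells of a product are products
  of cells, and it still gives the lower bound for open sets by Fatou's lemma.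

  Three features of the estimator shape the rest. The evaluation point is itself a sample point: its
  own term is split off at a cost of order 1 / (n h^d), and the other observations are independent
  of it. All n summands share one sample and are dependent, but expected absolute errors add up
  without independence, so the law of large numbers is applied only to the average of the limiting
  summands. All weights may vanish, so the estimates are treated as sub-probability measures
  throughout.\<close>

lemma emeasure_open_le_liminf:
  fixes N :: "'e::topological_space measure" and idx :: "nat \<Rightarrow> 'e \<Rightarrow> 'k::countable"
  assumes sets_N: "sets N = sets borel" and sets_Nn: "\<And>n. sets (Nn n) = sets borel"
    and idx: "\<And>m. idx m \<in> borel \<rightarrow>\<^sub>M count_space UNIV"
    and conv: "\<And>m k. (\<lambda>n. emeasure (Nn n) {e. idx m e = k}) \<longlonglongrightarrow> emeasure N {e. idx m e = k}"
    and U: "U \<in> sets borel"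
    and fine: "\<And>e. e \<in> U \<Longrightarrow> \<forall>\<^sub>F m in sequentially. {e'. idx m e' = idx m e} \<subseteq> U"
  shows "emeasure N U \<le> liminf (\<lambda>n. emeasure (Nn n) U)"
proof -
  \<comment> \<open>\<open>W m\<close> is the union of the level-\<open>m\<close> cells that lie
    inside \<open>U\<close>. Its \<open>N\<close>-mass is a countable sum of cell masses, each of
    which is a limit, so Fatou's lemma for the counting measure bounds it by the lower limit of the
    \<open>Nn\<close>-masses. Mass that escapes over infinitely many cells does no harm to this
    inequality.\<close>
  define J where "J m = {k. {e. idx m e = k} \<subseteq> U}" for m
  define W where "W m = (\<Union>k\<in>J m. {e. idx m e = k})" for m
  have cell: "{e. idx m e = k} \<in> sets borel" for m k
    using measurable_sets[OF idx, of "{k}" m] by (simp add: vimage_def)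
  have W: "W m \<in> sets borel" for m
    unfolding W_def by (rule sets.countable_UN') (use cell in auto)
  have W_sub: "W m \<subseteq> U" for m
    by (auto simp: W_def J_def)
  have em: "emeasure L (W m) = (\<integral>\<^sup>+k. emeasure L {e. idx m e = k} \<partial>count_space (J m))"
    if "sets L = sets borel" for L m
    unfolding W_def
    proof (rule emeasure_UN_countable)
    show "{e. idx m e = k} \<in> sets L" for k
      unfolding that by (rule cell)
  qed (auto simp: disjoint_family_on_def)
  have le: "emeasure N (W m) \<le> liminf (\<lambda>n. emeasure (Nn n) U)" for m
  proof -
    have "emeasure N (W m)
        = (\<integral>\<^sup>+k. liminf (\<lambda>n. emeasure (Nn n) {e. idx m e = k}) \<partial>count_space (J m))"
      unfolding em[OF sets_N]
      by (intro nn_integral_cong lim_imp_Liminf[symmetric] conv) simp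
    also have "\<dots> \<le> liminf (\<lambda>n. \<integral>\<^sup>+k. emeasure (Nn n) {e. idx m e = k} \<partial>count_space (J m))"
      by (rule nn_integral_liminf) simp
    also have "\<dots> = liminf (\<lambda>n. emeasure (Nn n) (W m))"
      by (simp add: em[OF sets_Nn])
    also have "\<dots> \<le> liminf (\<lambda>n. emeasure (Nn n) U)"
      by (intro Liminf_mono always_eventually allI emeasure_mono W_sub) (simp add: sets_Nn U)
    finally show ?thesis .
  qed
  \<comment> \<open>Partitions of different levels need not be nested, so \<open>W m\<close> need
    not increase. Each point of \<open>U\<close> still lies in \<open>W m\<close> for all large
    \<open>m\<close>, which is what a second use of Fatou's lemma, now under \<open>N\<close>, asks
    for.\<close>
  have ev: "indicator U e \<le> liminf (\<lambda>m. indicator (W m) e :: ennreal)" for e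
  proof (cases "e \<in> U")
    case True
    from fine[OF True] have "\<forall>\<^sub>F m in sequentially. (1::ennreal) \<le> indicator (W m) e"
      by eventually_elim (auto simp: W_def J_def)
    from Liminf_bounded[OF this] show ?thesis using True by simp
  qed simp
  have "emeasure N U = (\<integral>\<^sup>+e. indicator U e \<partial>N)"
    by (simp add: sets_N U)
  also have "\<dots> \<le> (\<integral>\<^sup>+e. liminf (\<lambda>m. indicator (W m) e) \<partial>N)"
    by (intro nn_integral_mono ev)
  also have "\<dots> \<le> liminf (\<lambda>m. \<integral>\<^sup>+e. indicator (W m) e \<partial>N)"
    by (intro nn_integral_liminf borel_measurable_indicator) (simp add: sets_N W)
  also have "\<dots> = liminf (\<lambda>m. emeasure N (W m))"
    by (simp add: sets_N W)
  also have "\<dots> \<le> liminf (\<lambda>n. emeasure (Nn n) U)"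
  proof -
    have "liminf (\<lambda>m. emeasure N (W m)) \<le> liminf (\<lambda>m::nat. liminf (\<lambda>n. emeasure (Nn n) U))"
      by (intro Liminf_mono always_eventually allI le)
    then show ?thesis by (simp add: Liminf_const)
  qed
  finally show ?thesis .
qed

text \<open>A substitute for weak convergence that constrains only countably many sequences of reals.\<close>

definition cellwise_conv ::
  "(nat \<Rightarrow> 'e::topological_space \<Rightarrow> 'k) \<Rightarrow> (nat \<Rightarrow> 'e measure) \<Rightarrow> 'e measure \<Rightarrow> bool" where
  "cellwise_conv idx Nn N \<longleftrightarrow>
     (\<forall>m. idx m \<in> borel \<rightarrow>\<^sub>M count_space UNIV) \<and>
     (\<forall>e U. open U \<longrightarrow> e \<in> U \<longrightarrow> (\<forall>\<^sub>F m in sequentially. {e'. idx m e' = idx m e} \<subseteq> U)) \<and>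
     (\<forall>n. sets (Nn n) = sets borel \<and> subprob_space (Nn n)) \<and> sets N = sets borel \<and> prob_space N \<and>
     (\<forall>m k. (\<lambda>n. emeasure (Nn n) {e. idx m e = k}) \<longlonglongrightarrow> emeasure N {e. idx m e = k})"

lemma subprob_space_pair_measure:
  assumes "subprob_space A" "subprob_space B"
  shows "subprob_space (A \<Otimes>\<^sub>M B)"
proof -
  interpret A: subprob_space A by fact
  interpret B: subprob_space B by fact
  interpret pair_sigma_finite A B ..
  show ?thesis
  proof
    have "emeasure (A \<Otimes>\<^sub>M B) (space (A \<Otimes>\<^sub>M B)) = emeasure A (space A) * emeasure B (space B)"
      by (simp add: space_pair_measure B.emeasure_pair_measure_Times)
    also have "\<dots> \<le> 1 * 1"
      by (intro mult_mono A.emeasure_space_le_1 B.emeasure_space_le_1) auto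
    finally show "emeasure (A \<Otimes>\<^sub>M B) (space (A \<Otimes>\<^sub>M B)) \<le> 1" by simp
    show "space (A \<Otimes>\<^sub>M B) \<noteq> {}"
      by (simp add: space_pair_measure A.subprob_not_empty B.subprob_not_empty)
  qed
qed

lemma sets_pair_borel:
  fixes A :: "'a::second_countable_topology measure" and B :: "'b::second_countable_topology measure"
  assumes "sets A = sets borel" "sets B = sets borel"
  shows "sets (A \<Otimes>\<^sub>M B) = sets borel"
  using sets_pair_measure_cong[OF assms] unfolding borel_prod .

text \<open>Product measures factor on rectangles and every cell of the product partition is a
  rectangle, so its mass is a product of two convergent finite masses. Open sets of the product
  contain open rectangles around each of their points, which gives fineness.\<close>

lemma cellwise_conv_pair:
  fixes i1 :: "nat \<Rightarrow> 'a::second_countable_topology \<Rightarrow> 'k::countable"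
    and i2 :: "nat \<Rightarrow> 'b::second_countable_topology \<Rightarrow> 'l::countable"
  assumes 1: "cellwise_conv i1 An A" and 2: "cellwise_conv i2 Bn B"
  shows "cellwise_conv (\<lambda>m e. (i1 m (fst e), i2 m (snd e))) (\<lambda>n. An n \<Otimes>\<^sub>M Bn n) (A \<Otimes>\<^sub>M B)"
proof -
  have [measurable]: "i1 m \<in> borel \<rightarrow>\<^sub>M count_space UNIV" "i2 m \<in> borel \<rightarrow>\<^sub>M count_space UNIV" for m
    using 1 2 by (auto simp: cellwise_conv_def)
  have [measurable]: "{e. i1 m e = k} \<in> sets borel" "{e. i2 m e = l} \<in> sets borel" for m k l
    using measurable_sets[of "i1 m" borel "count_space UNIV" "{k}"]
      measurable_sets[of "i2 m" borel "count_space UNIV" "{l}"] by (auto simp: vimage_def)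
  have A: "subprob_space (An n)" "prob_space A" "sets (An n) = sets borel" "sets A = sets borel"
    "(\<lambda>n. emeasure (An n) {e. i1 m e = k}) \<longlonglongrightarrow> emeasure A {e. i1 m e = k}" for n m k
    using 1 by (auto simp: cellwise_conv_def)
  have B: "subprob_space (Bn n)" "prob_space B" "sets (Bn n) = sets borel" "sets B = sets borel"
    "(\<lambda>n. emeasure (Bn n) {e. i2 m e = k}) \<longlonglongrightarrow> emeasure B {e. i2 m e = k}" for n m k
    using 2 by (auto simp: cellwise_conv_def)
  interpret A: prob_space A by (rule A)
  interpret B: prob_space B by (rule B)
  interpret AB: pair_prob_space A B ..
  have eq: "{e. (i1 m (fst e), i2 m (snd e)) = kl} = {e. i1 m e = fst kl} \<times> {e. i2 m e = snd kl}"
    for m kl by auto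
  have emn: "emeasure (An n \<Otimes>\<^sub>M Bn n) {e. (i1 m (fst e), i2 m (snd e)) = kl}
       = emeasure (An n) {e. i1 m e = fst kl} * emeasure (Bn n) {e. i2 m e = snd kl}" for n m kl
  proof -
    interpret B': subprob_space "Bn n" by (rule B)
    show ?thesis
      unfolding eq by (rule B'.emeasure_pair_measure_Times) (simp_all add: A B)
  qed
  have em: "emeasure (A \<Otimes>\<^sub>M B) {e. (i1 m (fst e), i2 m (snd e)) = kl}
       = emeasure A {e. i1 m e = fst kl} * emeasure B {e. i2 m e = snd kl}" for m kl
    unfolding eq by (rule B.emeasure_pair_measure_Times) (simp_all add: A B)
  have fine: "\<forall>\<^sub>F m in sequentially. {e'. (i1 m (fst e'), i2 m (snd e')) = (i1 m (fst e), i2 m (snd e))} \<subseteq> U"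
    if U: "open U" and e: "e \<in> U" for e U
  proof -
    obtain S T where ST: "open S" "open T" "e \<in> S \<times> T" "S \<times> T \<subseteq> U"
      using open_prod_elim[OF U e] by blast
    have "\<forall>\<^sub>F m in sequentially. {e'. i1 m e' = i1 m (fst e)} \<subseteq> S"
      "\<forall>\<^sub>F m in sequentially. {e'. i2 m e' = i2 m (snd e)} \<subseteq> T"
      using 1 2 ST by (auto simp: cellwise_conv_def)
    then show ?thesis
      by eventually_elim (use ST(4) in force)
  qed
  show ?thesis
    unfolding cellwise_conv_def
  proof (intro conjI allI impI)
    fix m
    have "(\<lambda>e. (i1 m (fst e), i2 m (snd e))) \<in> borel \<Otimes>\<^sub>M borel \<rightarrow>\<^sub>M count_space UNIV \<Otimes>\<^sub>M count_space UNIV"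
      by measurable
    then show "(\<lambda>e. (i1 m (fst e), i2 m (snd e))) \<in> borel \<rightarrow>\<^sub>M count_space UNIV"
      by (simp add: borel_prod pair_measure_countable)
  next
    fix m kl
    show "(\<lambda>n. emeasure (An n \<Otimes>\<^sub>M Bn n) {e. (i1 m (fst e), i2 m (snd e)) = kl})
       \<longlonglongrightarrow> emeasure (A \<Otimes>\<^sub>M B) {e. (i1 m (fst e), i2 m (snd e)) = kl}"
      unfolding emn em by (intro tendsto_mult_ennreal A(5) B(5)) simp
  qed (rule fine sets_pair_borel subprob_space_pair_measure AB.prob_space_axioms A B | assumption)+
qed

text \<open>The lower half of the portmanteau theorem, phrased through eventual strict bounds
  because this is the form in which two-sided limits are assembled afterwards.\<close>

lemma cellwise_conv_open:
  fixes idx :: "nat \<Rightarrow> 'e::topological_space \<Rightarrow> 'k::countable"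
  assumes c: "cellwise_conv idx Nn N" and U: "open U" and lt: "r < measure N U"
  shows "\<forall>\<^sub>F n in sequentially. r < measure (Nn n) U"
proof (cases "r < 0")
  \<comment> \<open>\<open>ennreal\<close> collapses negative reals to 0, so a negative
    \<open>r\<close>, for which the claim is trivial, is treated apart.\<close>
  case True
  then show ?thesis by (intro always_eventually allI less_le_trans[OF _ measure_nonneg])
next
  case False
  interpret N: prob_space N using c by (simp add: cellwise_conv_def)
  have fin: "subprob_space (Nn n)" for n using c by (simp add: cellwise_conv_def)
  have "emeasure N U \<le> liminf (\<lambda>n. emeasure (Nn n) U)"
    by (rule emeasure_open_le_liminf[of N Nn idx]) (use c U in \<open>auto simp: cellwise_conv_def\<close>)
  moreover have "ennreal r < emeasure N U"
    using lt False by (simp add: N.emeasure_eq_measure ennreal_lessI)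
  ultimately have "ennreal r < liminf (\<lambda>n. emeasure (Nn n) U)" by simp
  then have "\<forall>\<^sub>F n in sequentially. ennreal r < emeasure (Nn n) U"
    by (rule less_LiminfD)
  then show ?thesis
  proof eventually_elim
    case (elim n)
    interpret subprob_space "Nn n" by (rule fin)
    show ?case using elim False by (simp add: emeasure_eq_measure ennreal_less_iff)
  qed
qed

text \<open>\<open>V\<close> is open inside \<open>G\<close> and \<open>- G\<close> is open outside
  it, so two lower bounds on open sets pinch the mass of \<open>G\<close> once the gap
  \<open>G - V\<close> is null for the limit. Taking \<open>V\<close> as a parameter avoids having
  to compute the interior of \<open>G\<close>.\<close>

lemma cellwise_conv_closed:
  fixes idx :: "nat \<Rightarrow> 'e::topological_space \<Rightarrow> 'k::countable"
  assumes c: "cellwise_conv idx Nn N" and V: "open V" and G: "closed G" and VG: "V \<subseteq> G"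
    and null: "measure N (G - V) = 0"
  shows "(\<lambda>n. measure (Nn n) G) \<longlonglongrightarrow> measure N G"
proof -
  interpret N: prob_space N using c by (simp add: cellwise_conv_def)
  have sN: "sets N = sets borel" using c by (simp add: cellwise_conv_def)
  have sNn: "sets (Nn n) = sets borel" and fin: "subprob_space (Nn n)" for n
    using c by (auto simp: cellwise_conv_def)
  have spN: "space N = UNIV" using sets_eq_imp_space_eq[OF sN] by simp
  have eqV: "measure N G = measure N V"
  proof -
    have "measure N (V \<union> (G - V)) = measure N V + measure N (G - V)"
      by (rule N.finite_measure_Union) (use V G in \<open>auto simp: sN\<close>)
    moreover have "V \<union> (G - V) = G" using VG by auto
    ultimately show ?thesis using null by simp
  qed
  have cG: "measure N (- G) = 1 - measure N G"
    using N.prob_compl[of G] G by (simp add: spN sN Compl_eq_Diff_UNIV)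
  \<comment> \<open>The approximants may have total mass below 1, so passing to the complement gives
    only an inequality; it points in the direction that the upper bound needs.\<close>
  have le: "measure (Nn n) G \<le> 1 - measure (Nn n) (- G)" for n
  proof -
    interpret subprob_space "Nn n" by (rule fin)
    have "measure (Nn n) (G \<union> - G) = measure (Nn n) G + measure (Nn n) (- G)"
      by (rule finite_measure_Union) (use G in \<open>auto simp: sNn\<close>)
    then show ?thesis using subprob_measure_le_1[of "G \<union> - G"] by simp
  qed
  have mono: "measure (Nn n) V \<le> measure (Nn n) G" for n
  proof -
    interpret subprob_space "Nn n" by (rule fin)
    show ?thesis by (rule finite_measure_mono) (use VG G in \<open>auto simp: sNn\<close>)
  qed
  show ?thesis
  proof (rule order_tendstoI)
    fix r assume "r < measure N G"
    then have "\<forall>\<^sub>F n in sequentially. r < measure (Nn n) V"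
      by (intro cellwise_conv_open[OF c V]) (simp add: eqV)
    then show "\<forall>\<^sub>F n in sequentially. r < measure (Nn n) G"
      by eventually_elim (use mono in \<open>auto intro: less_le_trans\<close>)
  next
    fix r assume "measure N G < r"
    then have "\<forall>\<^sub>F n in sequentially. 1 - r < measure (Nn n) (- G)"
      by (intro cellwise_conv_open[OF c]) (use G in \<open>auto simp: cG\<close>)
    then show "\<forall>\<^sub>F n in sequentially. measure (Nn n) G < r"
    proof eventually_elim
      case (elim n) then show ?case using le[of n] by simp
    qed
  qed
qed

text \<open>Each point is sent to the first member of a dense sequence within distance
  \<open>1 / Suc m\<close>. Choosing the least index makes the map single-valued and Borel, and two
  points of one cell share a centre, hence are closer than \<open>2 / Suc m\<close>; this is the
  factor 2 below.\<close>

lemma ex_partition_index: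
  obtains idx :: "nat \<Rightarrow> 'x::{second_countable_topology, metric_space} \<Rightarrow> nat"
  where "\<And>m. idx m \<in> borel \<rightarrow>\<^sub>M count_space UNIV"
    and "\<And>x U. open U \<Longrightarrow> x \<in> U \<Longrightarrow> \<forall>\<^sub>F m in sequentially. {x'. idx m x' = idx m x} \<subseteq> U"
proof -
  obtain D :: "'x set" where D: "countable D" "\<And>X. open X \<Longrightarrow> X \<noteq> {} \<Longrightarrow> \<exists>d\<in>D. d \<in> X"
    using countable_dense_setE by blast
  have ne: "D \<noteq> {}" using D(2)[of UNIV] by auto
  define d where "d = from_nat_into D"
  define idx where "idx m x = (LEAST k. dist (d k) x < 1 / real (Suc m))" for m x
  have ex: "\<exists>k. dist (d k) x < 1 / real (Suc m)" for m x
  proof -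
    obtain y where "y \<in> D" "y \<in> ball x (1 / real (Suc m))"
      using D(2)[of "ball x (1 / real (Suc m))"] by auto
    then show ?thesis
      using from_nat_into_surj[OF D(1)] by (metis d_def dist_commute mem_ball)
  qed
  have near: "dist (d (idx m x)) x < 1 / real (Suc m)" for m x
    unfolding idx_def by (rule LeastI_ex[OF ex])
  show thesis
  proof
    fix m
    show "idx m \<in> borel \<rightarrow>\<^sub>M count_space UNIV"
      unfolding idx_def by measurable
  next
    fix x :: 'x and U assume "open U" "x \<in> U"
    then obtain e where e: "e > 0" "ball x e \<subseteq> U" using open_contains_ball by blast
    have "(\<lambda>m. 2 * inverse (real (Suc m))) \<longlonglongrightarrow> 2 * 0"
      by (intro tendsto_intros LIMSEQ_inverse_real_of_nat)
    then have "\<forall>\<^sub>F m in sequentially. 2 * inverse (real (Suc m)) < e"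
      using e(1) by (intro order_tendstoD(2)) simp_all
    then show "\<forall>\<^sub>F m in sequentially. {x'. idx m x' = idx m x} \<subseteq> U"
    proof eventually_elim
      case (elim m)
      show ?case
      proof safe
        fix x' assume "idx m x' = idx m x"
        then have "dist (d (idx m x)) x' < 1 / real (Suc m)" using near[of m x'] by simp
        then have "dist x x' < e"
          using near[of m x] dist_triangle3[of x x' "d (idx m x)"] elim
          by (simp add: inverse_eq_divide)
        then show "x' \<in> U" using e(2) by auto
      qed
    qed
  qed
qed

section \<open>The ball divergence as a multilinear functional\<close>

definition nearer_pairs :: "('x::euclidean_space \<times> 'x \<times> 'x \<times> 'x) set" where
  "nearer_pairs = {(u, v, x, x'). norm (x - u) \<le> norm (v - u) \<and> norm (x' - u) \<le> norm (v - u)}"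

text \<open>Expanding the square in the ball divergence produces probabilities that, of four independent
  points, the last two are at least as close to the first one as the second is.\<close>

definition ball_prod ::
  "'x::euclidean_space measure \<Rightarrow> 'x measure \<Rightarrow> 'x measure \<Rightarrow> 'x measure \<Rightarrow> real" where
  "ball_prod A B P Q = measure (A \<Otimes>\<^sub>M (B \<Otimes>\<^sub>M (P \<Otimes>\<^sub>M Q))) nearer_pairs"

lemma closed_nearer_pairs: "closed (nearer_pairs :: ('x::euclidean_space \<times> _) set)"
  unfolding nearer_pairs_def case_prod_unfold
  by (intro closed_Collect_conj closed_Collect_le continuous_intros)

lemma measure_pair_measure_eq:
  assumes "finite_measure A" "finite_measure B" "S \<in> sets (A \<Otimes>\<^sub>M B)"
  shows "measure (A \<Otimes>\<^sub>M B) S = (LINT x|A. measure B (Pair x -` S))"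
proof -
  interpret A: finite_measure A by fact
  interpret B: finite_measure B by fact
  interpret pair_sigma_finite A B ..
  have [measurable]: "S \<in> sets (A \<Otimes>\<^sub>M B)" by fact
  have eS: "emeasure (A \<Otimes>\<^sub>M B) S = (\<integral>\<^sup>+x. ennreal (measure B (Pair x -` S)) \<partial>A)"
    by (simp add: B.emeasure_pair_measure_alt B.emeasure_eq_measure)
  have "(\<lambda>x. measure B (Pair x -` S)) \<in> borel_measurable A"
    unfolding measure_def by (intro borel_measurable_enn2real B.measurable_emeasure_Pair) simp
  then have "(LINT x|A. measure B (Pair x -` S)) = enn2real (\<integral>\<^sup>+x. ennreal (measure B (Pair x -` S)) \<partial>A)"
    by (intro integral_eq_nn_integral) auto
  then show ?thesis by (simp add: measure_def[of "A \<Otimes>\<^sub>M B"] eS)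
qed

lemma measure_pair_measure_Times:
  assumes "finite_measure B" "S \<in> sets A" "T \<in> sets B"
  shows "measure (A \<Otimes>\<^sub>M B) (S \<times> T) = measure A S * measure B T"
proof -
  interpret B: finite_measure B by fact
  show ?thesis
    using assms by (simp add: measure_def B.emeasure_pair_measure_Times enn2real_mult)
qed

text \<open>Sub-probability rather than probability, because the kernel estimate is the null measure
  at points where all weights vanish.\<close>

locale borel_subprob = subprob_space P for P :: "'x::euclidean_space measure" +
  assumes sets_borel[measurable_cong]: "sets P = sets borel"

lemma borel_subprob_iff: "borel_subprob P \<longleftrightarrow> P \<in> space (subprob_algebra borel)"
  by (auto simp: space_subprob_algebra borel_subprob_def borel_subprob_axioms_def)

text \<open>The ball about \<open>u\<close> through \<open>v\<close> is the section at
  \<open>(u, v)\<close> of one closed set in three variables, and section masses are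
  measurable.\<close>

lemma measurable_measure_cball:
  assumes "borel_subprob P"
  shows "(\<lambda>w. measure P (cball (fst w) (norm (snd w - fst w)))) \<in> borel_measurable (borel :: ('x::euclidean_space \<times> 'x) measure)"
proof -
  interpret P: borel_subprob P by fact
  define S :: "(('x \<times> 'x) \<times> 'x) set" where "S = {w. norm (snd w - fst (fst w)) \<le> norm (snd (fst w) - fst (fst w))}"
  have "closed S"
    unfolding S_def by (intro closed_Collect_le continuous_intros)
  then have "S \<in> sets (borel \<Otimes>\<^sub>M P)"
    by (subst sets_pair_borel) (auto simp: P.sets_borel)
  then have "(\<lambda>w. emeasure P (Pair w -` S)) \<in> borel_measurable borel"
    by (rule P.measurable_emeasure_Pair)
  also have "(\<lambda>w. Pair w -` S) = (\<lambda>w. cball (fst w) (norm (snd w - fst w)))"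
    by (auto simp: S_def fun_eq_iff dist_norm norm_minus_commute)
  finally show ?thesis unfolding measure_def by measurable
qed

text \<open>Slicing \<open>nearer_pairs\<close> at \<open>u\<close> and then at \<open>v\<close>
  leaves the square of one closed ball, whose product mass factors. Iterating Fubini thus turns the
  four-fold measure into the double integral of a product of ball masses.\<close>

lemma ball_prod_eq:
  fixes A B P Q :: "'x::euclidean_space measure"
  assumes "borel_subprob A" "borel_subprob B" "borel_subprob P" "borel_subprob Q"
  shows "ball_prod A B P Q = (LINT u|A. LINT v|B. measure P (cball u (norm (v - u))) * measure Q (cball u (norm (v - u))))"
proof -
  interpret A: borel_subprob A by fact
  interpret B: borel_subprob B by fact
  interpret P: borel_subprob P by fact
  interpret Q: borel_subprob Q by fact
  have PQ: "subprob_space (P \<Otimes>\<^sub>M Q)" "sets (P \<Otimes>\<^sub>M Q) = sets borel"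
    by (intro subprob_space_pair_measure P.subprob_space_axioms Q.subprob_space_axioms
        sets_pair_borel P.sets_borel Q.sets_borel)+
  have BPQ: "subprob_space (B \<Otimes>\<^sub>M (P \<Otimes>\<^sub>M Q))" "sets (B \<Otimes>\<^sub>M (P \<Otimes>\<^sub>M Q)) = sets borel"
    by (intro subprob_space_pair_measure PQ B.subprob_space_axioms sets_pair_borel B.sets_borel)+
  have s: "sets (A \<Otimes>\<^sub>M (B \<Otimes>\<^sub>M (P \<Otimes>\<^sub>M Q))) = sets borel"
    by (intro sets_pair_borel BPQ A.sets_borel)
  have cl: "closed (Pair u -` (nearer_pairs :: ('x \<times> _) set))" for u
    by (intro continuous_closed_vimage closed_nearer_pairs continuous_intros)
  have sec: "Pair v -` (Pair u -` nearer_pairs) = cball u (norm (v - u)) \<times> cball u (norm (v - u))" for u v :: 'x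
    by (auto simp: nearer_pairs_def dist_norm norm_minus_commute)
  have "ball_prod A B P Q = (LINT u|A. measure (B \<Otimes>\<^sub>M (P \<Otimes>\<^sub>M Q)) (Pair u -` nearer_pairs))"
    unfolding ball_prod_def
    by (intro measure_pair_measure_eq A.finite_measure_axioms subprob_space.axioms(1)[OF BPQ(1)])
       (simp add: s closed_nearer_pairs borel_closed)
  also have "\<dots> = (LINT u|A. LINT v|B. measure (P \<Otimes>\<^sub>M Q) (Pair v -` (Pair u -` nearer_pairs)))"
    by (intro Bochner_Integration.integral_cong refl measure_pair_measure_eq B.finite_measure_axioms
        subprob_space.axioms(1)[OF PQ(1)])
       (simp add: BPQ cl borel_closed)
  also have "\<dots> = (LINT u|A. LINT v|B. measure P (cball u (norm (v - u))) * measure Q (cball u (norm (v - u))))"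
    unfolding sec
    by (intro Bochner_Integration.integral_cong refl measure_pair_measure_Times Q.finite_measure_axioms)
       (simp_all add: P.sets_borel Q.sets_borel)
  finally show ?thesis .
qed

text \<open>The square is expanded under the integral. The outer measures \<open>A\<close> and
  \<open>B\<close> stay arbitrary so that one expansion serves both halves of the ball divergence,
  with the pair drawn from \<open>P\<close> and with the pair drawn from \<open>Q\<close>.\<close>

lemma integral_square_measure_cball_diff:
  fixes A B P Q :: "'a::euclidean_space measure"
  assumes "borel_subprob A" "borel_subprob B" "borel_subprob P" "borel_subprob Q"
  shows "(LINT u|A. LINT v|B. (measure P (cball u (norm (v - u))) - measure Q (cball u (norm (v - u))))\<^sup>2)
     = ball_prod A B P P - 2 * ball_prod A B P Q + ball_prod A B Q Q"
proof -
  interpret A: borel_subprob A by fact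
  interpret B: borel_subprob B by fact
  interpret P: borel_subprob P by fact
  interpret Q: borel_subprob Q by fact
  \<comment> \<open>Indexing by the measure lets each integrability fact below cover the three
    products \<open>P P\<close>, \<open>P Q\<close> and \<open>Q Q\<close> at once.\<close>
  define f where "f R w = measure R (cball (fst w) (norm (snd w - fst w)))" for R :: "'a measure" and w
  have [measurable]: "f P \<in> borel_measurable (borel \<Otimes>\<^sub>M borel)" "f Q \<in> borel_measurable (borel \<Otimes>\<^sub>M borel)"
    using measurable_measure_cball[OF assms(3)] measurable_measure_cball[OF assms(4)]
    unfolding borel_prod f_def[abs_def] by auto
  have bd: "\<bar>f R w\<bar> \<le> 1" if "R \<in> {P, Q}" for R w
    using that by (auto simp: f_def P.subprob_measure_le_1 Q.subprob_measure_le_1)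
  have bd2: "\<bar>f R w * f R' w\<bar> \<le> 1" if "R \<in> {P, Q}" "R' \<in> {P, Q}" for R R' w
    unfolding abs_mult using mult_mono[OF bd[OF that(1)] bd[OF that(2)]] by simp
  have i2: "integrable B (\<lambda>v. f R (u, v) * f R' (u, v))" if "R \<in> {P, Q}" "R' \<in> {P, Q}" for R R' u
    by (rule B.integrable_const_bound[of _ 1]) (use that bd2 in auto)
  have i1: "integrable A (\<lambda>u. LINT v|B. f R (u, v) * f R' (u, v))"
    if R: "R \<in> {P, Q}" "R' \<in> {P, Q}" for R R'
  proof (rule A.integrable_const_bound[of _ 1])
    have "\<bar>LINT v|B. f R (u, v) * f R' (u, v)\<bar> \<le> 1" for u
    proof -
      have "\<bar>LINT v|B. f R (u, v) * f R' (u, v)\<bar> \<le> (LINT v|B. \<bar>f R (u, v) * f R' (u, v)\<bar>)"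
        by (rule integral_abs_bound)
      also have "\<dots> \<le> (LINT v|B. 1)"
        by (intro integral_mono integrable_abs i2 R bd2) auto
      also have "\<dots> \<le> 1" by (simp add: B.subprob_measure_le_1)
      finally show ?thesis .
    qed
    then show "AE u in A. norm (LINT v|B. f R (u, v) * f R' (u, v)) \<le> 1" by simp
    have [measurable]: "f R \<in> borel_measurable (borel \<Otimes>\<^sub>M borel)" "f R' \<in> borel_measurable (borel \<Otimes>\<^sub>M borel)"
      using R by auto
    show "(\<lambda>u. LINT v|B. f R (u, v) * f R' (u, v)) \<in> borel_measurable A"
      by measurable
  qed
  have bp: "ball_prod A B R R' = (LINT u|A. LINT v|B. f R (u, v) * f R' (u, v))"
    if "R \<in> {P, Q}" "R' \<in> {P, Q}" for R R'
    unfolding f_def using that assms by (auto simp: ball_prod_eq)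
  have "(LINT u|A. LINT v|B. (f P (u, v) - f Q (u, v))\<^sup>2)
     = (LINT u|A. (LINT v|B. f P (u, v) * f P (u, v)) - 2 * (LINT v|B. f P (u, v) * f Q (u, v))
         + (LINT v|B. f Q (u, v) * f Q (u, v)))"
  proof (intro Bochner_Integration.integral_cong refl)
    fix u
    have "(LINT v|B. (f P (u, v) - f Q (u, v))\<^sup>2)
      = (LINT v|B. f P (u, v) * f P (u, v) - 2 * (f P (u, v) * f Q (u, v)) + f Q (u, v) * f Q (u, v))"
      by (simp add: power2_eq_square algebra_simps)
    also have "\<dots> = (LINT v|B. f P (u, v) * f P (u, v)) - 2 * (LINT v|B. f P (u, v) * f Q (u, v))
         + (LINT v|B. f Q (u, v) * f Q (u, v))"
      using i2 by (simp add: integrable_mult_right)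
    finally show "(LINT v|B. (f P (u, v) - f Q (u, v))\<^sup>2) = \<dots>" .
  qed
  also have "\<dots> = ball_prod A B P P - 2 * ball_prod A B P Q + ball_prod A B Q Q"
    using i1 by (simp add: bp)
  finally show ?thesis by (simp add: f_def)
qed

lemma ball_divergence_eq:
  assumes "borel_subprob P" "borel_subprob Q"
  shows "ball_divergence P Q = (ball_prod P P P P - 2 * ball_prod P P P Q + ball_prod P P Q Q)
     + (ball_prod Q Q P P - 2 * ball_prod Q Q P Q + ball_prod Q Q Q Q)"
  unfolding ball_divergence_def using assms
  by (simp only: integral_square_measure_cball_diff)

lemma measurable_ball_prod:
  fixes f1 f2 f3 f4 :: "'w \<Rightarrow> 'a::euclidean_space measure"
  assumes [measurable]: "f1 \<in> N \<rightarrow>\<^sub>M subprob_algebra borel" "f2 \<in> N \<rightarrow>\<^sub>M subprob_algebra borel"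
    "f3 \<in> N \<rightarrow>\<^sub>M subprob_algebra borel" "f4 \<in> N \<rightarrow>\<^sub>M subprob_algebra borel"
  shows "(\<lambda>w. ball_prod (f1 w) (f2 w) (f3 w) (f4 w)) \<in> borel_measurable N"
proof -
  have "(\<lambda>w. f1 w \<Otimes>\<^sub>M (f2 w \<Otimes>\<^sub>M (f3 w \<Otimes>\<^sub>M f4 w)))
      \<in> N \<rightarrow>\<^sub>M subprob_algebra (borel \<Otimes>\<^sub>M (borel \<Otimes>\<^sub>M (borel \<Otimes>\<^sub>M borel)))"
    by (intro measurable_pair_measure assms)
  moreover have "(nearer_pairs :: ('a \<times> _) set) \<in> sets (borel \<Otimes>\<^sub>M (borel \<Otimes>\<^sub>M (borel \<Otimes>\<^sub>M borel)))"
    unfolding borel_prod by (rule borel_closed[OF closed_nearer_pairs])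
  ultimately show ?thesis
    unfolding ball_prod_def by (rule measurable_compose[OF _ measurable_measure_subprob_algebra])
qed

text \<open>The polynomial form replaces integrals of varying functions against varying measures by
  evaluations of product measures at one fixed set. The identity is valid for sub-probabilities on
  the Borel sets, hence the passage through \<open>measurable_cong\<close> on the space of
  \<open>N\<close>.\<close>

lemma measurable_ball_divergence:
  assumes f: "f \<in> N \<rightarrow>\<^sub>M subprob_algebra borel" and g: "g \<in> N \<rightarrow>\<^sub>M subprob_algebra borel"
  shows "(\<lambda>w. ball_divergence (f w) (g w)) \<in> borel_measurable N"
proof -
  note [measurable] = measurable_ball_prod f g
  have "(\<lambda>w. ball_divergence (f w) (g w)) \<in> borel_measurable N \<longleftrightarrow>
    (\<lambda>w. (ball_prod (f w) (f w) (f w) (f w) - 2 * ball_prod (f w) (f w) (f w) (g w) + ball_prod (f w) (f w) (g w) (g w))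
     + (ball_prod (g w) (g w) (f w) (f w) - 2 * ball_prod (g w) (g w) (f w) (g w) + ball_prod (g w) (g w) (g w) (g w)))
     \<in> borel_measurable N"
    using measurable_space[OF f] measurable_space[OF g]
    by (intro measurable_cong ball_divergence_eq) (auto simp: borel_subprob_iff)
  also have \<dots>
    by measurable
  finally show ?thesis .
qed

text \<open>The squared difference of two sub-probabilities is at most 1 and there are two double
  integrals. The resulting 2 is the dominating constant in the later limit and half of the bound
  \<open>2 * Ca\<close> on the weighted terms.\<close>

lemma ball_divergence_bounds:
  fixes P Q :: "'a::euclidean_space measure"
  assumes "borel_subprob P" "borel_subprob Q"
  shows "0 \<le> ball_divergence P Q" "ball_divergence P Q \<le> 2"
proof -
  interpret P: borel_subprob P by fact
  interpret Q: borel_subprob Q by fact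
  have bd: "(measure P S - measure Q S)\<^sup>2 \<le> 1" for S
    using P.subprob_measure_le_1[of S] Q.subprob_measure_le_1[of S]
      measure_nonneg[of P S] measure_nonneg[of Q S]
    by (intro abs_square_le_1[THEN iffD2]) linarith
  show "0 \<le> ball_divergence P Q"
    unfolding ball_divergence_def
    by (intro add_nonneg_nonneg Bochner_Integration.integral_nonneg) auto
  \<comment> \<open>Splitting on integrability avoids a measurability proof: a Bochner integral that
    does not exist has the value 0, which also satisfies the bound.\<close>
  have le1: "(LINT v|A. h v) \<le> 1" if "borel_subprob A" "\<And>v. 0 \<le> h v" "\<And>v. h v \<le> 1"
    for A :: "'a measure" and h :: "'a \<Rightarrow> real"
  proof -
    interpret A: borel_subprob A by fact
    show ?thesis
    proof (cases "integrable A h")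
      case True
      then have "(LINT v|A. h v) \<le> (LINT v|A. 1)"
        by (intro integral_mono that) auto
      also have "\<dots> \<le> 1" by (simp add: A.subprob_measure_le_1)
      finally show ?thesis .
    qed (simp add: not_integrable_integral_eq)
  qed
  have "ball_divergence P Q \<le> 1 + 1"
    unfolding ball_divergence_def
    by (intro add_mono le1 assms bd Bochner_Integration.integral_nonneg) auto
  then show "ball_divergence P Q \<le> 2" by simp
qed

text \<open>Stands in for the interior of \<open>nearer_pairs\<close>: it is open, and what it omits
  lies where one of the last two points is on the sphere about \<open>u\<close> through
  \<open>v\<close>.\<close>

definition nearer_pairs_strict :: "('x::euclidean_space \<times> 'x \<times> 'x \<times> 'x) set" where
  "nearer_pairs_strict = {(u, v, x, x'). norm (x - u) < norm (v - u) \<and> norm (x' - u) < norm (v - u)}"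

text \<open>For fixed \<open>u\<close> and \<open>v\<close> the omitted part is covered by two
  cylinders over a sphere. Spheres are Lebesgue null, also when \<open>u = v\<close> and the sphere
  is a single point, so absolute continuity of \<open>P\<close> and \<open>Q\<close> makes every
  section null and Fubini does the rest, whatever atoms \<open>A\<close> and \<open>B\<close>
  have.\<close>

lemma ball_prod_tendsto:
  fixes A B P Q :: "'x::euclidean_space measure" and idx :: "nat \<Rightarrow> 'x \<Rightarrow> nat"
  assumes A: "cellwise_conv idx An A" and B: "cellwise_conv idx Bn B"
    and P: "cellwise_conv idx Pn P" and Q: "cellwise_conv idx Qn Q"
    and ac: "absolutely_continuous lborel P" "absolutely_continuous lborel Q"
  shows "(\<lambda>n. ball_prod (An n) (Bn n) (Pn n) (Qn n)) \<longlonglongrightarrow> ball_prod A B P Q"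
proof -
  have PQ: "prob_space A" "prob_space B" "prob_space P" "prob_space Q"
    "sets A = sets borel" "sets B = sets borel" "sets P = sets borel" "sets Q = sets borel"
    using A B P Q by (auto simp: cellwise_conv_def)
  interpret A: prob_space A by (rule PQ)
  interpret B: prob_space B by (rule PQ)
  interpret P: prob_space P by (rule PQ)
  interpret Q: prob_space Q by (rule PQ)
  interpret PQ: pair_prob_space P Q ..
  interpret BPQ: pair_prob_space B "P \<Otimes>\<^sub>M Q" ..
  interpret ABPQ: pair_prob_space A "B \<Otimes>\<^sub>M (P \<Otimes>\<^sub>M Q)" ..
  have null: "emeasure R (sphere u r) = 0" if "absolutely_continuous lborel R" for R :: "'x measure" and u r
  proof -
    have "sphere u r \<in> null_sets lebesgue"
      using negligible_sphere[of u r] by (simp add: negligible_iff_null_sets)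
    then have "sphere u r \<in> null_sets lborel"
      by (auto simp: null_sets_def null_sets_completion_iff)
    then show ?thesis
      using that unfolding absolutely_continuous_def by blast
  qed
  define D :: "('x \<times> 'x \<times> 'x \<times> 'x) set" where "D = nearer_pairs - nearer_pairs_strict"
  have op: "open (nearer_pairs_strict :: ('x \<times> _) set)"
    unfolding nearer_pairs_strict_def case_prod_unfold
    by (intro open_Collect_conj open_Collect_less continuous_intros)
  have D: "D \<in> sets borel"
    unfolding D_def using op closed_nearer_pairs by (intro sets.Diff borel_closed borel_open)
  have s2: "sets (P \<Otimes>\<^sub>M Q) = sets borel" and s3: "sets (B \<Otimes>\<^sub>M (P \<Otimes>\<^sub>M Q)) = sets borel"
    and s4: "sets (A \<Otimes>\<^sub>M (B \<Otimes>\<^sub>M (P \<Otimes>\<^sub>M Q))) = sets borel"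
    by (intro sets_pair_borel PQ)+
  have sec: "emeasure (P \<Otimes>\<^sub>M Q) (Pair v -` (Pair u -` D)) = 0" for u v
  proof -
    have sub: "Pair v -` (Pair u -` D) \<subseteq> (sphere u (norm (v - u)) \<times> UNIV) \<union> (UNIV \<times> sphere u (norm (v - u)))"
      by (auto simp: D_def nearer_pairs_def nearer_pairs_strict_def dist_norm norm_minus_commute)
    have m: "sphere u (norm (v - u)) \<times> UNIV \<in> sets (P \<Otimes>\<^sub>M Q)" "UNIV \<times> sphere u (norm (v - u)) \<in> sets (P \<Otimes>\<^sub>M Q)"
      by (intro pair_measureI; simp add: PQ)+
    have "sphere u (norm (v - u)) \<times> UNIV \<in> null_sets (P \<Otimes>\<^sub>M Q)"
      "UNIV \<times> sphere u (norm (v - u)) \<in> null_sets (P \<Otimes>\<^sub>M Q)"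
      using m ac by (auto simp: null_sets_def Q.emeasure_pair_measure_Times PQ null)
    then have N: "(sphere u (norm (v - u)) \<times> UNIV) \<union> (UNIV \<times> sphere u (norm (v - u))) \<in> null_sets (P \<Otimes>\<^sub>M Q)"
      by (rule null_sets.Un)
    show ?thesis
      using emeasure_mono[OF sub null_setsD2[OF N]] null_setsD1[OF N] by simp
  qed
  have D3: "Pair u -` D \<in> sets borel" for u
  proof -
    have "Pair u \<in> borel_measurable borel"
      by (intro borel_measurable_continuous_onI continuous_intros)
    from measurable_sets[OF this D] show ?thesis by simp
  qed
  have "emeasure (A \<Otimes>\<^sub>M (B \<Otimes>\<^sub>M (P \<Otimes>\<^sub>M Q))) D
     = (\<integral>\<^sup>+u. \<integral>\<^sup>+v. emeasure (P \<Otimes>\<^sub>M Q) (Pair v -` (Pair u -` D)) \<partial>B \<partial>A)"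
    using D D3
    by (subst BPQ.emeasure_pair_measure_alt; (subst PQ.emeasure_pair_measure_alt)?; simp only: s3 s4)
  then have "measure (A \<Otimes>\<^sub>M (B \<Otimes>\<^sub>M (P \<Otimes>\<^sub>M Q))) D = 0"
    by (simp add: sec measure_def)
  then show ?thesis
    unfolding ball_prod_def
    by (intro cellwise_conv_closed[OF cellwise_conv_pair[OF A cellwise_conv_pair[OF B cellwise_conv_pair[OF P Q]]] op closed_nearer_pairs])
       (auto simp: D_def nearer_pairs_def nearer_pairs_strict_def)
qed

lemma ball_divergence_tendsto:
  fixes P Q :: "'x::euclidean_space measure" and idx :: "nat \<Rightarrow> 'x \<Rightarrow> nat"
  assumes P: "cellwise_conv idx Pn P" and Q: "cellwise_conv idx Qn Q"
    and ac: "absolutely_continuous lborel P" "absolutely_continuous lborel Q"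
  shows "(\<lambda>n. ball_divergence (Pn n) (Qn n)) \<longlonglongrightarrow> ball_divergence P Q"
proof -
  have "borel_subprob P" "borel_subprob Q" "borel_subprob (Pn n)" "borel_subprob (Qn n)" for n
    using P Q by (auto simp: cellwise_conv_def borel_subprob_def borel_subprob_axioms_def
        intro: prob_space_imp_subprob_space)
  then show ?thesis
    by (simp only: ball_divergence_eq) (intro tendsto_add tendsto_diff tendsto_mult tendsto_const ball_prod_tendsto[where idx=idx] P Q ac)
qed

section \<open>Continuity of translations in \<open>L\<^sup>1\<close>\<close>

text \<open>Sequences of shifts, rather than a limit over a neighbourhood filter, match dominated
  convergence, which works along sequences.\<close>

definition translation_continuous :: "('v::euclidean_space \<Rightarrow> real) \<Rightarrow> bool" where
  "translation_continuous g \<longleftrightarrow> (\<forall>t. t \<longlonglongrightarrow> 0 \<longrightarrow> (\<lambda>n. LINT v|lborel. \<bar>g (t n + v) - g v\<bar>) \<longlonglongrightarrow> 0)"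

lemma lborel_integral_translate:
  fixes g :: "'v::euclidean_space \<Rightarrow> real"
  assumes [measurable]: "g \<in> borel_measurable borel"
  shows "(LINT v|lborel. g (t + v)) = (LINT v|lborel. g v)"
  by (subst lborel_distr_plus[of t, symmetric]) (simp add: integral_distr)

lemma lborel_integrable_translate:
  fixes g :: "'v::euclidean_space \<Rightarrow> real"
  assumes "integrable lborel g"
  shows "integrable lborel (\<lambda>v. g (t + v))"
proof -
  have "integrable (distr lborel borel ((+) t)) g"
    using assms by (simp add: lborel_distr_plus)
  then show ?thesis by (subst (asm) integrable_distr_eq) (use assms in auto)
qed

text \<open>The usual three-term splitting. Lebesgue measure is translation invariant, so the
  shifted approximation error equals the unshifted one, and \<open>e / 3\<close> is spent on each of
  the three parts.\<close>

lemma translation_continuous_approx: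
  fixes g :: "'v::euclidean_space \<Rightarrow> real"
  assumes g: "integrable lborel g"
    and ap: "\<And>e. e > 0 \<Longrightarrow> \<exists>f. integrable lborel f \<and> translation_continuous f \<and> (LINT v|lborel. \<bar>f v - g v\<bar>) < e"
  shows "translation_continuous g"
  unfolding translation_continuous_def
proof (intro allI impI)
  fix t :: "nat \<Rightarrow> 'v" assume t: "t \<longlonglongrightarrow> 0"
  show "(\<lambda>n. LINT v|lborel. \<bar>g (t n + v) - g v\<bar>) \<longlonglongrightarrow> 0"
  proof (rule tendstoI)
    fix e :: real assume "e > 0"
    then obtain f where f: "integrable lborel f" "translation_continuous f" "(LINT v|lborel. \<bar>f v - g v\<bar>) < e / 3"
      using ap[of "e / 3"] by auto
    have [measurable]: "f \<in> borel_measurable borel" "g \<in> borel_measurable borel"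
      using f(1) g by auto
    have "(\<lambda>n. LINT v|lborel. \<bar>f (t n + v) - f v\<bar>) \<longlonglongrightarrow> 0"
      using f(2) t by (auto simp: translation_continuous_def)
    then have "\<forall>\<^sub>F n in sequentially. (LINT v|lborel. \<bar>f (t n + v) - f v\<bar>) < e / 3"
      using \<open>e > 0\<close> by (intro order_tendstoD(2)) auto
    then show "\<forall>\<^sub>F n in sequentially. dist (LINT v|lborel. \<bar>g (t n + v) - g v\<bar>) 0 < e"
    proof eventually_elim
      case (elim n)
      note i = lborel_integrable_translate[OF g, of "t n"] lborel_integrable_translate[OF f(1), of "t n"] g f(1)
      have tri: "\<bar>p - q\<bar> \<le> \<bar>r - p\<bar> + \<bar>r - s\<bar> + \<bar>s - q\<bar>" for p q r s :: real
        by linarith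
      have "(LINT v|lborel. \<bar>g (t n + v) - g v\<bar>)
        \<le> (LINT v|lborel. \<bar>f (t n + v) - g (t n + v)\<bar> + \<bar>f (t n + v) - f v\<bar> + \<bar>f v - g v\<bar>)"
        by (intro integral_mono integrable_abs Bochner_Integration.integrable_diff Bochner_Integration.integrable_add i) (rule tri)
      also have "\<dots> = (LINT v|lborel. \<bar>f (t n + v) - g (t n + v)\<bar>) + (LINT v|lborel. \<bar>f (t n + v) - f v\<bar>)
          + (LINT v|lborel. \<bar>f v - g v\<bar>)"
        using i by simp
      also have "(LINT v|lborel. \<bar>f (t n + v) - g (t n + v)\<bar>) = (LINT v|lborel. \<bar>f v - g v\<bar>)"
        by (rule lborel_integral_translate) simp
      finally show ?case using elim f(3) by (simp add: dist_real_def)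
    qed
  qed
qed

lemma translation_continuous_add:
  fixes f g :: "'v::euclidean_space \<Rightarrow> real"
  assumes i: "integrable lborel f" "integrable lborel g"
    and c: "translation_continuous f" "translation_continuous g"
  shows "translation_continuous (\<lambda>v. f v + g v)"
  unfolding translation_continuous_def
proof (intro allI impI)
  fix t :: "nat \<Rightarrow> 'v" assume t: "t \<longlonglongrightarrow> 0"
  note j = lborel_integrable_translate[OF i(1)] lborel_integrable_translate[OF i(2)] i
  show "(\<lambda>n. LINT v|lborel. \<bar>f (t n + v) + g (t n + v) - (f v + g v)\<bar>) \<longlonglongrightarrow> 0"
  proof (rule Lim_null_comparison)
    show "(\<lambda>n. (LINT v|lborel. \<bar>f (t n + v) - f v\<bar>) + (LINT v|lborel. \<bar>g (t n + v) - g v\<bar>)) \<longlonglongrightarrow> 0"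
      using c t unfolding translation_continuous_def by (intro tendsto_add_zero) auto
    show "\<forall>\<^sub>F n in sequentially. norm (LINT v|lborel. \<bar>f (t n + v) + g (t n + v) - (f v + g v)\<bar>)
      \<le> (LINT v|lborel. \<bar>f (t n + v) - f v\<bar>) + (LINT v|lborel. \<bar>g (t n + v) - g v\<bar>)"
    proof (intro always_eventually allI)
      fix n
      have tri: "\<bar>p + q - (r + s)\<bar> \<le> \<bar>p - r\<bar> + \<bar>q - s\<bar>" for p q r s :: real
        by linarith
      have "(LINT v|lborel. \<bar>f (t n + v) + g (t n + v) - (f v + g v)\<bar>)
        \<le> (LINT v|lborel. \<bar>f (t n + v) - f v\<bar> + \<bar>g (t n + v) - g v\<bar>)"
        by (intro integral_mono integrable_abs Bochner_Integration.integrable_diff Bochner_Integration.integrable_add j) (rule tri)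
      also have "\<dots> = (LINT v|lborel. \<bar>f (t n + v) - f v\<bar>) + (LINT v|lborel. \<bar>g (t n + v) - g v\<bar>)"
        using j by simp
      finally show "norm (LINT v|lborel. \<bar>f (t n + v) + g (t n + v) - (f v + g v)\<bar>)
      \<le> (LINT v|lborel. \<bar>f (t n + v) - f v\<bar>) + (LINT v|lborel. \<bar>g (t n + v) - g v\<bar>)" by simp
    qed
  qed
qed

lemma translation_continuous_scale:
  fixes f :: "'v::euclidean_space \<Rightarrow> real"
  assumes "translation_continuous f"
  shows "translation_continuous (\<lambda>v. f v * c)"
proof -
  have "(LINT v|lborel. \<bar>f (t + v) * c - f v * c\<bar>) = (LINT v|lborel. \<bar>f (t + v) - f v\<bar>) * \<bar>c\<bar>" for t
    by (simp add: left_diff_distrib[symmetric] abs_mult)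
  then show ?thesis
    using assms by (auto simp: translation_continuous_def intro!: tendsto_mult_left_zero)
qed

text \<open>For open \<open>U\<close> of finite measure, the positive part of \<open>1\<^sub>U(v) - 1\<^sub>U(t + v)\<close> tends
  to 0 pointwise, and it has the same integral as the negative part.\<close>

lemma translation_continuous_indicator_open:
  fixes U :: "'v::euclidean_space set"
  assumes U: "open U" and fin: "emeasure lborel U < \<infinity>"
  shows "translation_continuous (indicator U)"
  unfolding translation_continuous_def
proof (intro allI impI)
  fix t :: "nat \<Rightarrow> 'v" assume t: "t \<longlonglongrightarrow> 0"
  have [measurable]: "U \<in> sets borel" using U by simp
  have i: "integrable lborel (indicator U :: 'v \<Rightarrow> real)"
    using fin by (simp add: integrable_indicator_iff)
  note j = lborel_integrable_translate[OF i]
  have eq: "(LINT v|lborel. \<bar>indicator U (t n + v) - indicator U v :: real\<bar>)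
      = 2 * (LINT v|lborel. max 0 (indicator U v - indicator U (t n + v)))" for n
  proof -
    have "(LINT v|lborel. indicator U (t n + v) - indicator U v :: real) = 0"
      using i j[of "t n"] lborel_integral_translate[of "indicator U" "t n"] by simp
    moreover have "\<bar>indicator U (t n + v) - indicator U v :: real\<bar>
       = 2 * max 0 (indicator U v - indicator U (t n + v)) + (indicator U (t n + v) - indicator U v)" for v
      by (auto simp: max_def)
    ultimately show ?thesis
      using i j[of "t n"] by simp
  qed
  have "(\<lambda>n. LINT v|lborel. max 0 (indicator U v - indicator U (t n + v) :: real)) \<longlonglongrightarrow> (LINT v::'v|lborel. 0)"
  proof (rule integral_dominated_convergence)
    show "integrable lborel (indicator U :: 'v \<Rightarrow> real)" by (rule i)
    show "AE v in lborel. (\<lambda>n. max 0 (indicator U v - indicator U (t n + v) :: real)) \<longlonglongrightarrow> 0"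
    proof (rule AE_I2)
      fix v
      show "(\<lambda>n. max 0 (indicator U v - indicator U (t n + v) :: real)) \<longlonglongrightarrow> 0"
      proof (cases "v \<in> U")
        case True
        have "(\<lambda>n. t n + v) \<longlonglongrightarrow> 0 + v" by (intro tendsto_intros t)
        then have "\<forall>\<^sub>F n in sequentially. t n + v \<in> U"
          using topological_tendstoD[OF _ U] True by auto
        then have "\<forall>\<^sub>F n in sequentially. max 0 (indicator U v - indicator U (t n + v) :: real) = 0"
          by eventually_elim (use True in auto)
        then show ?thesis by (rule tendsto_eventually)
      next
        case False
        then have "max 0 (indicator U v - indicator U (t n + v) :: real) = 0" for n
          by (simp add: max_def indicator_def)
        then show ?thesis by simp
      qed
    qed
    show "AE v in lborel. norm (max 0 (indicator U v - indicator U (t n + v) :: real)) \<le> indicator U v" for n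
      by (auto simp: indicator_def)
  qed measurable
  then have "(\<lambda>n. 2 * (LINT v|lborel. max 0 (indicator U v - indicator U (t n + v) :: real))) \<longlonglongrightarrow> 2 * (LINT v::'v|lborel. 0)"
    by (rule tendsto_mult_left)
  then show "(\<lambda>n. LINT v|lborel. \<bar>indicator U (t n + v) - indicator U v :: real\<bar>) \<longlonglongrightarrow> 0"
    unfolding eq by simp
qed

text \<open>Outer regularity supplies an open superset with excess mass below \<open>e\<close>, and
  this excess is exactly the distance between the two indicators in mean.\<close>

lemma translation_continuous_indicator:
  fixes E :: "'v::euclidean_space set"
  assumes E[measurable]: "E \<in> sets borel" and fin: "emeasure lborel E < \<infinity>"
  shows "translation_continuous (indicator E)"
proof (rule translation_continuous_approx)
  show "integrable lborel (indicator E :: 'v \<Rightarrow> real)"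
    using fin by (simp add: integrable_indicator_iff)
  fix e :: real assume e: "e > 0"
  obtain U where U: "open U" "E \<subseteq> U" "emeasure lebesgue (U - E) < ennreal e"
    using sets_lebesgue_outer_open[OF _ e, of E] E by (metis sets_completionI_sets sets_lborel)
  have [measurable]: "U \<in> sets borel" using U by simp
  have UE: "emeasure lborel (U - E) < ennreal e"
    using U(3) by (simp add: emeasure_completion)
  have "emeasure lborel U = emeasure lborel (E \<union> (U - E))"
    using U(2) by (intro arg_cong[where f="emeasure lborel"]) auto
  also have "\<dots> \<le> emeasure lborel E + emeasure lborel (U - E)"
    by (rule emeasure_subadditive) auto
  also have "\<dots> < \<infinity>"
    using fin less_trans[OF UE ennreal_less_top] by (simp add: less_top ennreal_add_eq_top)
  finally have finU: "emeasure lborel U < \<infinity>" .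
  have "(LINT v|lborel. \<bar>indicator U v - indicator E v :: real\<bar>) = (LINT v|lborel. indicator (U - E) v)"
    by (intro Bochner_Integration.integral_cong refl) (use U(2) in \<open>simp add: indicator_def subset_iff\<close>)
  also have "\<dots> = measure lborel (U - E)" by simp
  also have "\<dots> < e"
  proof -
    have "emeasure lborel (U - E) \<noteq> \<top>" using less_trans[OF UE ennreal_less_top] by simp
    then show ?thesis using UE by (simp add: emeasure_eq_ennreal_measure ennreal_less_iff)
  qed
  finally show "\<exists>f::'v \<Rightarrow> real. integrable lborel f \<and> translation_continuous f \<and> (LINT v|lborel. \<bar>f v - indicator E v\<bar>) < e"
    using translation_continuous_indicator_open[OF U(1) finU] finU
    by (intro exI[of _ "indicator U"]) (simp add: integrable_indicator_iff)
qed

lemma integrable_imp_translation_continuous: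
  fixes g :: "'v::euclidean_space \<Rightarrow> real"
  assumes "integrable lborel g"
  shows "translation_continuous g"
  using assms
proof (induct rule: integrable_induct)
  case (base A c)
  then show ?case
    using translation_continuous_scale[OF translation_continuous_indicator, of A c] by simp
next
  case (add f g)
  then show ?case by (intro translation_continuous_add)
next
  case (lim f s)
  show ?case
  proof (rule translation_continuous_approx)
    show "integrable lborel f" by fact
    fix e :: real assume "e > 0"
    have "(\<lambda>i. LINT v|lborel. \<bar>s i v - f v\<bar>) \<longlonglongrightarrow> (LINT v::'v|lborel. 0)"
    proof (rule integral_dominated_convergence)
      \<comment> \<open>The induction rule provides approximants with
        \<open>\<bar>s i v\<bar> \<le> 2 * \<bar>f v\<bar>\<close>; adding
        \<open>\<bar>f v\<bar>\<close> for the limit gives the factor 3.\<close>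
      show "integrable lborel (\<lambda>v. 3 * \<bar>f v\<bar>)" using lim by simp
      show "AE v in lborel. (\<lambda>i. \<bar>s i v - f v\<bar>) \<longlonglongrightarrow> 0"
        by (intro AE_I2 tendsto_rabs_zero LIM_zero) (rule lim(3), simp)
      show "AE v in lborel. norm \<bar>s i v - f v\<bar> \<le> 3 * \<bar>f v\<bar>" for i
      proof (rule AE_I2)
        fix v :: 'v
        have "\<bar>s i v\<bar> \<le> 2 * \<bar>f v\<bar>" using lim(4)[of v i] by simp
        then show "norm \<bar>s i v - f v\<bar> \<le> 3 * \<bar>f v\<bar>" by simp
      qed
      show "(\<lambda>v. \<bar>s i v - f v\<bar>) \<in> borel_measurable lborel" for i
        by (intro borel_measurable_integrable integrable_abs Bochner_Integration.integrable_diff lim)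
    qed simp
    then have "\<forall>\<^sub>F i in sequentially. (LINT v|lborel. \<bar>s i v - f v\<bar>) < e"
      using \<open>e > 0\<close> by (intro order_tendstoD(2)) auto
    then obtain i where "(LINT v|lborel. \<bar>s i v - f v\<bar>) < e"
      by (auto simp: eventually_sequentially)
    then show "\<exists>h. integrable lborel h \<and> translation_continuous h \<and> (LINT v|lborel. \<bar>h v - f v\<bar>) < e"
      by (intro exI[of _ "s i"] conjI lim)
  qed
qed

section \<open>Independent sums and joint densities\<close>

text \<open>Independence as a product law, followed by Tonelli. It allows the evaluation point to be
  frozen while the rest of the sample is integrated out.\<close>

lemma (in prob_space) nn_integral_indep_var:
  assumes "indep_var S X T Y" and [measurable]: "F \<in> borel_measurable (S \<Otimes>\<^sub>M T)"
  shows "(\<integral>\<^sup>+\<omega>. F (X \<omega>, Y \<omega>) \<partial>M) = (\<integral>\<^sup>+\<omega>. \<integral>\<^sup>+\<omega>'. F (X \<omega>, Y \<omega>') \<partial>M \<partial>M)"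
proof -
  have [measurable]: "X \<in> M \<rightarrow>\<^sub>M S" "Y \<in> M \<rightarrow>\<^sub>M T"
    and eq: "distr M S X \<Otimes>\<^sub>M distr M T Y = distr M (S \<Otimes>\<^sub>M T) (\<lambda>\<omega>. (X \<omega>, Y \<omega>))"
    using assms(1) by (auto simp: indep_var_distribution_eq)
  interpret Y: prob_space "distr M T Y" by (rule prob_space_distr) simp
  have F': "F \<in> borel_measurable (distr M S X \<Otimes>\<^sub>M distr M T Y)"
    by simp
  have "(\<integral>\<^sup>+\<omega>. F (X \<omega>, Y \<omega>) \<partial>M) = (\<integral>\<^sup>+z. F z \<partial>(distr M (S \<Otimes>\<^sub>M T) (\<lambda>\<omega>. (X \<omega>, Y \<omega>))))"
    by (simp add: nn_integral_distr)
  also have "\<dots> = (\<integral>\<^sup>+x. \<integral>\<^sup>+y. F (x, y) \<partial>distr M T Y \<partial>distr M S X)"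
    unfolding eq[symmetric] by (rule Y.nn_integral_fst[symmetric, OF F'])
  also have "\<dots> = (\<integral>\<^sup>+x. \<integral>\<^sup>+\<omega>'. F (x, Y \<omega>') \<partial>M \<partial>distr M S X)"
    by (intro nn_integral_cong) (simp add: nn_integral_distr)
  also have "\<dots> = (\<integral>\<^sup>+\<omega>. \<integral>\<^sup>+\<omega>'. F (X \<omega>, Y \<omega>') \<partial>M \<partial>M)"
    by (simp add: nn_integral_distr)
  finally show ?thesis .
qed

text \<open>Off-diagonal products of the centred variables have mean 0 by independence, and a
  variance is at most the second moment. The bound \<open>B\<close> supplies integrability.\<close>

lemma (in prob_space) expectation_square_centered_sum:
  fixes Y :: "'i \<Rightarrow> 'a \<Rightarrow> real"
  assumes I: "finite I" and ind: "indep_vars (\<lambda>_. borel) Y I"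
    and bd: "\<And>i \<omega>. i \<in> I \<Longrightarrow> \<omega> \<in> space M \<Longrightarrow> \<bar>Y i \<omega>\<bar> \<le> B"
  shows "expectation (\<lambda>\<omega>. (\<Sum>i\<in>I. Y i \<omega> - expectation (Y i))\<^sup>2) \<le> (\<Sum>i\<in>I. expectation (\<lambda>\<omega>. (Y i \<omega>)\<^sup>2))"
proof -
  define Z where "Z i \<omega> = Y i \<omega> - expectation (Y i)" for i \<omega>
  have Y[measurable]: "Y i \<in> borel_measurable M" if "i \<in> I" for i
    using ind that by (auto simp: indep_vars_def)
  have intY: "integrable M (Y i)" if "i \<in> I" for i
    by (rule integrable_const_bound[of _ B]) (use bd Y that in auto)
  have intY2: "integrable M (\<lambda>\<omega>. (Y i \<omega>)\<^sup>2)" if "i \<in> I" for i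
  proof (rule integrable_const_bound[of _ "B\<^sup>2"])
    show "AE \<omega> in M. norm ((Y i \<omega>)\<^sup>2) \<le> B\<^sup>2"
    proof (rule AE_I2)
      fix \<omega> assume "\<omega> \<in> space M"
      then have "\<bar>Y i \<omega>\<bar> ^ 2 \<le> B ^ 2" by (intro power_mono bd that) auto
      then show "norm ((Y i \<omega>)\<^sup>2) \<le> B\<^sup>2" by simp
    qed
  qed (use Y[OF that] in measurable)
  have indZ: "indep_vars (\<lambda>_. borel) Z I"
    unfolding Z_def[abs_def] by (rule indep_vars_compose2[OF ind]) auto
  have intZ: "integrable M (Z i)" and expZ: "expectation (Z i) = 0" if "i \<in> I" for i
    unfolding Z_def using intY[OF that] by (auto simp: prob_space)
  have offdiag: "integrable M (\<lambda>\<omega>. Z i \<omega> * Z j \<omega>) \<and> expectation (\<lambda>\<omega>. Z i \<omega> * Z j \<omega>) = 0"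
    if "i \<in> I" "j \<in> I" "i \<noteq> j" for i j
  proof -
    have "indep_vars (\<lambda>_. borel) Z {i, j}"
      by (rule indep_vars_subset[OF indZ]) (use that in auto)
    from indep_vars_lebesgue_integral[OF _ this] indep_vars_integrable[OF _ this] that intZ expZ
    show ?thesis by auto
  qed
  have diag: "integrable M (\<lambda>\<omega>. Z i \<omega> * Z i \<omega>) \<and> expectation (\<lambda>\<omega>. Z i \<omega> * Z i \<omega>) \<le> expectation (\<lambda>\<omega>. (Y i \<omega>)\<^sup>2)"
    if "i \<in> I" for i
  proof -
    have "integrable M (\<lambda>\<omega>. (Y i \<omega>)\<^sup>2 - 2 * expectation (Y i) * Y i \<omega> + (expectation (Y i))\<^sup>2)"
      using intY2[OF that] intY[OF that] by simp
    also have "(\<lambda>\<omega>. (Y i \<omega>)\<^sup>2 - 2 * expectation (Y i) * Y i \<omega> + (expectation (Y i))\<^sup>2) = (\<lambda>\<omega>. Z i \<omega> * Z i \<omega>)"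
      by (auto simp: Z_def power2_eq_square algebra_simps)
    finally show ?thesis
      using variance_eq[OF intY[OF that] intY2[OF that]] by (simp add: Z_def power2_eq_square)
  qed
  have int: "integrable M (\<lambda>\<omega>. Z i \<omega> * Z j \<omega>)" if "i \<in> I" "j \<in> I" for i j
    using diag offdiag that by (cases "i = j") auto
  have "expectation (\<lambda>\<omega>. (\<Sum>i\<in>I. Z i \<omega>)\<^sup>2) = expectation (\<lambda>\<omega>. \<Sum>i\<in>I. \<Sum>j\<in>I. Z i \<omega> * Z j \<omega>)"
    by (simp add: power2_eq_square sum_product)
  also have "\<dots> = (\<Sum>i\<in>I. \<Sum>j\<in>I. expectation (\<lambda>\<omega>. Z i \<omega> * Z j \<omega>))"
    using int by (simp add: Bochner_Integration.integral_sum Bochner_Integration.integrable_sum)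
  also have "\<dots> = (\<Sum>i\<in>I. expectation (\<lambda>\<omega>. Z i \<omega> * Z i \<omega>))"
  proof (intro sum.cong refl)
    fix i assume i: "i \<in> I"
    have "(\<Sum>j\<in>I. expectation (\<lambda>\<omega>. Z i \<omega> * Z j \<omega>)) = (\<Sum>j\<in>{i}. expectation (\<lambda>\<omega>. Z i \<omega> * Z j \<omega>))"
      by (intro sum.mono_neutral_right) (use I i offdiag in auto)
    then show "(\<Sum>j\<in>I. expectation (\<lambda>\<omega>. Z i \<omega> * Z j \<omega>)) = expectation (\<lambda>\<omega>. Z i \<omega> * Z i \<omega>)" by simp
  qed
  also have "\<dots> \<le> (\<Sum>i\<in>I. expectation (\<lambda>\<omega>. (Y i \<omega>)\<^sup>2))"
    by (intro sum_mono) (use diag in auto)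
  finally show ?thesis by (simp add: Z_def)
qed

lemma (in prob_space) expectation_abs_le_sqrt:
  fixes Y :: "'a \<Rightarrow> real"
  assumes "integrable M Y" "integrable M (\<lambda>\<omega>. (Y \<omega>)\<^sup>2)"
  shows "expectation (\<lambda>\<omega>. \<bar>Y \<omega>\<bar>) \<le> sqrt (expectation (\<lambda>\<omega>. (Y \<omega>)\<^sup>2))"
proof -
  have "0 \<le> variance (\<lambda>\<omega>. \<bar>Y \<omega>\<bar>)" by (rule variance_positive)
  also have "variance (\<lambda>\<omega>. \<bar>Y \<omega>\<bar>) = expectation (\<lambda>\<omega>. (Y \<omega>)\<^sup>2) - (expectation (\<lambda>\<omega>. \<bar>Y \<omega>\<bar>))\<^sup>2"
    using assms by (subst variance_eq) auto
  finally show ?thesis by (intro real_le_rsqrt) simp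
qed

lemma nn_integral_lborel_affine:
  fixes \<phi> :: "'v::euclidean_space \<Rightarrow> ennreal"
  assumes [measurable]: "\<phi> \<in> borel_measurable borel" and h: "h > 0"
  shows "(\<integral>\<^sup>+v. \<phi> v \<partial>lborel) = ennreal (h ^ DIM('v)) * (\<integral>\<^sup>+u. \<phi> (t + h *\<^sub>R u) \<partial>lborel)"
  by (subst lborel_affine[of h t])
     (use h in \<open>simp_all add: nn_integral_density nn_integral_distr nn_integral_cmult\<close>)

text \<open>The conditioning variable is abstract so that one analysis serves both
  \<open>(Y, Z)\<close> with the joint density and \<open>Z\<close> with the density of
  \<open>(X, Z)\<close>. The constant \<open>C\<close> bounds the density of the conditioning
  variable at every point.\<close>

locale iid_density = prob_space M for M :: "'w measure" +
  fixes X :: "nat \<Rightarrow> 'w \<Rightarrow> 'x::euclidean_space" and V :: "nat \<Rightarrow> 'w \<Rightarrow> 'v::euclidean_space"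
    and f :: "'x \<times> 'v \<Rightarrow> real" and C :: real
  assumes indep: "indep_vars (\<lambda>_. borel) (\<lambda>i \<omega>. (X i \<omega>, V i \<omega>)) {1..}"
    and law: "\<And>i. i \<ge> 1 \<Longrightarrow> distr M borel (\<lambda>\<omega>. (X i \<omega>, V i \<omega>)) = density lborel (\<lambda>w. ennreal (f w))"
    and f_measurable[measurable]: "f \<in> borel_measurable borel"
    and f_nonneg: "\<And>w. 0 \<le> f w"
    and f_bound: "\<And>v. (\<integral>\<^sup>+x. ennreal (f (x, v)) \<partial>lborel) \<le> ennreal C"
    and C_nonneg: "0 \<le> C"
begin

text \<open>For \<open>A = UNIV\<close> this is the marginal density of \<open>V\<close>, and the
  ratio to that value is the conditional probability of \<open>A\<close>.\<close>

definition section_mass :: "'x set \<Rightarrow> 'v \<Rightarrow> real" where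
  "section_mass A v = (LINT x|lborel. indicator A x * f (x, v))"

lemma f_measurable'[measurable]: "f \<in> borel_measurable (borel \<Otimes>\<^sub>M borel)"
  using f_measurable by (simp add: borel_prod)

lemma measurable_pair: "i \<ge> 1 \<Longrightarrow> (\<lambda>\<omega>. (X i \<omega>, V i \<omega>)) \<in> M \<rightarrow>\<^sub>M borel"
  using indep by (auto simp: indep_vars_def)

lemma measurable_X[measurable]: "i \<ge> 1 \<Longrightarrow> X i \<in> M \<rightarrow>\<^sub>M borel"
  and measurable_V[measurable]: "i \<ge> 1 \<Longrightarrow> V i \<in> M \<rightarrow>\<^sub>M borel"
  using measurable_compose[OF measurable_pair, of i fst borel] measurable_compose[OF measurable_pair, of i snd borel]
  by (auto simp: borel_prod[symmetric])

lemma nn_integral_f_le: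
  assumes [measurable]: "A \<in> sets borel"
  shows "(\<integral>\<^sup>+x. ennreal (indicator A x * f (x, v)) \<partial>lborel) \<le> ennreal C"
proof -
  have "(\<integral>\<^sup>+x. ennreal (indicator A x * f (x, v)) \<partial>lborel) \<le> (\<integral>\<^sup>+x. ennreal (f (x, v)) \<partial>lborel)"
    by (intro nn_integral_mono ennreal_leI) (auto simp: indicator_def f_nonneg)
  also have "\<dots> \<le> ennreal C" by (rule f_bound)
  finally show ?thesis .
qed

text \<open>The bound \<open>C\<close> makes every section integral finite, so no information is
  lost in passing to a real value.\<close>

lemma section_mass_ennreal:
  assumes [measurable]: "A \<in> sets borel"
  shows "ennreal (section_mass A v) = (\<integral>\<^sup>+x. ennreal (indicator A x * f (x, v)) \<partial>lborel)"
proof -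
  have "section_mass A v = enn2real (\<integral>\<^sup>+x. ennreal (indicator A x * f (x, v)) \<partial>lborel)"
    unfolding section_mass_def by (rule integral_eq_nn_integral) (auto simp: f_nonneg)
  then show ?thesis
    using nn_integral_f_le[OF assms, of v] by (simp add: order_le_less_trans[OF _ ennreal_less_top])
qed

lemma section_mass_nonneg: "0 \<le> section_mass A v"
  unfolding section_mass_def by (rule Bochner_Integration.integral_nonneg) (simp add: f_nonneg)

lemma section_mass_le: "A \<in> sets borel \<Longrightarrow> section_mass A v \<le> C"
  using nn_integral_f_le[of A v] by (simp add: section_mass_ennreal[symmetric] ennreal_le_iff C_nonneg)

lemma section_mass_measurable[measurable]:
  assumes [measurable]: "A \<in> sets borel"
  shows "section_mass A \<in> borel_measurable borel"
  unfolding section_mass_def[abs_def] by measurable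

text \<open>Tonelli with \<open>x\<close> integrated first. With \<open>A = UNIV\<close> it says
  that \<open>V i\<close> has density \<open>section_mass UNIV\<close>; with \<open>\<phi>\<close>
  an indicator it describes the joint law on rectangles.\<close>

lemma nn_integral_law:
  assumes i: "i \<ge> 1" and [measurable]: "A \<in> sets borel" "\<phi> \<in> borel_measurable borel"
  shows "(\<integral>\<^sup>+\<omega>. \<phi> (V i \<omega>) * indicator A (X i \<omega>) \<partial>M) = (\<integral>\<^sup>+v. \<phi> v * ennreal (section_mass A v) \<partial>lborel)"
proof -
  note [measurable] = measurable_pair[OF i]
  have m: "(\<lambda>w. \<phi> (snd w) * indicator A (fst w)) \<in> borel_measurable borel"
    unfolding borel_prod[symmetric] by measurable
  have "(\<integral>\<^sup>+\<omega>. \<phi> (V i \<omega>) * indicator A (X i \<omega>) \<partial>M)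
     = (\<integral>\<^sup>+w. \<phi> (snd w) * indicator A (fst w) \<partial>distr M borel (\<lambda>\<omega>. (X i \<omega>, V i \<omega>)))"
    by (subst nn_integral_distr) (use m in auto)
  also have "\<dots> = (\<integral>\<^sup>+w. ennreal (f w) * (\<phi> (snd w) * indicator A (fst w)) \<partial>lborel)"
    unfolding law[OF i] by (rule nn_integral_density) (use m in auto)
  also have "\<dots> = (\<integral>\<^sup>+w. ennreal (f w) * (\<phi> (snd w) * indicator A (fst w)) \<partial>(lborel \<Otimes>\<^sub>M lborel))"
    by (simp add: lborel_prod)
  also have "\<dots> = (\<integral>\<^sup>+v. \<integral>\<^sup>+x. ennreal (f (x, v)) * (\<phi> v * indicator A x) \<partial>lborel \<partial>lborel)"
    by (subst lborel_pair.nn_integral_snd[symmetric]) (auto simp: f_measurable')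
  also have "\<dots> = (\<integral>\<^sup>+v. \<phi> v * ennreal (section_mass A v) \<partial>lborel)"
  proof (intro nn_integral_cong)
    fix v
    have "(\<integral>\<^sup>+x. ennreal (f (x, v)) * (\<phi> v * indicator A x) \<partial>lborel)
      = (\<integral>\<^sup>+x. \<phi> v * ennreal (indicator A x * f (x, v)) \<partial>lborel)"
      by (intro nn_integral_cong) (auto simp: indicator_def mult.commute)
    also have "\<dots> = \<phi> v * (\<integral>\<^sup>+x. ennreal (indicator A x * f (x, v)) \<partial>lborel)"
      by (rule nn_integral_cmult) simp
    finally show "(\<integral>\<^sup>+x. ennreal (f (x, v)) * (\<phi> v * indicator A x) \<partial>lborel) = \<phi> v * ennreal (section_mass A v)"
      by (simp add: section_mass_ennreal)
  qed
  finally show ?thesis .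
qed

lemma nn_integral_section_mass_le_1:
  assumes [measurable]: "A \<in> sets borel"
  shows "(\<integral>\<^sup>+v. ennreal (section_mass A v) \<partial>lborel) \<le> 1"
proof -
  have "(\<integral>\<^sup>+v. ennreal (section_mass A v) \<partial>lborel) = (\<integral>\<^sup>+\<omega>. indicator A (X 1 \<omega>) \<partial>M)"
    using nn_integral_law[of 1 A "\<lambda>_. 1"] assms by simp
  also have "\<dots> \<le> (\<integral>\<^sup>+\<omega>. 1 \<partial>M)"
    by (intro nn_integral_mono) (auto simp: indicator_def)
  finally show ?thesis by (simp add: emeasure_space_1)
qed

lemma section_mass_integrable:
  assumes [measurable]: "A \<in> sets borel"
  shows "integrable lborel (section_mass A)"
  using nn_integral_section_mass_le_1[OF assms]
  by (intro integrableI_nonneg) (auto simp: section_mass_nonneg intro: le_less_trans)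

text \<open>The density integrates to 0 over its own zero set. This makes the later quotients
  legitimate almost surely.\<close>

lemma AE_density_pos: "i \<ge> 1 \<Longrightarrow> AE \<omega> in M. section_mass UNIV (V i \<omega>) > 0"
proof -
  assume i: "i \<ge> 1"
  note [measurable] = measurable_V[OF i]
  have [measurable]: "{v. section_mass UNIV v = 0} \<in> sets borel"
    using measurable_sets[of "section_mass UNIV" borel borel "{0}"] by (simp add: vimage_def)
  have "(\<integral>\<^sup>+\<omega>. indicator {v. section_mass UNIV v = 0} (V i \<omega>) * indicator UNIV (X i \<omega>) \<partial>M)
      = (\<integral>\<^sup>+v. indicator {v. section_mass UNIV v = 0} v * ennreal (section_mass UNIV v) \<partial>lborel)"
    by (rule nn_integral_law[OF i]) auto
  also have "\<dots> = 0"
    by (subst nn_integral_0_iff_AE) (auto simp: indicator_def)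
  finally have "AE \<omega> in M. indicator {v. section_mass UNIV v = 0} (V i \<omega>) * indicator UNIV (X i \<omega>) = (0::ennreal)"
    by (subst (asm) nn_integral_0_iff_AE) auto
  then show ?thesis
    by eventually_elim (use section_mass_nonneg[of UNIV] in \<open>auto simp: indicator_def less_le split: if_splits\<close>)
qed

text \<open>The index blocks \<open>{1}\<close> and \<open>{2..n}\<close> are disjoint, so the
  evaluation point \<open>V 1\<close> is independent of the remaining observations and may be drawn
  separately.\<close>

lemma nn_integral_decouple:
  assumes [measurable]: "F \<in> borel_measurable (borel \<Otimes>\<^sub>M PiM {2..n} (\<lambda>_. borel :: ('x \<times> 'v) measure))"
  shows "(\<integral>\<^sup>+\<omega>. F (V 1 \<omega>, \<lambda>i\<in>{2..n}. (X i \<omega>, V i \<omega>)) \<partial>M)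
    = (\<integral>\<^sup>+\<omega>. \<integral>\<^sup>+\<omega>'. F (V 1 \<omega>, \<lambda>i\<in>{2..n}. (X i \<omega>', V i \<omega>')) \<partial>M \<partial>M)"
proof -
  have ind: "indep_var (PiM {1} (\<lambda>_. borel)) (\<lambda>\<omega>. \<lambda>i\<in>{1}. (X i \<omega>, V i \<omega>))
     (PiM {2..n} (\<lambda>_. borel)) (\<lambda>\<omega>. \<lambda>i\<in>{2..n}. (X i \<omega>, V i \<omega>))"
    by (rule indep_var_restrict[OF indep]) auto
  have meas: "(\<lambda>st. F (snd (fst st 1), snd st)) \<in> borel_measurable
     (PiM {1} (\<lambda>_. borel :: ('x \<times> 'v) measure) \<Otimes>\<^sub>M PiM {2..n} (\<lambda>_. borel))"
  proof -
    have "(\<lambda>t. t 1) \<in> PiM {1::nat} (\<lambda>_. borel :: ('x \<times> 'v) measure) \<rightarrow>\<^sub>M borel"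
      by (rule measurable_component_singleton) simp
    note [measurable] = measurable_compose[OF measurable_fst this]
    have [measurable]: "snd \<in> (borel :: ('x \<times> 'v) measure) \<rightarrow>\<^sub>M borel"
      unfolding borel_prod[symmetric] by measurable
    show ?thesis by measurable
  qed
  from nn_integral_indep_var[OF ind meas] show ?thesis by simp
qed

end

section \<open>Kernel averages\<close>

locale kernel_sample = iid_density M X V f C
  for M :: "'w measure" and X :: "nat \<Rightarrow> 'w \<Rightarrow> 'x::euclidean_space"
    and V :: "nat \<Rightarrow> 'w \<Rightarrow> 'v::euclidean_space" and f :: "'x \<times> 'v \<Rightarrow> real" and C :: real +
  fixes K :: "real \<Rightarrow> real" and B :: real
  assumes K_nonneg: "\<And>t. 0 \<le> K t" and K_le: "\<And>t. K t \<le> B"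
    and K_norm: "has_bochner_integral lborel (\<lambda>u::'v. K (norm u)) 1"
begin

lemma B_nonneg: "0 \<le> B"
  using K_nonneg[of 0] K_le[of 0] by linarith

lemma K_measurable[measurable]: "(\<lambda>u::'v. K (norm u)) \<in> borel_measurable borel"
  using borel_measurable_has_bochner_integral[OF K_norm] by simp

text \<open>Measurability is known for \<open>K\<close> composed with the norm of a vector, so the
  division by \<open>h\<close> is moved inside the norm as a scaling.\<close>

lemma kernel_measurable[measurable]:
  assumes [measurable]: "\<phi> \<in> N \<rightarrow>\<^sub>M borel" "\<psi> \<in> N \<rightarrow>\<^sub>M (borel :: 'v measure)" and h: "h > 0"
  shows "(\<lambda>w. K (norm (\<phi> w - \<psi> w) / h)) \<in> borel_measurable N"
proof -
  have "(\<lambda>w. K (norm ((1 / h) *\<^sub>R (\<phi> w - \<psi> w)))) \<in> borel_measurable N"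
    by measurable
  then show ?thesis using h by simp
qed

lemma nn_integral_K: "(\<integral>\<^sup>+u. ennreal (K (norm (u::'v))) \<partial>lborel) = 1"
  using K_norm K_nonneg
  by (subst nn_integral_eq_integral) (auto simp: has_bochner_integral_iff)

text \<open>The convolution of \<open>section_mass A\<close> with the kernel at scale
  \<open>h\<close>, written after the substitution that removes the factor
  \<open>h ^ DIM('v)\<close>.\<close>

definition smooth :: "'x set \<Rightarrow> real \<Rightarrow> 'v \<Rightarrow> real" where
  "smooth A h v = (LINT u|lborel. K (norm u) * section_mass A (v + h *\<^sub>R u))"

lemma smooth_integrable:
  assumes [measurable]: "A \<in> sets borel"
  shows "integrable lborel (\<lambda>u. K (norm u) * section_mass A (v + h *\<^sub>R u))"
proof (rule Bochner_Integration.integrable_bound)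
  show "integrable lborel (\<lambda>u::'v. K (norm u) * C)"
    using K_norm by (auto simp: has_bochner_integral_iff)
  show "AE u in lborel. norm (K (norm u) * section_mass A (v + h *\<^sub>R u)) \<le> norm (K (norm u) * C)"
    using section_mass_le[OF assms] by (auto simp: abs_mult section_mass_nonneg K_nonneg C_nonneg intro!: mult_left_mono)
qed measurable

lemma smooth_ennreal:
  assumes [measurable]: "A \<in> sets borel"
  shows "ennreal (smooth A h v) = (\<integral>\<^sup>+u. ennreal (K (norm u)) * ennreal (section_mass A (v + h *\<^sub>R u)) \<partial>lborel)"
  unfolding smooth_def
  by (subst nn_integral_eq_integral[OF smooth_integrable[OF assms], symmetric])
     (auto simp: K_nonneg section_mass_nonneg ennreal_mult)

lemma smooth_nonneg: "0 \<le> smooth A h v"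
  unfolding smooth_def by (intro Bochner_Integration.integral_nonneg mult_nonneg_nonneg K_nonneg section_mass_nonneg)

lemma smooth_le:
  assumes "A \<in> sets borel"
  shows "smooth A h v \<le> C"
proof -
  have "smooth A h v \<le> (LINT u|lborel. K (norm (u::'v)) * C)"
    unfolding smooth_def
    using K_norm by (intro integral_mono smooth_integrable assms mult_left_mono section_mass_le K_nonneg)
      (auto simp: has_bochner_integral_iff)
  also have "\<dots> = C"
    using K_norm by (simp add: has_bochner_integral_iff)
  finally show ?thesis .
qed

lemma smooth_measurable[measurable]:
  assumes [measurable]: "A \<in> sets borel"
  shows "smooth A h \<in> borel_measurable borel"
  unfolding smooth_def[abs_def] by measurable

lemma expectation_kernel:
  assumes i: "i \<ge> 1" and h: "h > 0" and [measurable]: "A \<in> sets borel"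
  shows "expectation (\<lambda>\<omega>. K (norm (v - V i \<omega>) / h) * indicator A (X i \<omega>)) = h ^ DIM('v) * smooth A h v"
proof -
  note [measurable] = measurable_X[OF i] measurable_V[OF i]
  have [measurable]: "(\<lambda>v'. K (norm (v - v') / h)) \<in> borel_measurable borel"
    using h by measurable
  have "(\<integral>\<^sup>+\<omega>. ennreal (K (norm (v - V i \<omega>) / h) * indicator A (X i \<omega>)) \<partial>M)
     = (\<integral>\<^sup>+\<omega>. ennreal (K (norm (v - V i \<omega>) / h)) * indicator A (X i \<omega>) \<partial>M)"
    by (intro nn_integral_cong) (auto simp: indicator_def)
  also have "\<dots> = (\<integral>\<^sup>+v'. ennreal (K (norm (v - v') / h)) * ennreal (section_mass A v') \<partial>lborel)"
    by (rule nn_integral_law[OF i]) auto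
  \<comment> \<open>Substitution of \<open>v + h u\<close> for the integration variable, with
    Jacobian \<open>h ^ DIM('v)\<close>. Since the kernel sees only the norm, the sign of the
    displacement does not matter.\<close>
  also have "\<dots> = ennreal (h ^ DIM('v)) *
      (\<integral>\<^sup>+u. ennreal (K (norm (v - (v + h *\<^sub>R u)) / h)) * ennreal (section_mass A (v + h *\<^sub>R u)) \<partial>lborel)"
    by (rule nn_integral_lborel_affine) (use h in auto)
  also have "\<dots> = ennreal (h ^ DIM('v)) * ennreal (smooth A h v)"
    using h by (simp add: smooth_ennreal[OF assms(3)])
  finally have *: "(\<integral>\<^sup>+\<omega>. ennreal (K (norm (v - V i \<omega>) / h) * indicator A (X i \<omega>)) \<partial>M)
     = ennreal (h ^ DIM('v) * smooth A h v)"
    using h by (simp add: ennreal_mult smooth_nonneg)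
  have "expectation (\<lambda>\<omega>. K (norm (v - V i \<omega>) / h) * indicator A (X i \<omega>))
     = enn2real (\<integral>\<^sup>+\<omega>. ennreal (K (norm (v - V i \<omega>) / h) * indicator A (X i \<omega>)) \<partial>M)"
    by (rule integral_eq_nn_integral) (use h in \<open>auto simp: K_nonneg\<close>)
  then show ?thesis
    using h by (simp add: * smooth_nonneg)
qed

text \<open>The error in mean is at most the \<open>K\<close>-average over \<open>u\<close> of the
  translation error \<open>L\<close> at the shift \<open>h u\<close>, by Tonelli. Each of these
  errors tends to 0 by continuity of translations, and they are dominated.\<close>

lemma bias_tendsto_0:
  assumes A[measurable]: "A \<in> sets borel" and h: "h \<longlonglongrightarrow> 0"
  shows "(\<lambda>n. \<integral>\<^sup>+v. ennreal \<bar>smooth A (h n) v - section_mass A v\<bar> \<partial>lborel) \<longlonglongrightarrow> 0"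
proof -
  define L where "L t = (\<integral>\<^sup>+v. ennreal \<bar>section_mass A (t + v) - section_mass A v\<bar> \<partial>lborel)" for t
  note gi = section_mass_integrable[OF A]
  note gt = lborel_integrable_translate[OF gi]
  have L_eq: "L t = ennreal (LINT v|lborel. \<bar>section_mass A (t + v) - section_mass A v\<bar>)" for t
    unfolding L_def by (rule nn_integral_eq_integral) (use gi gt in auto)
  \<comment> \<open>Each of the two shifted copies has total mass at most 1, which gives the
    dominating constant 2.\<close>
  have L_le: "L t \<le> 2" for t
  proof -
    have tr: "(\<integral>\<^sup>+v. ennreal (section_mass A (t + v)) \<partial>lborel) = (\<integral>\<^sup>+v. ennreal (section_mass A v) \<partial>lborel)"
      using nn_integral_lborel_affine[of "\<lambda>v. ennreal (section_mass A v)" 1 t] by simp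
    have "L t \<le> (\<integral>\<^sup>+v. ennreal (section_mass A (t + v)) + ennreal (section_mass A v) \<partial>lborel)"
      unfolding L_def
      by (intro nn_integral_mono) (auto simp: ennreal_plus[symmetric] section_mass_nonneg abs_le_iff simp del: ennreal_plus
          intro!: ennreal_leI add_increasing add_increasing2)
    also have "\<dots> = (\<integral>\<^sup>+v. ennreal (section_mass A v) \<partial>lborel) + (\<integral>\<^sup>+v. ennreal (section_mass A v) \<partial>lborel)"
      by (subst nn_integral_add) (auto simp: tr)
    also have "\<dots> \<le> 1 + 1"
      by (intro add_mono nn_integral_section_mass_le_1 A)
    finally show ?thesis by simp
  qed
  have bound: "(\<integral>\<^sup>+v. ennreal \<bar>smooth A h v - section_mass A v\<bar> \<partial>lborel) \<le> (\<integral>\<^sup>+u. ennreal (K (norm (u::'v))) * L (h *\<^sub>R u) \<partial>lborel)" for h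
  proof -
    have pt: "ennreal \<bar>smooth A h v - section_mass A v\<bar> \<le> (\<integral>\<^sup>+u. ennreal (K (norm u)) * ennreal \<bar>section_mass A (h *\<^sub>R u + v) - section_mass A v\<bar> \<partial>lborel)" for v
    proof -
      \<comment> \<open>Because the kernel has mass 1, \<open>section_mass A v\<close> is itself a
        kernel average of a constant, and the difference becomes one integral.\<close>
      have i: "integrable lborel (\<lambda>u::'v. K (norm u) * section_mass A v)"
        using K_norm by (auto simp: has_bochner_integral_iff)
      have "smooth A h v - section_mass A v = (LINT u|lborel. K (norm u) * section_mass A (v + h *\<^sub>R u) - K (norm u) * section_mass A v)"
        unfolding smooth_def using smooth_integrable[OF A] i K_norm
        by (subst Bochner_Integration.integral_diff) (auto simp: has_bochner_integral_iff)
      then have "ennreal \<bar>smooth A h v - section_mass A v\<bar>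
         = ennreal (norm (LINT u|lborel. K (norm u) * section_mass A (v + h *\<^sub>R u) - K (norm u) * section_mass A v))" by simp
      also have "\<dots> \<le> (\<integral>\<^sup>+u. ennreal (norm (K (norm u) * section_mass A (v + h *\<^sub>R u) - K (norm u) * section_mass A v)) \<partial>lborel)"
        by (rule integral_norm_bound_ennreal) (use smooth_integrable[OF A] i in auto)
      also have "\<dots> = (\<integral>\<^sup>+u. ennreal (K (norm u)) * ennreal \<bar>section_mass A (h *\<^sub>R u + v) - section_mass A v\<bar> \<partial>lborel)"
        by (intro nn_integral_cong)
           (simp add: right_diff_distrib[symmetric] abs_mult K_nonneg ennreal_mult add.commute)
      finally show ?thesis .
    qed
    have "(\<integral>\<^sup>+v. ennreal \<bar>smooth A h v - section_mass A v\<bar> \<partial>lborel)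
      \<le> (\<integral>\<^sup>+v. \<integral>\<^sup>+u. ennreal (K (norm u)) * ennreal \<bar>section_mass A (h *\<^sub>R u + v) - section_mass A v\<bar> \<partial>lborel \<partial>lborel)"
      by (intro nn_integral_mono pt)
    also have "\<dots> = (\<integral>\<^sup>+u. \<integral>\<^sup>+v. ennreal (K (norm u)) * ennreal \<bar>section_mass A (h *\<^sub>R u + v) - section_mass A v\<bar> \<partial>lborel \<partial>lborel)"
      by (rule lborel_pair.Fubini') measurable
    also have "\<dots> = (\<integral>\<^sup>+u. ennreal (K (norm u)) * L (h *\<^sub>R u) \<partial>lborel)"
      unfolding L_def by (intro nn_integral_cong nn_integral_cmult) simp
    finally show ?thesis .
  qed
  have "(\<lambda>n. \<integral>\<^sup>+u. ennreal (K (norm (u::'v))) * L (h n *\<^sub>R u) \<partial>lborel) \<longlonglongrightarrow> (\<integral>\<^sup>+u. 0 \<partial>(lborel :: 'v measure))"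
  proof (rule nn_integral_dominated_convergence[where w="\<lambda>u. ennreal (K (norm u)) * 2"])
    have L_meas[measurable]: "L \<in> borel_measurable borel"
      unfolding L_def[abs_def] by measurable
    show "(\<lambda>u. ennreal (K (norm (u::'v))) * L (h n *\<^sub>R u)) \<in> borel_measurable lborel" for n
      by measurable
    show "AE u in lborel. ennreal (K (norm (u::'v))) * L (h n *\<^sub>R u) \<le> ennreal (K (norm u)) * 2" for n
      by (intro AE_I2 mult_left_mono L_le) simp
    show "(\<integral>\<^sup>+u. ennreal (K (norm (u::'v))) * 2 \<partial>lborel) < \<infinity>"
      by (subst nn_integral_multc) (auto simp: nn_integral_K)
    show "AE u in lborel. (\<lambda>n. ennreal (K (norm (u::'v))) * L (h n *\<^sub>R u)) \<longlonglongrightarrow> 0"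
    proof (rule AE_I2)
      fix u :: 'v
      have "(\<lambda>n. h n *\<^sub>R u) \<longlonglongrightarrow> 0 *\<^sub>R u" by (intro tendsto_intros h)
      then have "(\<lambda>n. LINT v|lborel. \<bar>section_mass A (h n *\<^sub>R u + v) - section_mass A v\<bar>) \<longlonglongrightarrow> 0"
        using integrable_imp_translation_continuous[OF gi] by (simp add: translation_continuous_def)
      then have "(\<lambda>n. L (h n *\<^sub>R u)) \<longlonglongrightarrow> ennreal 0"
        unfolding L_eq by (rule tendsto_ennrealI)
      then have "(\<lambda>n. ennreal (K (norm u)) * L (h n *\<^sub>R u)) \<longlonglongrightarrow> ennreal (K (norm u)) * 0"
        by (intro tendsto_mult_ennreal tendsto_const) auto
      then show "(\<lambda>n. ennreal (K (norm u)) * L (h n *\<^sub>R u)) \<longlonglongrightarrow> 0" by simp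
    qed
  qed measurable
  then have lim: "(\<lambda>n. \<integral>\<^sup>+u. ennreal (K (norm (u::'v))) * L (h n *\<^sub>R u) \<partial>lborel) \<longlonglongrightarrow> 0"
    by simp
  show ?thesis
    by (rule tendsto_sandwich[OF _ _ tendsto_const lim]) (simp_all add: bound)
qed

text \<open>Numerator of the estimator at the first sample point, own term included. The scaling by
  \<open>n h^d\<close> makes it converge and cancels in the quotient of the averages of
  \<open>A\<close> and \<open>UNIV\<close>.\<close>

definition kernel_avg :: "real \<Rightarrow> nat \<Rightarrow> 'x set \<Rightarrow> 'w \<Rightarrow> real" where
  "kernel_avg h n A \<omega> =
     (\<Sum>i=1..n. K (norm (V 1 \<omega> - V i \<omega>) / h) * indicator A (X i \<omega>)) / (real n * h ^ DIM('v))"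

lemma kernel_avg_measurable:
  assumes h: "h > 0" and [measurable]: "A \<in> sets borel"
  shows "kernel_avg h n A \<in> borel_measurable M"
proof -
  have [measurable]: "(\<lambda>\<omega>. K (norm (V 1 \<omega> - V i \<omega>) / h) * indicator A (X i \<omega>)) \<in> borel_measurable M"
    if "i \<in> {1..n}" for i
  proof -
    have [measurable]: "X i \<in> M \<rightarrow>\<^sub>M borel" "V i \<in> M \<rightarrow>\<^sub>M borel" "V 1 \<in> M \<rightarrow>\<^sub>M borel"
      using that measurable_X measurable_V by auto
    show ?thesis using h by measurable
  qed
  show ?thesis
    unfolding kernel_avg_def[abs_def] by measurable
qed

text \<open>The term \<open>i = 1\<close> is left out because it is not independent of
  \<open>V 1\<close>. What is subtracted from each other term is its conditional mean given
  \<open>V 1\<close>.\<close>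

definition centered_sum :: "real \<Rightarrow> nat \<Rightarrow> 'x set \<Rightarrow> 'w \<Rightarrow> real" where
  "centered_sum h n A \<omega> = (\<Sum>i\<in>{2..n}. K (norm (V 1 \<omega> - V i \<omega>) / h) * indicator A (X i \<omega>) - h ^ DIM('v) * smooth A h (V 1 \<omega>))"

text \<open>Conditionally on \<open>V 1\<close> this is the variance of a sum of at most
  \<open>n\<close> independent terms with values in \<open>[0, B]\<close> and mean at most
  \<open>C h^d\<close>, hence the bound with \<open>n B C h^d\<close>.\<close>

lemma centered_sum_second_moment:
  assumes h: "h > 0" and A[measurable]: "A \<in> sets borel"
  shows "(\<integral>\<^sup>+\<omega>. ennreal ((centered_sum h n A \<omega>)\<^sup>2) \<partial>M) \<le> ennreal (real n * (B * C * h ^ DIM('v)))"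
proof -
  \<comment> \<open>Evaluation point and remaining sample are separate arguments of
    \<open>F\<close>, as decoupling requires.\<close>
  define F :: "'v \<times> (nat \<Rightarrow> 'x \<times> 'v) \<Rightarrow> ennreal" where
    "F w = ennreal ((\<Sum>i\<in>{2..n}. K (norm (fst w - snd (snd w i)) / h) * indicator A (fst (snd w i))
        - h ^ DIM('v) * smooth A h (fst w))\<^sup>2)" for w
  have F[measurable]: "F \<in> borel_measurable (borel \<Otimes>\<^sub>M PiM {2..n} (\<lambda>_. borel))"
  proof -
    have "(\<lambda>w. K (norm (fst w - snd (snd w i)) / h) * indicator A (fst (snd w i)) - h ^ DIM('v) * smooth A h (fst w))
       \<in> borel_measurable (borel \<Otimes>\<^sub>M PiM {2..n} (\<lambda>_. borel :: ('x \<times> 'v) measure))" if "i \<in> {2..n}" for i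
    proof -
      have [measurable]: "fst \<in> (borel :: ('x \<times> 'v) measure) \<rightarrow>\<^sub>M borel" "snd \<in> (borel :: ('x \<times> 'v) measure) \<rightarrow>\<^sub>M borel"
        unfolding borel_prod[symmetric] by measurable
      have "(\<lambda>t. t i) \<in> PiM {2..n} (\<lambda>_. borel :: ('x \<times> 'v) measure) \<rightarrow>\<^sub>M borel"
        by (rule measurable_component_singleton) (rule that)
      note [measurable] = measurable_compose[OF measurable_snd this]
      show ?thesis using h by measurable
    qed
    then show ?thesis unfolding F_def[abs_def] by measurable
  qed
  have inner: "(\<integral>\<^sup>+\<omega>'. F (v, \<lambda>i\<in>{2..n}. (X i \<omega>', V i \<omega>')) \<partial>M) \<le> ennreal (real n * (B * C * h ^ DIM('v)))" for v
  proof -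
    define Y where "Y i \<omega> = K (norm (v - V i \<omega>) / h) * indicator A (X i \<omega>)" for i \<omega>
    have Y: "0 \<le> Y i \<omega>" "Y i \<omega> \<le> B" for i \<omega>
      using K_nonneg K_le B_nonneg by (auto simp: Y_def indicator_def)
    have EY: "expectation (Y i) = h ^ DIM('v) * smooth A h v" if "i \<in> {2..n}" for i
      unfolding Y_def[abs_def] by (rule expectation_kernel) (use that h in auto)
    have ind: "indep_vars (\<lambda>_. borel) Y {2..n}"
    proof -
      have [measurable]: "fst \<in> (borel :: ('x \<times> 'v) measure) \<rightarrow>\<^sub>M borel" "snd \<in> (borel :: ('x \<times> 'v) measure) \<rightarrow>\<^sub>M borel"
        unfolding borel_prod[symmetric] by measurable
      have m: "(\<lambda>w. K (norm (v - snd w) / h) * indicator A (fst w)) \<in> borel_measurable (borel :: ('x \<times> 'v) measure)"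
        using h by measurable
      have "indep_vars (\<lambda>_. borel) (\<lambda>i \<omega>. (X i \<omega>, V i \<omega>)) {2..n}"
        by (rule indep_vars_subset[OF indep]) auto
      from indep_vars_compose2[OF this m] show ?thesis by (simp add: Y_def[abs_def])
    qed
    have Ym: "Y i \<in> borel_measurable M" if "i \<in> {2..n}" for i
      using ind that by (auto simp: indep_vars_def)
    have intY: "integrable M (Y i)" and intY2: "integrable M (\<lambda>\<omega>. (Y i \<omega>)\<^sup>2)" if "i \<in> {2..n}" for i
    proof -
      note [measurable] = Ym[OF that]
      show "integrable M (Y i)" by (rule integrable_const_bound[of _ B]) (use Y in auto)
      show "integrable M (\<lambda>\<omega>. (Y i \<omega>)\<^sup>2)"
        by (rule integrable_const_bound[of _ "B\<^sup>2"]) (use Y in \<open>auto intro!: power_mono\<close>)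
    qed
    have "(\<integral>\<^sup>+\<omega>'. F (v, \<lambda>i\<in>{2..n}. (X i \<omega>', V i \<omega>')) \<partial>M)
        = (\<integral>\<^sup>+\<omega>'. ennreal ((\<Sum>i\<in>{2..n}. Y i \<omega>' - expectation (Y i))\<^sup>2) \<partial>M)"
      unfolding F_def by (intro nn_integral_cong arg_cong[where f="\<lambda>s. ennreal (s\<^sup>2)"] sum.cong refl) (subst EY, simp_all add: Y_def)
    also have "\<dots> = ennreal (expectation (\<lambda>\<omega>'. (\<Sum>i\<in>{2..n}. Y i \<omega>' - expectation (Y i))\<^sup>2))"
    proof (rule nn_integral_eq_integral)
      have "\<bar>\<Sum>i\<in>{2..n}. Y i \<omega> - expectation (Y i)\<bar> \<le> (\<Sum>i\<in>{2..n}. B + \<bar>expectation (Y i)\<bar>)" for \<omega>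
        by (rule order_trans[OF sum_abs sum_mono]) (use Y in \<open>smt (verit)\<close>)
      then have "\<bar>\<Sum>i\<in>{2..n}. Y i \<omega> - expectation (Y i)\<bar>\<^sup>2 \<le> (\<Sum>i\<in>{2..n}. B + \<bar>expectation (Y i)\<bar>)\<^sup>2" for \<omega>
        by (intro power_mono) auto
      then show "integrable M (\<lambda>\<omega>. (\<Sum>i\<in>{2..n}. Y i \<omega> - expectation (Y i))\<^sup>2)"
        using Ym by (intro integrable_const_bound[of _ "(\<Sum>i\<in>{2..n}. B + \<bar>expectation (Y i)\<bar>)\<^sup>2"]) auto
    qed simp
    also have "\<dots> \<le> ennreal (\<Sum>i\<in>{2..n}. expectation (\<lambda>\<omega>. (Y i \<omega>)\<^sup>2))"
      by (intro ennreal_leI expectation_square_centered_sum[where B=B] ind) (use Y in auto)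
    also have "\<dots> \<le> ennreal (\<Sum>i\<in>{2..n}. B * C * h ^ DIM('v))"
    proof (intro ennreal_leI sum_mono)
      fix i assume i: "i \<in> {2..n}"
      \<comment> \<open>From \<open>0 \<le> Y \<le> B\<close> the square is at most
        \<open>B * Y\<close>. Bounding by the mean instead of by the constant
        \<open>B\<^sup>2\<close> is what gains the factor \<open>h^d\<close>, without which the
        variance would not vanish after scaling.\<close>
      have "expectation (\<lambda>\<omega>. (Y i \<omega>)\<^sup>2) \<le> expectation (\<lambda>\<omega>. B * Y i \<omega>)"
        using Y by (intro integral_mono intY2 intY i integrable_mult_right) (auto simp: power2_eq_square mult_right_mono)
      also have "\<dots> = B * (h ^ DIM('v) * smooth A h v)"
        by (simp add: EY[OF i])
      also have "\<dots> \<le> B * (h ^ DIM('v) * C)"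
        using h by (intro mult_left_mono smooth_le B_nonneg A) auto
      finally show "expectation (\<lambda>\<omega>. (Y i \<omega>)\<^sup>2) \<le> B * C * h ^ DIM('v)" by (simp add: algebra_simps)
    qed
    also have "\<dots> \<le> ennreal (real n * (B * C * h ^ DIM('v)))"
      using h B_nonneg C_nonneg by (intro ennreal_leI) (auto intro!: mult_right_mono)
    finally show ?thesis .
  qed
  have "(\<integral>\<^sup>+\<omega>. ennreal ((centered_sum h n A \<omega>)\<^sup>2) \<partial>M) = (\<integral>\<^sup>+\<omega>. F (V 1 \<omega>, \<lambda>i\<in>{2..n}. (X i \<omega>, V i \<omega>)) \<partial>M)"
    by (intro nn_integral_cong) (simp add: F_def centered_sum_def)
  also have "\<dots> = (\<integral>\<^sup>+\<omega>. \<integral>\<^sup>+\<omega>'. F (V 1 \<omega>, \<lambda>i\<in>{2..n}. (X i \<omega>', V i \<omega>')) \<partial>M \<partial>M)"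
    by (rule nn_integral_decouple[OF F])
  also have "\<dots> \<le> (\<integral>\<^sup>+\<omega>. ennreal (real n * (B * C * h ^ DIM('v))) \<partial>M)"
    by (intro nn_integral_mono inner)
  finally show ?thesis by (simp add: emeasure_space_1)
qed

text \<open>With \<open>N = n h^d\<close>, the own term costs \<open>B / N\<close>, the fluctuation
  of the other terms costs the root of \<open>n B C h^d\<close> divided by \<open>N\<close>, and
  centring \<open>n - 1\<close> rather than \<open>n\<close> terms costs \<open>C / n\<close>. The
  bias is measured under the law of \<open>V 1\<close>, whose density is at most \<open>C\<close>;
  this turns it into a Lebesgue integral.\<close>

lemma kernel_avg_L1_bound:
  assumes h: "h > 0" and n: "n \<ge> 1" and A[measurable]: "A \<in> sets borel"
  shows "(\<integral>\<^sup>+\<omega>. ennreal \<bar>kernel_avg h n A \<omega> - section_mass A (V 1 \<omega>)\<bar> \<partial>M)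
    \<le> ennreal (B / (real n * h ^ DIM('v)) + sqrt (B * C / (real n * h ^ DIM('v))) + C / real n)
      + ennreal C * (\<integral>\<^sup>+v. ennreal \<bar>smooth A h v - section_mass A v\<bar> \<partial>lborel)"
proof -
  define N where "N = real n * h ^ DIM('v)"
  have N: "N > 0" using h n by (simp add: N_def)
  have [measurable]: "V 1 \<in> M \<rightarrow>\<^sub>M borel" by (rule measurable_V) simp
  have centered_sum_meas[measurable]: "centered_sum h n A \<in> borel_measurable M"
  proof -
    have "(\<lambda>\<omega>. K (norm (V 1 \<omega> - V i \<omega>) / h) * indicator A (X i \<omega>) - h ^ DIM('v) * smooth A h (V 1 \<omega>)) \<in> borel_measurable M"
      if "i \<in> {2..n}" for i
    proof -
      have [measurable]: "X i \<in> M \<rightarrow>\<^sub>M borel" "V i \<in> M \<rightarrow>\<^sub>M borel"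
        using that measurable_X measurable_V by auto
      show ?thesis using h by measurable
    qed
    then show ?thesis unfolding centered_sum_def[abs_def] by measurable
  qed
  have pt: "\<bar>kernel_avg h n A \<omega> - section_mass A (V 1 \<omega>)\<bar>
     \<le> (B / N + C / real n) + \<bar>centered_sum h n A \<omega> / N\<bar> + \<bar>smooth A h (V 1 \<omega>) - section_mass A (V 1 \<omega>)\<bar>" for \<omega>
  proof -
    define k where "k i = K (norm (V 1 \<omega> - V i \<omega>) / h) * indicator A (X i \<omega>)" for i
    define b where "b = smooth A h (V 1 \<omega>)"
    have "{1..n} = insert 1 {2..n}" using n by auto
    then have "(\<Sum>i=1..n. k i) = k 1 + (\<Sum>i\<in>{2..n}. k i)" by simp
    moreover have "centered_sum h n A \<omega> = (\<Sum>i\<in>{2..n}. k i) - (real n - 1) * (h ^ DIM('v) * b)"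
      using n by (simp add: centered_sum_def k_def b_def sum_subtractf of_nat_diff)
    moreover have "kernel_avg h n A \<omega> = (\<Sum>i=1..n. k i) / N"
      by (simp only: kernel_avg_def k_def N_def)
    ultimately have "kernel_avg h n A \<omega> = (k 1 + centered_sum h n A \<omega> + (real n - 1) * (h ^ DIM('v) * b)) / N"
      by simp
    \<comment> \<open>The \<open>n - 1\<close> conditional means divided by \<open>n h^d\<close>
      give \<open>b - b / n\<close>, the source of the \<open>C / n\<close> term.\<close>
    also have "\<dots> = k 1 / N + centered_sum h n A \<omega> / N + (b - b / real n)"
      using h n by (simp add: N_def field_simps)
    finally have "kernel_avg h n A \<omega> = k 1 / N + centered_sum h n A \<omega> / N + (b - b / real n)" .
    moreover have "0 \<le> k 1 / N" "k 1 / N \<le> B / N"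
      using N K_nonneg K_le B_nonneg by (auto simp: k_def indicator_def intro!: divide_right_mono)
    moreover have "0 \<le> b / real n" "b / real n \<le> C / real n"
      by (auto simp: b_def smooth_nonneg intro!: divide_right_mono smooth_le)
    ultimately show ?thesis unfolding b_def[symmetric] by linarith
  qed
  have dev2: "(\<integral>\<^sup>+\<omega>. ennreal ((centered_sum h n A \<omega>)\<^sup>2) \<partial>M) \<le> ennreal (N * (B * C))"
    using centered_sum_second_moment[OF h A, of n] by (simp add: N_def algebra_simps)
  have int2: "integrable M (\<lambda>\<omega>. (centered_sum h n A \<omega>)\<^sup>2)"
    using dev2 by (intro integrableI_nonneg) (auto intro: le_less_trans)
  have int1: "integrable M (centered_sum h n A)"
    using square_integrable_imp_integrable[OF centered_sum_meas int2] .
  have e2: "expectation (\<lambda>\<omega>. (centered_sum h n A \<omega>)\<^sup>2) \<le> N * (B * C)"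
    using dev2 N B_nonneg C_nonneg by (subst (asm) nn_integral_eq_integral[OF int2]) (auto simp: ennreal_le_iff)
  have "(\<integral>\<^sup>+\<omega>. ennreal \<bar>centered_sum h n A \<omega> / N\<bar> \<partial>M) = ennreal (expectation (\<lambda>\<omega>. \<bar>centered_sum h n A \<omega> / N\<bar>))"
    using int1 by (intro nn_integral_eq_integral) auto
  also have "expectation (\<lambda>\<omega>. \<bar>centered_sum h n A \<omega> / N\<bar>) = expectation (\<lambda>\<omega>. \<bar>centered_sum h n A \<omega>\<bar>) / N"
    using N by simp
  also have "\<dots> \<le> sqrt (N * (B * C)) / N"
    using N by (intro divide_right_mono order_trans[OF expectation_abs_le_sqrt[OF int1 int2]] real_sqrt_le_mono e2) auto
  also have "\<dots> = sqrt (B * C / N)"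
    using N by (simp add: real_sqrt_mult real_sqrt_divide field_simps)
  finally have dev1: "(\<integral>\<^sup>+\<omega>. ennreal \<bar>centered_sum h n A \<omega> / N\<bar> \<partial>M) \<le> ennreal (sqrt (B * C / N))"
    by (simp add: ennreal_leI)
  have bias: "(\<integral>\<^sup>+\<omega>. ennreal \<bar>smooth A h (V 1 \<omega>) - section_mass A (V 1 \<omega>)\<bar> \<partial>M)
      \<le> ennreal C * (\<integral>\<^sup>+v. ennreal \<bar>smooth A h v - section_mass A v\<bar> \<partial>lborel)"
  proof -
    have "(\<integral>\<^sup>+\<omega>. ennreal \<bar>smooth A h (V 1 \<omega>) - section_mass A (V 1 \<omega>)\<bar> \<partial>M)
       = (\<integral>\<^sup>+v. ennreal \<bar>smooth A h v - section_mass A v\<bar> * ennreal (section_mass UNIV v) \<partial>lborel)"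
      using nn_integral_law[of 1 UNIV "\<lambda>v. ennreal \<bar>smooth A h v - section_mass A v\<bar>"] by simp
    also have "\<dots> \<le> (\<integral>\<^sup>+v. ennreal C * ennreal \<bar>smooth A h v - section_mass A v\<bar> \<partial>lborel)"
      by (intro nn_integral_mono) (subst mult.commute, intro mult_right_mono ennreal_leI section_mass_le, auto)
    also have "\<dots> = ennreal C * (\<integral>\<^sup>+v. ennreal \<bar>smooth A h v - section_mass A v\<bar> \<partial>lborel)"
      by (rule nn_integral_cmult) simp
    finally show ?thesis .
  qed
  have nonneg: "0 \<le> B / N + C / real n" using N B_nonneg C_nonneg by simp
  have "(\<integral>\<^sup>+\<omega>. ennreal \<bar>kernel_avg h n A \<omega> - section_mass A (V 1 \<omega>)\<bar> \<partial>M)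
    \<le> (\<integral>\<^sup>+\<omega>. ennreal (B / N + C / real n) + ennreal \<bar>centered_sum h n A \<omega> / N\<bar>
        + ennreal \<bar>smooth A h (V 1 \<omega>) - section_mass A (V 1 \<omega>)\<bar> \<partial>M)"
    using nonneg pt
    by (intro nn_integral_mono) (simp add: ennreal_plus[symmetric] ennreal_leI del: ennreal_plus)
  also have "\<dots> = ennreal (B / N + C / real n) + (\<integral>\<^sup>+\<omega>. ennreal \<bar>centered_sum h n A \<omega> / N\<bar> \<partial>M)
        + (\<integral>\<^sup>+\<omega>. ennreal \<bar>smooth A h (V 1 \<omega>) - section_mass A (V 1 \<omega>)\<bar> \<partial>M)"
    by (simp add: nn_integral_add emeasure_space_1)
  also have "\<dots> \<le> ennreal (B / N + C / real n) + ennreal (sqrt (B * C / N))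
      + ennreal C * (\<integral>\<^sup>+v. ennreal \<bar>smooth A h v - section_mass A v\<bar> \<partial>lborel)"
    by (intro add_mono order_refl dev1 bias)
  also have "ennreal (B / N + C / real n) + ennreal (sqrt (B * C / N)) = ennreal (B / N + sqrt (B * C / N) + C / real n)"
    using nonneg N B_nonneg C_nonneg by (subst ennreal_plus[symmetric]) (auto simp: algebra_simps)
  finally show ?thesis by (simp add: N_def)
qed

lemma kernel_avg_L1:
  assumes h: "\<And>n. n \<ge> 1 \<Longrightarrow> h n > 0" "h \<longlonglongrightarrow> 0"
    and nh: "filterlim (\<lambda>n. real n * h n ^ DIM('v)) at_top sequentially"
    and A: "A \<in> sets borel"
  shows "(\<lambda>n. \<integral>\<^sup>+\<omega>. ennreal \<bar>kernel_avg (h n) n A \<omega> - section_mass A (V 1 \<omega>)\<bar> \<partial>M) \<longlonglongrightarrow> 0"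
proof (rule tendsto_sandwich[OF _ _ tendsto_const])
  let ?U = "\<lambda>n. ennreal (B / (real n * h n ^ DIM('v)) + sqrt (B * C / (real n * h n ^ DIM('v))) + C / real n)
      + ennreal C * (\<integral>\<^sup>+v. ennreal \<bar>smooth A (h n) v - section_mass A v\<bar> \<partial>lborel)"
  have l1: "(\<lambda>n. c / (real n * h n ^ DIM('v))) \<longlonglongrightarrow> 0" for c
    by (rule real_tendsto_divide_at_top[OF tendsto_const nh])
  have "(\<lambda>n. B / (real n * h n ^ DIM('v)) + sqrt (B * C / (real n * h n ^ DIM('v))) + C / real n) \<longlonglongrightarrow> 0 + sqrt 0 + 0"
    by (intro tendsto_add tendsto_real_sqrt l1 real_tendsto_divide_at_top[OF tendsto_const filterlim_real_sequentially])
  from tendsto_ennrealI[OF this] have "?U \<longlonglongrightarrow> ennreal (0 + sqrt 0 + 0) + ennreal C * 0"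
    by (rule tendsto_add) (intro tendsto_mult_ennreal tendsto_const bias_tendsto_0 A h, auto)
  then show "?U \<longlonglongrightarrow> 0" by simp
  show "\<forall>\<^sub>F n in sequentially. (\<integral>\<^sup>+\<omega>. ennreal \<bar>kernel_avg (h n) n A \<omega> - section_mass A (V 1 \<omega>)\<bar> \<partial>M) \<le> ?U n"
    using eventually_ge_at_top[of 1] by eventually_elim (intro kernel_avg_L1_bound h A)
qed simp

end

section \<open>Conditional distributions and their estimators\<close>

text \<open>Finite intersections of a countable basis; the empty intersection contributes
  \<open>UNIV\<close>. Equality of finite measures on such a family can be secured outside a single
  null set.\<close>

lemma ex_countable_pi_system_borel:
  obtains G :: "'x::second_countable_topology set set"
  where "countable G" "Int_stable G" "UNIV \<in> G" "sets borel = sigma_sets UNIV G"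
proof -
  obtain B :: "'x set set" where B: "countable B" "topological_basis B"
    using ex_countable_basis by blast
  define G where "G = Inter ` {F. finite F \<and> F \<subseteq> B}"
  have "UNIV \<in> G" unfolding G_def by (rule image_eqI[of _ _ "{}"]) auto
  moreover have "countable G"
    unfolding G_def using B(1) by (intro countable_image countable_Collect_finite_subset)
  moreover have "Int_stable G"
  proof (rule Int_stableI)
    fix S T assume "S \<in> G" "T \<in> G"
    then obtain E F where "S = \<Inter>E" "finite E" "E \<subseteq> B" "T = \<Inter>F" "finite F" "F \<subseteq> B"
      by (auto simp: G_def)
    then show "S \<inter> T \<in> G"
      unfolding G_def by (intro image_eqI[of _ _ "E \<union> F"]) auto
  qed
  moreover have "sets borel = sigma_sets UNIV G"
  proof
    have "B \<subseteq> G"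
    proof
      fix S assume "S \<in> B"
      then show "S \<in> G" unfolding G_def by (intro image_eqI[of _ _ "{S}"]) auto
    qed
    then have "sigma_sets UNIV B \<subseteq> sigma_sets UNIV G" by (rule sigma_sets_mono')
    then show "sets borel \<subseteq> sigma_sets UNIV G"
      by (simp add: borel_eq_countable_basis[OF B])
    have "G \<subseteq> sets borel"
    proof
      fix S assume "S \<in> G"
      then obtain F where F: "S = \<Inter>F" "finite F" "F \<subseteq> B" by (auto simp: G_def)
      have "open S"
        unfolding F(1) using F B(2) by (intro open_Inter) (auto intro: topological_basis_open)
      then show "S \<in> sets borel" by simp
    qed
    then show "sigma_sets UNIV G \<subseteq> sets borel"
      using sets.sigma_sets_subset[of G borel] by simp
  qed
  ultimately show thesis using that by blast
qed

text \<open>Both sides of the defining identity depend on the joint law alone. This carries the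
  given conditional distributions from the generic triple over to the first observation.\<close>

lemma regular_cond_dist_cong_law:
  fixes X X' :: "'a \<Rightarrow> 'b::euclidean_space" and W W' :: "'a \<Rightarrow> 'c::euclidean_space"
  assumes rcd: "regular_cond_dist M X W \<kappa>"
    and m: "(\<lambda>\<omega>. (X \<omega>, W \<omega>)) \<in> M \<rightarrow>\<^sub>M borel" "(\<lambda>\<omega>. (X' \<omega>, W' \<omega>)) \<in> M \<rightarrow>\<^sub>M borel"
    and law: "distr M borel (\<lambda>\<omega>. (X' \<omega>, W' \<omega>)) = distr M borel (\<lambda>\<omega>. (X \<omega>, W \<omega>))"
  shows "regular_cond_dist M X' W' \<kappa>"
  unfolding regular_cond_dist_def
proof (intro conjI ballI)
  show \<kappa>: "\<kappa> \<in> borel \<rightarrow>\<^sub>M prob_algebra borel" using rcd by (simp add: regular_cond_dist_def)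
  fix A :: "'b set" and B :: "'c set" assume A[measurable]: "A \<in> sets borel" and B[measurable]: "B \<in> sets borel"
  have AB: "A \<times> B \<in> sets (borel :: ('b \<times> 'c) measure)"
    unfolding borel_prod[symmetric] by measurable
  have meas: "measure M {\<omega> \<in> space M. U \<omega> \<in> A \<and> V \<omega> \<in> B} = measure (distr M borel (\<lambda>\<omega>. (U \<omega>, V \<omega>))) (A \<times> B)"
    if "(\<lambda>\<omega>. (U \<omega>, V \<omega>)) \<in> M \<rightarrow>\<^sub>M borel" for U :: "'a \<Rightarrow> 'b" and V :: "'a \<Rightarrow> 'c"
    by (subst measure_distr[OF that AB]) (auto intro!: arg_cong[where f="measure M"])
  have "(\<lambda>w. measure (\<kappa> w) A) \<in> borel_measurable borel"
    by (rule measurable_compose[OF \<kappa>]) simp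
  then have h: "(\<lambda>z. indicator B (snd z) * measure (\<kappa> (snd z)) A) \<in> borel_measurable (borel :: ('b \<times> 'c) measure)"
    unfolding borel_prod[symmetric] by measurable
  have int: "(LINT \<omega>|M. indicator B (V \<omega>) * measure (\<kappa> (V \<omega>)) A)
     = (LINT z|distr M borel (\<lambda>\<omega>. (U \<omega>, V \<omega>)). indicator B (snd z) * measure (\<kappa> (snd z)) A)"
    if "(\<lambda>\<omega>. (U \<omega>, V \<omega>)) \<in> M \<rightarrow>\<^sub>M borel" for U :: "'a \<Rightarrow> 'b" and V :: "'a \<Rightarrow> 'c"
    by (subst integral_distr[OF that h]) simp
  have "measure M {\<omega> \<in> space M. X \<omega> \<in> A \<and> W \<omega> \<in> B} = (LINT \<omega>|M. indicator B (W \<omega>) * measure (\<kappa> (W \<omega>)) A)"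
    using rcd A B by (simp add: regular_cond_dist_def)
  then show "measure M {\<omega> \<in> space M. X' \<omega> \<in> A \<and> W' \<omega> \<in> B} = (LINT \<omega>|M. indicator B (W' \<omega>) * measure (\<kappa> (W' \<omega>)) A)"
    unfolding meas[OF m(1)] meas[OF m(2)] int[OF m(1)] int[OF m(2)] law .
qed

context iid_density
begin

lemma AE_V:
  assumes i: "i \<ge> 1" and P: "AE v in lborel. P v" and m: "{v. P v} \<in> sets borel"
  shows "AE \<omega> in M. P (V i \<omega>)"
proof -
  note [measurable] = measurable_V[OF i]
  have [measurable]: "{v. \<not> P v} \<in> sets borel"
    using sets.compl_sets[OF m] by (simp add: Collect_neg_eq Compl_eq_Diff_UNIV)
  have "(\<integral>\<^sup>+\<omega>. indicator {v. \<not> P v} (V i \<omega>) * indicator UNIV (X i \<omega>) \<partial>M)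
      = (\<integral>\<^sup>+v. indicator {v. \<not> P v} v * ennreal (section_mass UNIV v) \<partial>lborel)"
    by (rule nn_integral_law[OF i]) auto
  also have "\<dots> = (\<integral>\<^sup>+v. 0 \<partial>(lborel :: 'v measure))"
    by (rule nn_integral_cong_AE) (rule AE_mp[OF P], auto)
  finally have "AE \<omega> in M. indicator {v. \<not> P v} (V i \<omega>) * indicator UNIV (X i \<omega>) = (0::ennreal)"
    by (subst (asm) nn_integral_const, subst (asm) mult_zero_left, subst (asm) nn_integral_0_iff_AE) auto
  then show ?thesis
    by eventually_elim (auto simp: indicator_def split: if_splits)
qed

text \<open>Both sides are Lebesgue densities of the measure that assigns to \<open>B\<close> the
  probability of \<open>X 1 \<in> A\<close> and \<open>V 1 \<in> B\<close>, and densities are unique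
  up to null sets. The product form avoids dividing where the density of \<open>V 1\<close>
  vanishes.\<close>

lemma regular_cond_dist_AE:
  assumes rcd: "regular_cond_dist M (X 1) (V 1) \<kappa>" and A[measurable]: "A \<in> sets borel"
  shows "AE \<omega> in M. measure (\<kappa> (V 1 \<omega>)) A * section_mass UNIV (V 1 \<omega>) = section_mass A (V 1 \<omega>)"
proof (rule AE_V)
  have [measurable]: "V 1 \<in> M \<rightarrow>\<^sub>M borel" "X 1 \<in> M \<rightarrow>\<^sub>M borel"
    using measurable_V measurable_X by auto
  have \<kappa>: "\<kappa> \<in> borel \<rightarrow>\<^sub>M prob_algebra borel"
    using rcd by (simp add: regular_cond_dist_def)
  have prob: "prob_space (\<kappa> v)" for v
    using measurable_space[OF \<kappa>, of v] by (simp add: space_prob_algebra)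
  have [measurable]: "(\<lambda>v. measure (\<kappa> v) A) \<in> borel_measurable borel"
    by (rule measurable_compose[OF \<kappa>]) simp
  have "density lborel (\<lambda>v. ennreal (measure (\<kappa> v) A * section_mass UNIV v)) = density lborel (\<lambda>v. ennreal (section_mass A v))"
  proof (rule measure_eqI)
    fix B :: "'v set" assume "B \<in> sets (density lborel (\<lambda>v. ennreal (measure (\<kappa> v) A * section_mass UNIV v)))"
    then have [measurable]: "B \<in> sets borel" by simp
    have "emeasure (density lborel (\<lambda>v. ennreal (measure (\<kappa> v) A * section_mass UNIV v))) B
        = (\<integral>\<^sup>+v. (indicator B v * ennreal (measure (\<kappa> v) A)) * ennreal (section_mass UNIV v) \<partial>lborel)"
      by (subst emeasure_density) (auto intro!: nn_integral_cong simp: ennreal_mult section_mass_nonneg mult_ac)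
    also have "\<dots> = (\<integral>\<^sup>+\<omega>. indicator B (V 1 \<omega>) * ennreal (measure (\<kappa> (V 1 \<omega>)) A) * indicator UNIV (X 1 \<omega>) \<partial>M)"
      by (rule nn_integral_law[symmetric]) auto
    also have "\<dots> = (\<integral>\<^sup>+\<omega>. ennreal (indicator B (V 1 \<omega>) * measure (\<kappa> (V 1 \<omega>)) A) \<partial>M)"
      by (intro nn_integral_cong) (auto simp: indicator_def)
    also have "\<dots> = ennreal (LINT \<omega>|M. indicator B (V 1 \<omega>) * measure (\<kappa> (V 1 \<omega>)) A)"
    proof (rule nn_integral_eq_integral)
      show "integrable M (\<lambda>\<omega>. indicator B (V 1 \<omega>) * measure (\<kappa> (V 1 \<omega>)) A)"
        using prob by (intro integrable_const_bound[of _ 1] AE_I2)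
          (auto simp: indicator_def prob_space.prob_le_1)
    qed simp
    also have "\<dots> = ennreal (measure M {\<omega> \<in> space M. X 1 \<omega> \<in> A \<and> V 1 \<omega> \<in> B})"
      using rcd by (simp add: regular_cond_dist_def)
    also have "\<dots> = emeasure M {\<omega> \<in> space M. X 1 \<omega> \<in> A \<and> V 1 \<omega> \<in> B}"
      by (simp add: emeasure_eq_measure)
    also have "\<dots> = (\<integral>\<^sup>+\<omega>. indicator {\<omega> \<in> space M. X 1 \<omega> \<in> A \<and> V 1 \<omega> \<in> B} \<omega> \<partial>M)"
      by simp
    also have "\<dots> = (\<integral>\<^sup>+\<omega>. indicator B (V 1 \<omega>) * indicator A (X 1 \<omega>) \<partial>M)"
      by (intro nn_integral_cong) (auto simp: indicator_def)
    also have "\<dots> = (\<integral>\<^sup>+v. indicator B v * ennreal (section_mass A v) \<partial>lborel)"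
      by (rule nn_integral_law) auto
    also have "\<dots> = emeasure (density lborel (\<lambda>v. ennreal (section_mass A v))) B"
      by (subst emeasure_density) (auto intro!: nn_integral_cong simp: mult_ac)
    finally show "emeasure (density lborel (\<lambda>v. ennreal (measure (\<kappa> v) A * section_mass UNIV v))) B
        = emeasure (density lborel (\<lambda>v. ennreal (section_mass A v))) B" .
  qed simp
  then have "AE v in lborel. ennreal (measure (\<kappa> v) A * section_mass UNIV v) = ennreal (section_mass A v)"
    by (intro sigma_finite_measure.density_unique[OF sigma_finite_lborel]) auto
  then show "AE v in lborel. measure (\<kappa> v) A * section_mass UNIV v = section_mass A v"
    by eventually_elim (simp add: section_mass_nonneg)
  show "{v. measure (\<kappa> v) A * section_mass UNIV v = section_mass A v} \<in> sets borel"
    by measurable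
qed simp

text \<open>The exceptional null set of the previous identity depends on \<open>A\<close>. A
  countable generator reduces this to one null set, outside which the conditional law is the measure
  with density \<open>f (x, v) / section_mass UNIV v\<close>.\<close>

lemma AE_absolutely_continuous_cond:
  assumes rcd: "regular_cond_dist M (X 1) (V 1) \<kappa>"
  shows "AE \<omega> in M. absolutely_continuous lborel (\<kappa> (V 1 \<omega>))"
proof -
  obtain G :: "'x set set" where G: "countable G" "Int_stable G" "UNIV \<in> G" "sets borel = sigma_sets UNIV G"
    using ex_countable_pi_system_borel by blast
  have GB: "A \<in> sets borel" if "A \<in> G" for A using that G(4) by auto
  have "AE \<omega> in M. \<forall>A\<in>G. measure (\<kappa> (V 1 \<omega>)) A * section_mass UNIV (V 1 \<omega>) = section_mass A (V 1 \<omega>)"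
    unfolding AE_ball_countable[OF G(1)] by (intro ballI regular_cond_dist_AE[OF rcd] GB)
  moreover have "AE \<omega> in M. section_mass UNIV (V 1 \<omega>) > 0" by (rule AE_density_pos) simp
  ultimately show ?thesis
  proof eventually_elim
    case (elim \<omega>)
    define v where "v = V 1 \<omega>"
    have \<kappa>: "\<kappa> \<in> borel \<rightarrow>\<^sub>M prob_algebra borel"
      using rcd by (simp add: regular_cond_dist_def)
    have prob: "prob_space (\<kappa> v)" and s\<kappa>: "sets (\<kappa> v) = sets borel"
      using measurable_space[OF \<kappa>, of v] by (auto simp: space_prob_algebra)
    interpret P: prob_space "\<kappa> v" by (rule prob)
    have "\<kappa> v = density lborel (\<lambda>x. ennreal (f (x, v) / section_mass UNIV v))"
    proof (rule measure_eqI_generator_eq[of G UNIV _ _ "\<lambda>_. UNIV"])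
      fix A assume A: "A \<in> G"
      note [measurable] = GB[OF A]
      have "emeasure (density lborel (\<lambda>x. ennreal (f (x, v) / section_mass UNIV v))) A
         = (\<integral>\<^sup>+x. ennreal (1 / section_mass UNIV v) * ennreal (indicator A x * f (x, v)) \<partial>lborel)"
        using elim by (subst emeasure_density)
          (auto intro!: nn_integral_cong simp: indicator_def ennreal_mult[symmetric] f_nonneg v_def)
      also have "\<dots> = ennreal (1 / section_mass UNIV v) * ennreal (section_mass A v)"
        by (subst nn_integral_cmult) (auto simp: section_mass_ennreal)
      also have "\<dots> = ennreal (measure (\<kappa> v) A)"
        using elim A by (simp add: ennreal_mult[symmetric] section_mass_nonneg v_def field_simps)
      finally show "emeasure (\<kappa> v) A = emeasure (density lborel (\<lambda>x. ennreal (f (x, v) / section_mass UNIV v))) A"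
        by (simp add: P.emeasure_eq_measure)
    qed (use G s\<kappa> in auto)
    moreover have "absolutely_continuous lborel (density lborel (\<lambda>x. ennreal (f (x, v) / section_mass UNIV v)))"
      by (intro absolutely_continuousI_density) measurable
    ultimately show ?case by (simp add: v_def)
  qed
qed

end

section \<open>Kernel estimates as random sub-probability measures\<close>

lemma kernel_cond_dist_borel_subprob:
  fixes xs :: "nat \<Rightarrow> 'x::euclidean_space" and ws :: "nat \<Rightarrow> 'v::euclidean_space"
  assumes K: "\<And>t. 0 \<le> K t"
  shows "borel_subprob (kernel_cond_dist K h n xs ws w)"
proof -
  define S where "S = (\<Sum>j=1..n. K (norm (w - ws j) / h))"
  have "emeasure (kernel_cond_dist K h n xs ws w) UNIV = (\<Sum>i=1..n. ennreal (K (norm (w - ws i) / h) / S))"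
    unfolding kernel_cond_dist_def S_def[symmetric]
    by (subst emeasure_distr) (auto simp: space_point_measure emeasure_point_measure_finite)
  also have "\<dots> = ennreal (\<Sum>i=1..n. K (norm (w - ws i) / h) / S)"
    by (rule sum_ennreal) (auto simp: S_def intro!: divide_nonneg_nonneg sum_nonneg K)
  also have "(\<Sum>i=1..n. K (norm (w - ws i) / h) / S) = S / S"
    by (simp only: S_def sum_divide_distrib)
  \<comment> \<open>Total mass 1, or 0 when all weights vanish, since division by 0 yields
    0.\<close>
  also have "ennreal (S / S) \<le> 1" by (cases "S = 0") auto
  finally have "emeasure (kernel_cond_dist K h n xs ws w) UNIV \<le> 1" .
  then show ?thesis
    unfolding borel_subprob_def borel_subprob_axioms_def
    by (intro conjI subprob_spaceI) (auto simp: kernel_cond_dist_def)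
qed

text \<open>At a fixed evaluation point the estimate is symmetric in the observations. As only
  indices in \<open>{1..n}\<close> enter, the lemma also replaces tuples restricted to that range by
  the full sequences.\<close>

lemma kernel_cond_dist_reindex:
  fixes xs xs' :: "nat \<Rightarrow> 'x::euclidean_space" and ws ws' :: "nat \<Rightarrow> 'v::euclidean_space"
  assumes K: "\<And>t. 0 \<le> K t" and \<pi>: "bij_betw \<pi> {1..n} {1..n}"
    and eq: "\<And>i. i \<in> {1..n} \<Longrightarrow> xs' i = xs (\<pi> i)" "\<And>i. i \<in> {1..n} \<Longrightarrow> ws' i = ws (\<pi> i)"
  shows "kernel_cond_dist K h n xs' ws' w = kernel_cond_dist K h n xs ws w"
proof (rule measure_eqI)
  interpret P: borel_subprob "kernel_cond_dist K h n xs ws w" by (rule kernel_cond_dist_borel_subprob[OF K])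
  interpret P': borel_subprob "kernel_cond_dist K h n xs' ws' w" by (rule kernel_cond_dist_borel_subprob[OF K])
  show "sets (kernel_cond_dist K h n xs' ws' w) = sets (kernel_cond_dist K h n xs ws w)"
    by (simp add: P.sets_borel P'.sets_borel)
  fix A assume "A \<in> sets (kernel_cond_dist K h n xs' ws' w)"
  then have A: "A \<in> sets borel" by (simp add: P'.sets_borel)
  have "(\<Sum>i=1..n. K (norm (w - ws' i) / h) * indicator A (xs' i)) = (\<Sum>i=1..n. K (norm (w - ws (\<pi> i)) / h) * indicator A (xs (\<pi> i)))"
    using eq by (intro sum.cong) auto
  also have "\<dots> = (\<Sum>i=1..n. K (norm (w - ws i) / h) * indicator A (xs i))"
    by (rule sum.reindex_bij_betw[OF \<pi>])
  finally have 1: "(\<Sum>i=1..n. K (norm (w - ws' i) / h) * indicator A (xs' i)) = \<dots>" .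
  have "(\<Sum>i=1..n. K (norm (w - ws' i) / h)) = (\<Sum>i=1..n. K (norm (w - ws (\<pi> i)) / h))"
    using eq by (intro sum.cong) auto
  also have "\<dots> = (\<Sum>i=1..n. K (norm (w - ws i) / h))"
    by (rule sum.reindex_bij_betw[OF \<pi>])
  finally show "emeasure (kernel_cond_dist K h n xs' ws' w) A = emeasure (kernel_cond_dist K h n xs ws w) A"
    by (simp only: P.emeasure_eq_measure P'.emeasure_eq_measure measure_kernel_cond_dist[OF K A] 1)
qed

text \<open>It suffices to treat the mass of each Borel set, which is a quotient of finite sums.
  Positivity of \<open>h\<close> is asked for \<open>n \<ge> 1\<close>, where the bandwidths have
  it; at \<open>n = 0\<close> the sums are empty.\<close>

lemma kernel_cond_dist_measurable:
  fixes xs :: "nat \<Rightarrow> 's \<Rightarrow> 'x::euclidean_space" and ws :: "nat \<Rightarrow> 's \<Rightarrow> 'v::euclidean_space"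
  assumes K: "\<And>t. 0 \<le> K t" and Km: "(\<lambda>u::'v. K (norm u)) \<in> borel_measurable borel" and h: "n \<ge> 1 \<Longrightarrow> h > 0"
    and m: "\<And>i. i \<in> {1..n} \<Longrightarrow> xs i \<in> N \<rightarrow>\<^sub>M borel" "\<And>i. i \<in> {1..n} \<Longrightarrow> ws i \<in> N \<rightarrow>\<^sub>M borel"
    and w: "w \<in> N \<rightarrow>\<^sub>M borel"
  shows "(\<lambda>\<omega>. kernel_cond_dist K h n (\<lambda>i. xs i \<omega>) (\<lambda>i. ws i \<omega>) (w \<omega>)) \<in> N \<rightarrow>\<^sub>M subprob_algebra borel"
proof (rule measurable_subprob_algebra)
  fix \<omega>
  interpret P: borel_subprob "kernel_cond_dist K h n (\<lambda>i. xs i \<omega>) (\<lambda>i. ws i \<omega>) (w \<omega>)"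
    by (rule kernel_cond_dist_borel_subprob[OF K])
  show "subprob_space (kernel_cond_dist K h n (\<lambda>i. xs i \<omega>) (\<lambda>i. ws i \<omega>) (w \<omega>))"
    by (rule P.subprob_space_axioms)
  show "sets (kernel_cond_dist K h n (\<lambda>i. xs i \<omega>) (\<lambda>i. ws i \<omega>) (w \<omega>)) = sets borel"
    by (rule P.sets_borel)
next
  fix A :: "'x set" assume A[measurable]: "A \<in> sets borel"
  have em: "emeasure (kernel_cond_dist K h n (\<lambda>i. xs i \<omega>) (\<lambda>i. ws i \<omega>) (w \<omega>)) A
     = ennreal ((\<Sum>i=1..n. K (norm (w \<omega> - ws i \<omega>) / h) * indicator A (xs i \<omega>)) / (\<Sum>i=1..n. K (norm (w \<omega> - ws i \<omega>) / h)))" for \<omega>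
  proof -
    interpret P: borel_subprob "kernel_cond_dist K h n (\<lambda>i. xs i \<omega>) (\<lambda>i. ws i \<omega>) (w \<omega>)"
      by (rule kernel_cond_dist_borel_subprob[OF K])
    show ?thesis unfolding P.emeasure_eq_measure measure_kernel_cond_dist[OF K A] ..
  qed
  have Kh: "(\<lambda>\<omega>. K (norm (w \<omega> - ws i \<omega>) / h)) \<in> borel_measurable N" if i: "i \<in> {1..n}" for i
  proof -
    note [measurable] = m(2)[OF i] w Km
    have "(\<lambda>\<omega>. K (norm ((1 / h) *\<^sub>R (w \<omega> - ws i \<omega>)))) \<in> borel_measurable N"
      by measurable
    then show ?thesis using h i by simp
  qed
  have "(\<lambda>\<omega>. K (norm (w \<omega> - ws i \<omega>) / h) * indicator A (xs i \<omega>)) \<in> borel_measurable N" if i: "i \<in> {1..n}" for i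
  proof -
    note [measurable] = m(1)[OF i] Kh[OF i]
    show ?thesis by measurable
  qed
  then show "(\<lambda>\<omega>. emeasure (kernel_cond_dist K h n (\<lambda>i. xs i \<omega>) (\<lambda>i. ws i \<omega>) (w \<omega>)) A) \<in> borel_measurable N"
    unfolding em using Kh by measurable
qed

section \<open>Almost sure convergence along subsequences\<close>

lemma LIMSEQ_if_subsubsequence:
  fixes e :: "nat \<Rightarrow> 'a::metric_space"
  assumes sub: "\<And>s. strict_mono s \<Longrightarrow> \<exists>r. strict_mono (r :: nat \<Rightarrow> nat) \<and> (\<lambda>n. e (s (r n))) \<longlonglongrightarrow> L"
  shows "e \<longlonglongrightarrow> L"
proof (rule ccontr)
  assume "\<not> e \<longlonglongrightarrow> L"
  then obtain \<epsilon> where \<epsilon>: "\<epsilon> > 0" "\<not> (\<forall>\<^sub>F n in sequentially. dist (e n) L < \<epsilon>)"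
    unfolding tendsto_iff by blast
  then have "infinite {n. \<not> dist (e n) L < \<epsilon>}"
    by (simp add: cofinite_eq_sequentially[symmetric] eventually_cofinite)
  then obtain s :: "nat \<Rightarrow> nat" where s: "strict_mono s" "\<And>n. \<not> dist (e (s n)) L < \<epsilon>"
    using infinite_enumerate[of "{n. \<not> dist (e n) L < \<epsilon>}"] by auto
  obtain r where "(\<lambda>n. e (s (r n))) \<longlonglongrightarrow> L" using sub[OF s(1)] by auto
  then have "\<forall>\<^sub>F n in sequentially. dist (e (s (r n))) L < \<epsilon>" using \<epsilon>(1) by (rule tendstoD)
  with s(2) show False by (auto simp: eventually_sequentially)
qed

text \<open>For one \<open>j\<close>, convergence in mean yields an almost surely convergent
  subsequence. This property is inherited by further subsequences, so extraction can be repeated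
  over all \<open>j\<close> and a diagonal taken; countably many null sets are then
  collected.\<close>

lemma (in prob_space) L1_tendsto_AE_diagonal_subsequence:
  fixes F :: "nat \<Rightarrow> nat \<Rightarrow> 'a \<Rightarrow> real"
  assumes m[measurable]: "\<And>j n. F j n \<in> borel_measurable M"
    and lim: "\<And>j. (\<lambda>n. \<integral>\<^sup>+\<omega>. ennreal \<bar>F j n \<omega>\<bar> \<partial>M) \<longlonglongrightarrow> 0" and s: "strict_mono s"
  obtains r :: "nat \<Rightarrow> nat" where "strict_mono r" "AE \<omega> in M. \<forall>j. (\<lambda>n. F j (s (r n)) \<omega>) \<longlonglongrightarrow> 0"
proof -
  define P where "P j t \<longleftrightarrow> (AE \<omega> in M. (\<lambda>n. F j (s (t n)) \<omega>) \<longlonglongrightarrow> 0)" for j t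
  interpret subseqs P
  proof
    fix j and t :: "nat \<Rightarrow> nat" assume t: "strict_mono t"
    \<comment> \<open>The nonnegative integrals may be infinite for small \<open>n\<close>.
      Truncation at 1 makes each function integrable and is inactive as soon as the values are below
      1.\<close>
    define u where "u n \<omega> = min 1 \<bar>F j (s (t n)) \<omega>\<bar>" for n \<omega>
    have um[measurable]: "u n \<in> borel_measurable M" for n unfolding u_def[abs_def] by measurable
    have int: "integrable M (u n)" for n
      by (rule integrable_const_bound[of _ 1]) (auto simp: u_def)
    have "(\<lambda>n. \<integral>\<^sup>+\<omega>. ennreal \<bar>F j (s (t n)) \<omega>\<bar> \<partial>M) \<longlonglongrightarrow> 0"
      using LIMSEQ_subseq_LIMSEQ[OF lim strict_mono_o[OF s t]] by (simp add: o_def)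
    then have "(\<lambda>n. \<integral>\<^sup>+\<omega>. ennreal (norm (u n \<omega>)) \<partial>M) \<longlonglongrightarrow> 0"
      by (rule tendsto_sandwich[OF _ _ tendsto_const, rotated 2])
         (auto intro!: always_eventually nn_integral_mono ennreal_leI simp: u_def)
    moreover have "(\<integral>\<^sup>+\<omega>. ennreal (norm (u n \<omega>)) \<partial>M) = ennreal (LINT \<omega>|M. norm (u n \<omega>))" for n
      by (rule nn_integral_eq_integral) (use int in auto)
    ultimately have "(\<lambda>n. ennreal (LINT \<omega>|M. norm (u n \<omega>))) \<longlonglongrightarrow> ennreal 0" by simp
    then have "(\<lambda>n. LINT \<omega>|M. norm (u n \<omega>)) \<longlonglongrightarrow> 0"
      by (subst (asm) tendsto_ennreal_iff) auto
    from tendsto_L1_AE_subseq[OF int this] obtain r :: "nat \<Rightarrow> nat" where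
      r: "strict_mono r" "AE \<omega> in M. (\<lambda>n. u (r n) \<omega>) \<longlonglongrightarrow> 0" by blast
    from r(2) have "P j (t \<circ> r)"
      unfolding P_def
    proof eventually_elim
      case (elim \<omega>)
      have "\<forall>\<^sub>F n in sequentially. u (r n) \<omega> < 1"
        using elim by (rule order_tendstoD(2)) simp
      then have "\<forall>\<^sub>F n in sequentially. u (r n) \<omega> = \<bar>F j (s ((t \<circ> r) n)) \<omega>\<bar>"
        by eventually_elim (auto simp: u_def min_def split: if_splits)
      from Lim_transform_eventually[OF elim this] show ?case
        by (simp add: tendsto_rabs_zero_iff)
    qed
    with r(1) show "\<exists>r'. strict_mono r' \<and> P j (t \<circ> r')" by blast
  qed
  \<comment> \<open>The diagonal sequence is known to refine the \<open>j\<close>-th extraction only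
    from position \<open>Suc j\<close> on; the shift is removed afterwards, as it does not affect
    limits.\<close>
  have diag: "P j (diagseq \<circ> (+) (Suc j))" for j
  proof (rule diagseq_holds)
    fix r t :: "nat \<Rightarrow> nat" and n assume r: "strict_mono r" and "P n t"
    from this(2) show "P n (t \<circ> r)"
      unfolding P_def
      by eventually_elim (use LIMSEQ_subseq_LIMSEQ[OF _ r] in \<open>fastforce simp: o_def\<close>)
  qed
  have "AE \<omega> in M. (\<lambda>n. F j (s (diagseq n)) \<omega>) \<longlonglongrightarrow> 0" for j
    using P_def[THEN iffD1, OF diag[of j]]
  proof eventually_elim
    case (elim \<omega>)
    then have "(\<lambda>n. F j (s (diagseq (n + Suc j))) \<omega>) \<longlonglongrightarrow> 0" by (simp add: o_def add.commute)
    then show ?case by (rule LIMSEQ_offset)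
  qed
  then have "AE \<omega> in M. \<forall>j. (\<lambda>n. F j (s (diagseq n)) \<omega>) \<longlonglongrightarrow> 0"
    by (simp add: AE_all_countable)
  with subseq_diagseq show thesis by (rule that)
qed

lemma cellwise_conv_subseq:
  assumes conv: "cellwise_conv idx Nn N" and t: "strict_mono t"
  shows "cellwise_conv idx (\<lambda>n. Nn (t n)) N"
proof -
  note c = conv[unfolded cellwise_conv_def]
  have lim: "(\<lambda>n. emeasure (Nn (t n)) {e. idx m e = k}) \<longlonglongrightarrow> emeasure N {e. idx m e = k}" for m k
  proof -
    have "(\<lambda>n. emeasure (Nn n) {e. idx m e = k}) \<longlonglongrightarrow> emeasure N {e. idx m e = k}"
      using conv by (simp only: cellwise_conv_def)
    from LIMSEQ_subseq_LIMSEQ[OF this t] show ?thesis by (simp only: o_def)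
  qed
  have sub: "\<forall>n. sets (Nn (t n)) = sets borel \<and> subprob_space (Nn (t n))"
    using c[THEN conjunct2, THEN conjunct2, THEN conjunct1] by simp
  show ?thesis
    unfolding cellwise_conv_def
    by (rule conjI[OF c[THEN conjunct1] conjI[OF c[THEN conjunct2, THEN conjunct1] conjI[OF sub
        conjI[OF c[THEN conjunct2, THEN conjunct2, THEN conjunct2, THEN conjunct1]
        conjI[OF c[THEN conjunct2, THEN conjunct2, THEN conjunct2, THEN conjunct2, THEN conjunct1]]]]]])
       (intro allI lim)
qed

context kernel_sample
begin

lemma measure_kernel_cond_dist_eq_avg:
  assumes "n \<ge> 1" "h > 0" "A \<in> sets borel"
  shows "measure (kernel_cond_dist K h n (\<lambda>i. X i \<omega>) (\<lambda>i. V i \<omega>) (V 1 \<omega>)) A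
    = kernel_avg h n A \<omega> / kernel_avg h n UNIV \<omega>"
  unfolding measure_kernel_cond_dist[OF K_nonneg assms(3)] kernel_avg_def
  using assms(1,2) by simp

text \<open>All cells of all levels, together with the whole space, form a countable family, so one
  subsequence makes all their kernel averages converge almost surely. Dividing by the average of the
  whole space gives the conditional probabilities of the cells.\<close>

lemma AE_cellwise_conv_subsequence:
  assumes h: "\<And>n. n \<ge> 1 \<Longrightarrow> h n > 0" "h \<longlonglongrightarrow> 0"
    and nh: "filterlim (\<lambda>n. real n * h n ^ DIM('v)) at_top sequentially"
    and rcd: "regular_cond_dist M (X 1) (V 1) \<kappa>"
    and idx: "\<And>m. idx m \<in> borel \<rightarrow>\<^sub>M count_space UNIV"
    and fine: "\<And>x U. open U \<Longrightarrow> x \<in> U \<Longrightarrow> \<forall>\<^sub>F m in sequentially. {x'. idx m x' = idx m x} \<subseteq> U"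
    and s: "strict_mono s"
  obtains r :: "nat \<Rightarrow> nat" where "strict_mono r"
    "AE \<omega> in M. cellwise_conv (idx :: nat \<Rightarrow> 'x \<Rightarrow> nat)
       (\<lambda>n. kernel_cond_dist K (h (s (r n))) (s (r n)) (\<lambda>i. X i \<omega>) (\<lambda>i. V i \<omega>) (V 1 \<omega>)) (\<kappa> (V 1 \<omega>))"
proof -
  \<comment> \<open>Index 0 is reserved for the whole space, the denominator; the other indices run
    through all pairs of a level and a cell number.\<close>
  define A :: "nat \<Rightarrow> 'x set" where
    "A j = (case j of 0 \<Rightarrow> UNIV | Suc k \<Rightarrow> {x. idx (fst (prod_decode k)) x = snd (prod_decode k)})" for j
  have A: "A j \<in> sets borel" for j
    using measurable_sets[OF idx, of "{snd (prod_decode k)}" "fst (prod_decode k)" for k]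
    by (cases j) (auto simp: A_def vimage_def)
  have A_UNIV: "A 0 = UNIV" and A_cell: "A (Suc (prod_encode (m, k))) = {x. idx m x = k}" for m k
    by (auto simp: A_def)
  define F where "F j n \<omega> = kernel_avg (h n) n (A j) \<omega> - section_mass (A j) (V 1 \<omega>)" for j n \<omega>
  have [measurable]: "V 1 \<in> M \<rightarrow>\<^sub>M borel" by (rule measurable_V) simp
  have F: "F j n \<in> borel_measurable M" for j n
  proof -
    have [measurable]: "kernel_avg (h n) n (A j) \<in> borel_measurable M"
    proof (cases "n \<ge> 1")
      case True
      then show ?thesis by (intro kernel_avg_measurable h A)
    next
      case False
      then have "kernel_avg (h n) n (A j) = (\<lambda>_. 0)" by (auto simp: kernel_avg_def fun_eq_iff)
      then show ?thesis by simp
    qed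
    note [measurable] = A
    show ?thesis unfolding F_def[abs_def] by measurable
  qed
  have "(\<lambda>n. \<integral>\<^sup>+\<omega>. ennreal \<bar>F j n \<omega>\<bar> \<partial>M) \<longlonglongrightarrow> 0" for j
    unfolding F_def by (rule kernel_avg_L1[OF h nh A])
  then obtain r where r: "strict_mono r" "AE \<omega> in M. \<forall>j. (\<lambda>n. F j (s (r n)) \<omega>) \<longlonglongrightarrow> 0"
    using L1_tendsto_AE_diagonal_subsequence[of F s, OF F _ s] by blast
  have sr: "strict_mono (s \<circ> r)" using s r(1) by (rule strict_mono_o)
  \<comment> \<open>A strictly increasing sequence dominates its index, so sample sizes along the
    subsequence are at least 1 from \<open>n = 1\<close> on, where bandwidths are positive.\<close>
  have ge1: "s (r n) \<ge> 1" if "n \<ge> 1" for n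
    using strict_mono_imp_increasing[OF sr, of n] that by simp
  have "AE \<omega> in M. \<forall>j. measure (\<kappa> (V 1 \<omega>)) (A j) * section_mass UNIV (V 1 \<omega>) = section_mass (A j) (V 1 \<omega>)"
    unfolding AE_all_countable by (intro allI regular_cond_dist_AE[OF rcd] A)
  moreover have "AE \<omega> in M. section_mass UNIV (V 1 \<omega>) > 0" by (rule AE_density_pos) simp
  ultimately have "AE \<omega> in M. cellwise_conv idx
       (\<lambda>n. kernel_cond_dist K (h (s (r n))) (s (r n)) (\<lambda>i. X i \<omega>) (\<lambda>i. V i \<omega>) (V 1 \<omega>)) (\<kappa> (V 1 \<omega>))"
    using r(2)
  proof eventually_elim
    case (elim \<omega>)
    define N where "N n = kernel_cond_dist K (h (s (r n))) (s (r n)) (\<lambda>i. X i \<omega>) (\<lambda>i. V i \<omega>) (V 1 \<omega>)" for n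
    have \<kappa>: "\<kappa> \<in> borel \<rightarrow>\<^sub>M prob_algebra borel"
      using rcd by (simp add: regular_cond_dist_def)
    have prob: "prob_space (\<kappa> (V 1 \<omega>))" and s\<kappa>: "sets (\<kappa> (V 1 \<omega>)) = sets borel"
      using measurable_space[OF \<kappa>, of "V 1 \<omega>"] by (auto simp: space_prob_algebra)
    interpret P: prob_space "\<kappa> (V 1 \<omega>)" by (rule prob)
    have N: "borel_subprob (N n)" for n
      unfolding N_def by (rule kernel_cond_dist_borel_subprob[OF K_nonneg])
    have sN: "sets (N n) = sets borel" and pN: "subprob_space (N n)" for n
      using N[of n] by (auto simp: borel_subprob_def borel_subprob_axioms_def)
    have avg: "(\<lambda>n. kernel_avg (h (s (r n))) (s (r n)) (A j) \<omega>) \<longlonglongrightarrow> section_mass (A j) (V 1 \<omega>)" for j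
      by (rule LIM_zero_cancel) (rule elim(3)[rule_format, unfolded F_def])
    have "(\<lambda>n. measure (N n) (A j)) \<longlonglongrightarrow> measure (\<kappa> (V 1 \<omega>)) (A j)" for j
    proof -
      have "(\<lambda>n. kernel_avg (h (s (r n))) (s (r n)) (A j) \<omega> / kernel_avg (h (s (r n))) (s (r n)) UNIV \<omega>)
          \<longlonglongrightarrow> section_mass (A j) (V 1 \<omega>) / section_mass UNIV (V 1 \<omega>)"
        using avg[of 0] elim(2) by (intro tendsto_divide avg) (auto simp: A_UNIV)
      also have "section_mass (A j) (V 1 \<omega>) / section_mass UNIV (V 1 \<omega>) = measure (\<kappa> (V 1 \<omega>)) (A j)"
        using elim(1)[rule_format, of j] elim(2) by (simp add: field_simps)
      finally show ?thesis
      proof (rule Lim_transform_eventually)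
        show "\<forall>\<^sub>F n in sequentially. kernel_avg (h (s (r n))) (s (r n)) (A j) \<omega> / kernel_avg (h (s (r n))) (s (r n)) UNIV \<omega>
           = measure (N n) (A j)"
          using eventually_ge_at_top[of 1]
          by eventually_elim (simp only: N_def measure_kernel_cond_dist_eq_avg[OF ge1 h(1)[OF ge1] A])
      qed
    qed
    then have "(\<lambda>n. ennreal (measure (N n) {x. idx m x = k})) \<longlonglongrightarrow> ennreal (measure (\<kappa> (V 1 \<omega>)) {x. idx m x = k})" for m k
      unfolding A_cell[symmetric] by (rule tendsto_ennrealI)
    then have em: "(\<lambda>n. emeasure (N n) {x. idx m x = k}) \<longlonglongrightarrow> emeasure (\<kappa> (V 1 \<omega>)) {x. idx m x = k}" for m k
      unfolding P.emeasure_eq_measure finite_measure.emeasure_eq_measure[OF subprob_space.axioms(1)[OF pN]] .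
    show ?case
      unfolding cellwise_conv_def N_def[symmetric]
      by (intro conjI allI impI idx fine sN pN s\<kappa> prob em)
  qed
  with r(1) show thesis by (rule that)
qed

end

text \<open>Along any subsequence a further one makes both estimates converge cellwise almost
  surely. Their limits are almost surely absolutely continuous, so the divergences converge
  pointwise, and boundedness turns this into convergence in mean.\<close>

lemma ball_divergence_kernel_L1:
  fixes X :: "nat \<Rightarrow> 'w \<Rightarrow> 'x::euclidean_space" and V :: "nat \<Rightarrow> 'w \<Rightarrow> 'v::euclidean_space"
    and V' :: "nat \<Rightarrow> 'w \<Rightarrow> 'u::euclidean_space"
  assumes 1: "kernel_sample M X V f C K B" and 2: "kernel_sample M X V' f' C' K B'"
    and h1: "\<And>n. n \<ge> 1 \<Longrightarrow> h1 n > 0" "h1 \<longlonglongrightarrow> 0"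
      "filterlim (\<lambda>n. real n * h1 n ^ DIM('v)) at_top sequentially"
    and h2: "\<And>n. n \<ge> 1 \<Longrightarrow> h2 n > 0" "h2 \<longlonglongrightarrow> 0"
      "filterlim (\<lambda>n. real n * h2 n ^ DIM('u)) at_top sequentially"
    and rcd: "regular_cond_dist M (X 1) (V 1) \<kappa>1" "regular_cond_dist M (X 1) (V' 1) \<kappa>2"
  shows "(\<lambda>n. LINT \<omega>|M. \<bar>ball_divergence (kernel_cond_dist K (h1 n) n (\<lambda>i. X i \<omega>) (\<lambda>i. V i \<omega>) (V 1 \<omega>))
        (kernel_cond_dist K (h2 n) n (\<lambda>i. X i \<omega>) (\<lambda>i. V' i \<omega>) (V' 1 \<omega>))
      - ball_divergence (\<kappa>1 (V 1 \<omega>)) (\<kappa>2 (V' 1 \<omega>))\<bar>) \<longlonglongrightarrow> 0"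
proof (rule LIMSEQ_if_subsubsequence)
  interpret S1: kernel_sample M X V f C K B by (rule 1)
  interpret S2: kernel_sample M X V' f' C' K B' by (rule 2)
  fix s :: "nat \<Rightarrow> nat" assume s: "strict_mono s"
  define P where "P n \<omega> = kernel_cond_dist K (h1 n) n (\<lambda>i. X i \<omega>) (\<lambda>i. V i \<omega>) (V 1 \<omega>)" for n \<omega>
  define Q where "Q n \<omega> = kernel_cond_dist K (h2 n) n (\<lambda>i. X i \<omega>) (\<lambda>i. V' i \<omega>) (V' 1 \<omega>)" for n \<omega>
  obtain idx :: "nat \<Rightarrow> 'x \<Rightarrow> nat" where idx: "\<And>m. idx m \<in> borel \<rightarrow>\<^sub>M count_space UNIV"
    "\<And>x U. open U \<Longrightarrow> x \<in> U \<Longrightarrow> \<forall>\<^sub>F m in sequentially. {x'. idx m x' = idx m x} \<subseteq> U"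
    using ex_partition_index by blast
  obtain r1 where r1: "strict_mono r1" "AE \<omega> in M. cellwise_conv idx (\<lambda>n. P (s (r1 n)) \<omega>) (\<kappa>1 (V 1 \<omega>))"
    unfolding P_def using S1.AE_cellwise_conv_subsequence[OF h1 rcd(1) idx s] by blast
  \<comment> \<open>The second extraction runs inside the first, so that both estimates converge
    along the same sample sizes.\<close>
  obtain r2 where r2: "strict_mono r2"
    "AE \<omega> in M. cellwise_conv idx (\<lambda>n. Q ((s \<circ> r1) (r2 n)) \<omega>) (\<kappa>2 (V' 1 \<omega>))"
    unfolding Q_def
    using S2.AE_cellwise_conv_subsequence[OF h2 rcd(2) idx strict_mono_o[OF s r1(1)]] by blast
  define r where "r = r1 \<circ> r2"
  have PQ: "borel_subprob (P n \<omega>)" "borel_subprob (Q n \<omega>)" for n \<omega>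
    unfolding P_def Q_def by (rule kernel_cond_dist_borel_subprob[OF S1.K_nonneg])+
  have [measurable]: "V 1 \<in> M \<rightarrow>\<^sub>M borel" "V' 1 \<in> M \<rightarrow>\<^sub>M borel"
    by (intro S1.measurable_V S2.measurable_V; simp)+
  have \<kappa>: "\<kappa>1 \<in> borel \<rightarrow>\<^sub>M prob_algebra borel" "\<kappa>2 \<in> borel \<rightarrow>\<^sub>M prob_algebra borel"
    using rcd by (auto simp: regular_cond_dist_def)
  note [measurable] = measurable_prob_algebraD[OF \<kappa>(1)] measurable_prob_algebraD[OF \<kappa>(2)]
  have \<kappa>_sub: "borel_subprob (\<kappa>1 v)" "borel_subprob (\<kappa>2 v')" for v v'
    using measurable_space[OF measurable_prob_algebraD[OF \<kappa>(1)], of v]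
      measurable_space[OF measurable_prob_algebraD[OF \<kappa>(2)], of v']
    by (auto simp: borel_subprob_iff)
  have Pm[measurable]: "P n \<in> M \<rightarrow>\<^sub>M subprob_algebra borel" for n
    unfolding P_def[abs_def]
    by (rule kernel_cond_dist_measurable[OF S1.K_nonneg S1.K_measurable])
       (auto intro: h1 S1.measurable_X S1.measurable_V)
  have Qm[measurable]: "Q n \<in> M \<rightarrow>\<^sub>M subprob_algebra borel" for n
    unfolding Q_def[abs_def]
    by (rule kernel_cond_dist_measurable[OF S1.K_nonneg S2.K_measurable])
       (auto intro: h2 S2.measurable_X S2.measurable_V)
  have lim: "AE \<omega> in M. (\<lambda>n. ball_divergence (P (s (r n)) \<omega>) (Q (s (r n)) \<omega>))
      \<longlonglongrightarrow> ball_divergence (\<kappa>1 (V 1 \<omega>)) (\<kappa>2 (V' 1 \<omega>))"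
    using r1(2) r2(2) S1.AE_absolutely_continuous_cond[OF rcd(1)] S2.AE_absolutely_continuous_cond[OF rcd(2)]
  proof eventually_elim
    case (elim \<omega>)
    have "cellwise_conv idx (\<lambda>n. P (s (r n)) \<omega>) (\<kappa>1 (V 1 \<omega>))"
      using cellwise_conv_subseq[OF elim(1) r2(1)] by (simp add: r_def)
    moreover have "cellwise_conv idx (\<lambda>n. Q (s (r n)) \<omega>) (\<kappa>2 (V' 1 \<omega>))"
      using elim(2) by (simp add: r_def)
    ultimately show ?case by (rule ball_divergence_tendsto) (rule elim)+
  qed
  have "(\<lambda>n. LINT \<omega>|M. \<bar>ball_divergence (P (s (r n)) \<omega>) (Q (s (r n)) \<omega>) - ball_divergence (\<kappa>1 (V 1 \<omega>)) (\<kappa>2 (V' 1 \<omega>))\<bar>)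
     \<longlonglongrightarrow> (LINT \<omega>|M. 0)"
  proof (rule integral_dominated_convergence)
    \<comment> \<open>Both divergences lie in \<open>[0, 2]\<close>, hence so does the absolute
      difference.\<close>
    show "integrable M (\<lambda>_. 2 :: real)" by simp
    show "AE \<omega> in M. (\<lambda>n. \<bar>ball_divergence (P (s (r n)) \<omega>) (Q (s (r n)) \<omega>) - ball_divergence (\<kappa>1 (V 1 \<omega>)) (\<kappa>2 (V' 1 \<omega>))\<bar>) \<longlonglongrightarrow> 0"
      using lim by eventually_elim (intro tendsto_rabs_zero LIM_zero)
    show "AE \<omega> in M. norm \<bar>ball_divergence (P (s (r n)) \<omega>) (Q (s (r n)) \<omega>) - ball_divergence (\<kappa>1 (V 1 \<omega>)) (\<kappa>2 (V' 1 \<omega>))\<bar> \<le> 2" for n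
    proof (rule AE_I2)
      fix \<omega>
      show "norm \<bar>ball_divergence (P (s (r n)) \<omega>) (Q (s (r n)) \<omega>) - ball_divergence (\<kappa>1 (V 1 \<omega>)) (\<kappa>2 (V' 1 \<omega>))\<bar> \<le> 2"
        using ball_divergence_bounds[OF PQ, of "s (r n)" \<omega> "s (r n)" \<omega>] ball_divergence_bounds[OF \<kappa>_sub, of "V 1 \<omega>" "V' 1 \<omega>"]
        by (simp add: abs_le_iff)
    qed
    show "(\<lambda>\<omega>. \<bar>ball_divergence (P (s (r n)) \<omega>) (Q (s (r n)) \<omega>) - ball_divergence (\<kappa>1 (V 1 \<omega>)) (\<kappa>2 (V' 1 \<omega>))\<bar>) \<in> borel_measurable M" for n
      by (intro borel_measurable_abs borel_measurable_diff measurable_ball_divergence) measurable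
  qed simp
  moreover have "strict_mono r" unfolding r_def by (rule strict_mono_o[OF r1(1) r2(1)])
  ultimately show "\<exists>r. strict_mono r \<and> (\<lambda>n. LINT \<omega>|M. \<bar>ball_divergence
        (kernel_cond_dist K (h1 (s (r n))) (s (r n)) (\<lambda>i. X i \<omega>) (\<lambda>i. V i \<omega>) (V 1 \<omega>))
        (kernel_cond_dist K (h2 (s (r n))) (s (r n)) (\<lambda>i. X i \<omega>) (\<lambda>i. V' i \<omega>) (V' 1 \<omega>))
      - ball_divergence (\<kappa>1 (V 1 \<omega>)) (\<kappa>2 (V' 1 \<omega>))\<bar>) \<longlonglongrightarrow> 0"
    unfolding P_def Q_def Bochner_Integration.integral_zero by (intro exI[of _ r] conjI)
qed

section \<open>Exchangeability and the law of large numbers\<close>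

lemma (in prob_space) expectation_iid_reindex:
  fixes \<Phi> :: "(nat \<Rightarrow> 'b) \<Rightarrow> real"
  assumes ind: "indep_vars (\<lambda>_. N) \<xi> I" and I: "I \<noteq> {}"
    and law: "\<And>i. i \<in> I \<Longrightarrow> distr M N (\<xi> i) = \<mu>"
    and \<pi>: "bij_betw \<pi> I I" and \<Phi>: "\<Phi> \<in> borel_measurable (PiM I (\<lambda>_. N))"
  shows "expectation (\<lambda>\<omega>. \<Phi> (\<lambda>i\<in>I. \<xi> (\<pi> i) \<omega>)) = expectation (\<lambda>\<omega>. \<Phi> (\<lambda>i\<in>I. \<xi> i \<omega>))"
proof -
  have rv: "\<xi> i \<in> M \<rightarrow>\<^sub>M N" if "i \<in> I" for i
    using ind that by (auto simp: indep_vars_def)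
  obtain i0 where i0: "i0 \<in> I" using I by auto
  have \<mu>: "prob_space \<mu>" and s\<mu>: "sets \<mu> = sets N"
    using law[OF i0] prob_space_distr[OF rv[OF i0]] by auto
  have \<pi>I: "\<pi> i \<in> I" if "i \<in> I" for i using \<pi> that by (auto simp: bij_betw_def)
  have tup: "(\<lambda>\<omega>. \<lambda>i\<in>I. \<xi> i \<omega>) \<in> M \<rightarrow>\<^sub>M PiM I (\<lambda>_. N)" by (rule measurable_restrict) (rule rv)
  have perm: "(\<lambda>t. \<lambda>i\<in>I. t (\<pi> i)) \<in> PiM I (\<lambda>_. N) \<rightarrow>\<^sub>M PiM I (\<lambda>_. N)"
    by (intro measurable_restrict measurable_component_singleton \<pi>I)
  have law_tup: "distr M (PiM I (\<lambda>_. N)) (\<lambda>\<omega>. \<lambda>i\<in>I. \<xi> i \<omega>) = PiM I (\<lambda>_. \<mu>)"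
    using indep_vars_iff_distr_eq_PiM'[OF I rv] ind by (simp add: law cong: PiM_cong)
  have eqP: "sets (PiM I (\<lambda>_. \<mu>)) = sets (PiM I (\<lambda>_. N))"
    by (rule sets_PiM_cong) (simp_all add: s\<mu>)
  \<comment> \<open>Identical factors make the product law of the sample tuple invariant under
    permutation of coordinates; this is the whole content of exchangeability here.\<close>
  have "distr (PiM I (\<lambda>_. \<mu>)) (PiM I (\<lambda>_. \<mu>)) (\<lambda>t. \<lambda>i\<in>I. t (\<pi> i)) = PiM I (\<lambda>_. \<mu>)"
    using distr_PiM_reindex[of I "\<lambda>_. \<mu>" \<pi> I] \<mu> \<pi> \<pi>I by (auto simp: bij_betw_def)
  then have law_perm: "distr (PiM I (\<lambda>_. \<mu>)) (PiM I (\<lambda>_. N)) (\<lambda>t. \<lambda>i\<in>I. t (\<pi> i)) = PiM I (\<lambda>_. \<mu>)"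
    by (subst distr_cong[OF refl eqP[symmetric] refl])
  have "expectation (\<lambda>\<omega>. \<Phi> (\<lambda>i\<in>I. \<xi> (\<pi> i) \<omega>)) = expectation (\<lambda>\<omega>. \<Phi> (\<lambda>i\<in>I. (\<lambda>i\<in>I. \<xi> i \<omega>) (\<pi> i)))"
    by (simp add: \<pi>I cong: restrict_cong)
  also have "\<dots> = (LINT t|PiM I (\<lambda>_. \<mu>). \<Phi> (\<lambda>i\<in>I. t (\<pi> i)))"
    unfolding law_tup[symmetric] by (rule integral_distr[OF tup measurable_compose[OF perm \<Phi>], symmetric])
  also have "\<dots> = (LINT t|distr (PiM I (\<lambda>_. \<mu>)) (PiM I (\<lambda>_. N)) (\<lambda>t. \<lambda>i\<in>I. t (\<pi> i)). \<Phi> t)"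
    by (rule integral_distr[OF _ \<Phi>, symmetric]) (use perm eqP in \<open>simp cong: measurable_cong_sets\<close>)
  also have "\<dots> = (LINT t|distr M (PiM I (\<lambda>_. N)) (\<lambda>\<omega>. \<lambda>i\<in>I. \<xi> i \<omega>). \<Phi> t)"
    unfolding law_perm law_tup ..
  also have "\<dots> = expectation (\<lambda>\<omega>. \<Phi> (\<lambda>i\<in>I. \<xi> i \<omega>))"
    by (rule integral_distr[OF tup \<Phi>])
  finally show ?thesis .
qed

text \<open>The centred sum has second moment at most \<open>n B\<^sup>2\<close>; its root divided
  by \<open>n\<close> is the rate. A bound in mean, rather than in probability, can be added to the
  error of the estimated divergences.\<close>

lemma (in prob_space) iid_mean_L1_bound:
  fixes Y :: "nat \<Rightarrow> 'a \<Rightarrow> real"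
  assumes ind: "indep_vars (\<lambda>_. borel) Y {1..}"
    and bd: "\<And>i \<omega>. i \<ge> 1 \<Longrightarrow> \<bar>Y i \<omega>\<bar> \<le> B" and B: "0 \<le> B"
    and mean: "\<And>i. i \<ge> 1 \<Longrightarrow> expectation (Y i) = c" and n: "n \<ge> 1"
  shows "expectation (\<lambda>\<omega>. \<bar>1 / real n * (\<Sum>i=1..n. Y i \<omega>) - c\<bar>) \<le> B / sqrt (real n)"
proof -
  have rv[measurable]: "Y i \<in> borel_measurable M" if "i \<in> {1..n}" for i
    using ind that by (auto simp: indep_vars_def)
  define D where "D \<omega> = (\<Sum>i=1..n. Y i \<omega> - expectation (Y i))" for \<omega>
  have c: "\<bar>c\<bar> \<le> B"
  proof -
    have "\<bar>expectation (Y 1)\<bar> \<le> expectation (\<lambda>\<omega>. \<bar>Y 1 \<omega>\<bar>)" by (rule integral_abs_bound)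
    also have "\<dots> \<le> expectation (\<lambda>_. B)"
      using rv[of 1] n bd B by (intro integral_mono integrable_const_bound[of _ B]) auto
    finally show ?thesis by (simp add: mean prob_space)
  qed
  have Dm[measurable]: "D \<in> borel_measurable M"
    unfolding D_def[abs_def] using rv by measurable
  have D_bd: "\<bar>D \<omega>\<bar> \<le> real n * (2 * B)" for \<omega>
  proof -
    have "\<bar>D \<omega>\<bar> \<le> (\<Sum>i=1..n. \<bar>Y i \<omega> - expectation (Y i)\<bar>)" unfolding D_def by (rule sum_abs)
    also have "\<dots> \<le> (\<Sum>i=1..n. 2 * B)"
    proof (rule sum_mono)
      fix i assume "i \<in> {1..n}"
      then have "\<bar>Y i \<omega>\<bar> \<le> B" "expectation (Y i) = c" using bd mean by auto
      then show "\<bar>Y i \<omega> - expectation (Y i)\<bar> \<le> 2 * B" using c by simp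
    qed
    finally show ?thesis by simp
  qed
  have int: "integrable M D"
    by (rule integrable_const_bound[of _ "real n * (2 * B)"]) (use D_bd in auto)
  have int2: "integrable M (\<lambda>\<omega>. (D \<omega>)\<^sup>2)"
  proof (rule integrable_const_bound[of _ "(real n * (2 * B))\<^sup>2"])
    show "AE \<omega> in M. norm ((D \<omega>)\<^sup>2) \<le> (real n * (2 * B))\<^sup>2"
    proof (rule AE_I2)
      fix \<omega>
      have "\<bar>D \<omega>\<bar>\<^sup>2 \<le> (real n * (2 * B))\<^sup>2" by (intro power_mono D_bd) simp
      then show "norm ((D \<omega>)\<^sup>2) \<le> (real n * (2 * B))\<^sup>2" by simp
    qed
  qed simp
  have "expectation (\<lambda>\<omega>. (D \<omega>)\<^sup>2) \<le> (\<Sum>i=1..n. expectation (\<lambda>\<omega>. (Y i \<omega>)\<^sup>2))"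
    unfolding D_def by (rule expectation_square_centered_sum[where B=B])
      (use bd in \<open>auto intro: indep_vars_subset[OF ind]\<close>)
  also have "\<dots> \<le> (\<Sum>i=1..n. B\<^sup>2)"
  proof (rule sum_mono)
    fix i assume i: "i \<in> {1..n}"
    have sq: "(Y i \<omega>)\<^sup>2 \<le> B\<^sup>2" for \<omega>
      using power_mono[OF bd[of i \<omega>], of 2] i by simp
    have "expectation (\<lambda>\<omega>. (Y i \<omega>)\<^sup>2) \<le> expectation (\<lambda>_. B\<^sup>2)"
      using rv[OF i] sq by (intro integral_mono integrable_const_bound[of _ "B\<^sup>2"]) auto
    then show "expectation (\<lambda>\<omega>. (Y i \<omega>)\<^sup>2) \<le> B\<^sup>2" by (simp add: prob_space)
  qed
  finally have e2: "expectation (\<lambda>\<omega>. (D \<omega>)\<^sup>2) \<le> real n * B\<^sup>2" by simp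
  have "1 / real n * (\<Sum>i=1..n. Y i \<omega>) - c = D \<omega> / real n" for \<omega>
    using n mean by (simp add: D_def sum_subtractf field_simps)
  then have "expectation (\<lambda>\<omega>. \<bar>1 / real n * (\<Sum>i=1..n. Y i \<omega>) - c\<bar>) = expectation (\<lambda>\<omega>. \<bar>D \<omega>\<bar>) / real n"
    by simp
  also have "\<dots> \<le> sqrt (real n * B\<^sup>2) / real n"
    by (intro divide_right_mono order_trans[OF expectation_abs_le_sqrt[OF int int2]] real_sqrt_le_mono e2) simp
  also have "\<dots> = B / sqrt (real n)"
    using n B by (simp add: real_sqrt_mult field_simps)
  finally show ?thesis .
qed

section \<open>Consistency\<close>

text \<open>The quotient of \<open>n h^(d+4)\<close>, which tends to 0, by \<open>n h^d\<close>,
  which tends to infinity, is \<open>h^4\<close>; the fourth root gives the claim.\<close>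

lemma bandwidth_tendsto_0:
  fixes h :: "nat \<Rightarrow> real"
  assumes pos: "\<And>n. n \<ge> 1 \<Longrightarrow> 0 < h n"
    and top: "filterlim (\<lambda>n. real n * h n ^ d) at_top sequentially"
    and zero: "(\<lambda>n. real n * h n ^ (d + 4)) \<longlonglongrightarrow> 0"
  shows "h \<longlonglongrightarrow> 0"
proof -
  have "(\<lambda>n. (real n * h n ^ (d + 4)) / (real n * h n ^ d)) \<longlonglongrightarrow> 0"
    by (rule real_tendsto_divide_at_top[OF zero top])
  then have "(\<lambda>n. root 4 ((real n * h n ^ (d + 4)) / (real n * h n ^ d))) \<longlonglongrightarrow> root 4 0"
    by (rule tendsto_real_root)
  moreover have "\<forall>\<^sub>F n in sequentially. root 4 ((real n * h n ^ (d + 4)) / (real n * h n ^ d)) = h n"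
    using eventually_ge_at_top[of 1]
  proof eventually_elim
    case (elim n)
    then have "(real n * h n ^ (d + 4)) / (real n * h n ^ d) = h n ^ 4"
      using pos[of n] by (simp add: power_add)
    then show ?case using pos[OF elim] by (simp add: real_root_power_cancel)
  qed
  ultimately show ?thesis by (auto dest: Lim_transform_eventually)
qed

lemma tendsto_in_prob_if_L1:
  assumes "prob_space M" and T: "\<And>n. T n \<in> borel_measurable M"
    and int: "\<And>n. n \<ge> 1 \<Longrightarrow> integrable M (T n)"
    and bd: "\<And>n. n \<ge> 1 \<Longrightarrow> (LINT \<omega>|M. \<bar>T n \<omega> - c\<bar>) \<le> u n" and u: "u \<longlonglongrightarrow> 0"
  shows "tendsto_in_prob M T c"
  unfolding tendsto_in_prob_def
proof (intro conjI allI impI T)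
  interpret prob_space M by fact
  note [measurable] = T
  fix \<epsilon> :: real assume \<epsilon>: "\<epsilon> > 0"
  show "(\<lambda>n. prob {\<omega> \<in> space M. \<epsilon> < \<bar>T n \<omega> - c\<bar>}) \<longlonglongrightarrow> 0"
  proof (rule tendsto_sandwich[OF _ _ tendsto_const])
    show "(\<lambda>n. u n / \<epsilon>) \<longlonglongrightarrow> 0" using tendsto_divide[OF u tendsto_const[of \<epsilon>]] \<epsilon> by simp
    show "\<forall>\<^sub>F n in sequentially. prob {\<omega> \<in> space M. \<epsilon> < \<bar>T n \<omega> - c\<bar>} \<le> u n / \<epsilon>"
      using eventually_ge_at_top[of 1]
    proof eventually_elim
      case (elim n)
      have "prob {\<omega> \<in> space M. \<epsilon> < \<bar>T n \<omega> - c\<bar>} \<le> prob {\<omega> \<in> space M. \<epsilon> \<le> \<bar>T n \<omega> - c\<bar>}"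
        by (rule finite_measure_mono) auto
      also have "\<dots> \<le> (LINT \<omega>|M. \<bar>T n \<omega> - c\<bar>) / \<epsilon>"
        using int[OF elim] \<epsilon> by (intro integral_Markov_inequality_measure[of _ _ "{}"]) auto
      also have "\<dots> \<le> u n / \<epsilon>" using bd[OF elim] \<epsilon> by (intro divide_right_mono) auto
      finally show ?case .
    qed
  qed simp
qed

text \<open>Tonelli with the middle coordinate innermost, so that the inner integral is the marginal
  in the outer two coordinates.\<close>

lemma nn_integral_marginal_swap:
  fixes \<phi> :: "'x::euclidean_space \<times> 'y::euclidean_space \<times> 'z::euclidean_space \<Rightarrow> ennreal"
  assumes [measurable]: "\<phi> \<in> borel_measurable borel"
  shows "(\<integral>\<^sup>+w. \<phi> w \<partial>lborel) = (\<integral>\<^sup>+v. \<integral>\<^sup>+y. \<phi> (fst v, y, snd v) \<partial>lborel \<partial>lborel)"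
proof -
  have m[measurable]: "\<phi> \<in> borel_measurable (borel \<Otimes>\<^sub>M (borel \<Otimes>\<^sub>M borel))"
    by (simp add: borel_prod)
  have "(\<integral>\<^sup>+w. \<phi> w \<partial>lborel) = (\<integral>\<^sup>+w. \<phi> w \<partial>(lborel \<Otimes>\<^sub>M lborel))"
    by (simp add: lborel_prod)
  also have "\<dots> = (\<integral>\<^sup>+x. \<integral>\<^sup>+v. \<phi> (x, v) \<partial>(lborel \<Otimes>\<^sub>M lborel) \<partial>lborel)"
    unfolding lborel_prod[where 'a='y and 'b='z] by (rule lborel.nn_integral_fst[symmetric]) (simp add: lborel_prod)
  also have "\<dots> = (\<integral>\<^sup>+x. \<integral>\<^sup>+z. \<integral>\<^sup>+y. \<phi> (x, y, z) \<partial>lborel \<partial>lborel \<partial>lborel)"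
    by (intro nn_integral_cong lborel_pair.nn_integral_snd[symmetric]) measurable
  also have "\<dots> = (\<integral>\<^sup>+v. \<integral>\<^sup>+y. \<phi> (fst v, y, snd v) \<partial>lborel \<partial>(lborel \<Otimes>\<^sub>M lborel))"
    by (subst lborel.nn_integral_fst[symmetric]) auto
  finally show ?thesis by (simp add: lborel_prod)
qed

theorem theorem2p1:
  fixes M :: "'w measure"
    and X :: "'w \<Rightarrow> 'x::euclidean_space"
    and Y :: "'w \<Rightarrow> 'y::euclidean_space"
    and Z :: "'w \<Rightarrow> 'z::euclidean_space"
    and Xs :: "nat \<Rightarrow> 'w \<Rightarrow> 'x"
    and Ys :: "nat \<Rightarrow> 'w \<Rightarrow> 'y"
    and Zs :: "nat \<Rightarrow> 'w \<Rightarrow> 'z"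
    and p :: "'x \<times> 'y \<times> 'z \<Rightarrow> real"
    and a :: "'y \<times> 'z \<Rightarrow> real"
    and K :: "real \<Rightarrow> real"
    and h1 h2 :: "nat \<Rightarrow> real"
    and \<kappa>1 :: "'y \<times> 'z \<Rightarrow> 'x measure"
    and \<kappa>2 :: "'z \<Rightarrow> 'x measure"
  assumes "prob_space M"
    and "\<And>v. 0 \<le> p v"
    and "distributed M lborel (\<lambda>\<omega>. (X \<omega>, Y \<omega>, Z \<omega>)) (\<lambda>v. ennreal (p v))"
    and "prob_space.indep_vars M (\<lambda>_. borel) (\<lambda>i \<omega>. (Xs i \<omega>, Ys i \<omega>, Zs i \<omega>)) {1..}"
    and "\<And>i. i \<ge> 1 \<Longrightarrow> distr M borel (\<lambda>\<omega>. (Xs i \<omega>, Ys i \<omega>, Zs i \<omega>))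
                       = distr M borel (\<lambda>\<omega>. (X \<omega>, Y \<omega>, Z \<omega>))"
    and "regular_cond_dist M X (\<lambda>\<omega>. (Y \<omega>, Z \<omega>)) \<kappa>1"
    and "regular_cond_dist M X Z \<kappa>2"
    and "weight_function (marginal_YZ p) a"
    and "\<And>n. n \<ge> 1 \<Longrightarrow> 0 < h1 n"
    and "\<And>n. n \<ge> 1 \<Longrightarrow> 0 < h2 n"
    and "assumption_A1 p"
    and "assumption_A2 TYPE('y) TYPE('z) K"
    and "assumption_A3 (DIM('y) + DIM('z)) DIM('z) h1 h2"
  shows "tendsto_in_prob M
           (\<lambda>n \<omega>. zeta_hat K (h1 n) (h2 n) a n (\<lambda>i. Xs i \<omega>) (\<lambda>i. Ys i \<omega>) (\<lambda>i. Zs i \<omega>))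
           (cond_ball_divergence M Y Z \<kappa>1 \<kappa>2 a)"
proof -
  interpret prob_space M by fact
  note p_nonneg = assms(2) and iid = assms(4) and law = assms(5)
  define W where "W i \<omega> = (Ys i \<omega>, Zs i \<omega>)" for i \<omega>

  \<comment> \<open>Joint law, density bound and kernel constants\<close>
  have ep: "(\<lambda>v. ennreal (p v)) \<in> borel_measurable borel"
    using distributed_borel_measurable[OF assms(3)] by simp
  have p_meas[measurable]: "p \<in> borel_measurable borel"
    using borel_measurable_enn2real[OF ep] p_nonneg by simp
  have p_meas'[measurable]: "p \<in> borel_measurable (borel \<Otimes>\<^sub>M (borel \<Otimes>\<^sub>M borel))"
    by (simp add: borel_prod)
  have XYZ: "(\<lambda>\<omega>. (X \<omega>, Y \<omega>, Z \<omega>)) \<in> M \<rightarrow>\<^sub>M borel"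
    using distributed_measurable[OF assms(3)] by simp
  have XYZs: "(\<lambda>\<omega>. (Xs i \<omega>, Ys i \<omega>, Zs i \<omega>)) \<in> M \<rightarrow>\<^sub>M borel" if "i \<ge> 1" for i
    using iid that by (auto simp: indep_vars_def)
  have density: "distr M borel (\<lambda>\<omega>. (X \<omega>, Y \<omega>, Z \<omega>)) = density lborel (\<lambda>v. ennreal (p v))"
    using distributed_distr_eq_density[OF assms(3)] by (simp cong: distr_cong)

  obtain C0 where C0: "\<And>y z. (\<integral>\<^sup>+x. ennreal (p (x, y, z)) \<partial>lborel) \<le> ennreal C0"
      "\<And>x z. (\<integral>\<^sup>+y. ennreal (p (x, y, z)) \<partial>lborel) \<le> ennreal C0"
      "\<And>z. (\<integral>\<^sup>+w. ennreal (p (fst w, snd w, z)) \<partial>lborel) \<le> ennreal C0"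
    using assms(11) unfolding assumption_A1_def bounded_with_marginals_def by auto
  \<comment> \<open>\<open>ennreal\<close> sends negative constants to 0, so taking the maximum with
    0 leaves the bounds unchanged and provides the nonnegative constant that the locale asks
    for.\<close>
  define C where "C = max 0 C0"
  have C: "0 \<le> C" "ennreal C0 = ennreal C" by (auto simp: C_def max_def ennreal_neg)
  obtain B where B: "\<And>t. K t \<le> B" using assms(12) by (auto simp: assumption_A2_def)
  have K_nonneg: "\<And>t. 0 \<le> K t"
    and K_norm1: "has_bochner_integral lborel (\<lambda>u::'y \<times> 'z. K (norm u)) 1"
    and K_norm2: "has_bochner_integral lborel (\<lambda>u::'z. K (norm u)) 1"
    using assms(12) by (auto simp: assumption_A2_def kernel_normalized_def)

  have S1: "kernel_sample M Xs W p C K B"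
  proof unfold_locales
    show "indep_vars (\<lambda>_. borel) (\<lambda>i \<omega>. (Xs i \<omega>, W i \<omega>)) {1..}" unfolding W_def by (rule iid)
    show "distr M borel (\<lambda>\<omega>. (Xs i \<omega>, W i \<omega>)) = density lborel (\<lambda>w. ennreal (p w))" if "i \<ge> 1" for i
      unfolding W_def using law[OF that] density by simp
    show "(\<integral>\<^sup>+x. ennreal (p (x, v)) \<partial>lborel) \<le> ennreal C" for v
      using C0(1)[of "fst v" "snd v"] C by simp
  qed (use p_nonneg p_meas C K_nonneg B K_norm1 in auto)

  \<comment> \<open>The pair of the first and third components and its density\<close>
  define q where "q v = marginal_XZ p (fst v) (snd v)" for v
  \<comment> \<open>The bound on every section excludes a divergent integral, whose Bochner value
    would be 0; so \<open>q\<close> is the marginal at every point and not merely almost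
    everywhere.\<close>
  have q_ennreal: "ennreal (q v) = (\<integral>\<^sup>+y. ennreal (p (fst v, y, snd v)) \<partial>lborel)" for v
  proof -
    have "q v = enn2real (\<integral>\<^sup>+y. ennreal (p (fst v, y, snd v)) \<partial>lborel)"
      unfolding q_def marginal_XZ_def by (rule integral_eq_nn_integral) (auto simp: p_nonneg)
    then show ?thesis
      using C0(2)[of "fst v" "snd v"] by (simp add: order_le_less_trans[OF _ ennreal_less_top])
  qed
  have q_nonneg: "0 \<le> q v" for v
    unfolding q_def marginal_XZ_def by (rule Bochner_Integration.integral_nonneg) (rule p_nonneg)
  have q_meas: "q \<in> borel_measurable borel"
    unfolding q_def[abs_def] marginal_XZ_def borel_prod[symmetric] by measurable
  have proj: "(\<lambda>w. (fst w, snd (snd w))) \<in> (borel :: ('x \<times> 'y \<times> 'z) measure) \<rightarrow>\<^sub>M (borel :: ('x \<times> 'z) measure)"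
    unfolding borel_prod[symmetric] by measurable
  have law2: "distr M borel (\<lambda>\<omega>. (Xs i \<omega>, Zs i \<omega>)) = density lborel (\<lambda>v. ennreal (q v))" if i: "i \<ge> 1" for i
  proof -
    have "distr M borel (\<lambda>\<omega>. (Xs i \<omega>, Zs i \<omega>))
       = distr (distr M borel (\<lambda>\<omega>. (Xs i \<omega>, Ys i \<omega>, Zs i \<omega>))) borel (\<lambda>w. (fst w, snd (snd w)))"
      by (subst distr_distr[OF proj XYZs[OF i]]) (simp add: o_def)
    also have "\<dots> = distr (density lborel (\<lambda>v. ennreal (p v))) borel (\<lambda>w. (fst w, snd (snd w)))"
      unfolding law[OF i] density ..
    also have "\<dots> = density lborel (\<lambda>v. ennreal (q v))"
    proof (rule measure_eqI)
      fix S :: "('x \<times> 'z) set"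
      assume "S \<in> sets (distr (density lborel (\<lambda>v. ennreal (p v))) borel (\<lambda>w. (fst w, snd (snd w))))"
      then have S[measurable]: "S \<in> sets borel" by simp
      have pre: "(\<lambda>w. (fst w, snd (snd w))) -` S \<in> sets (borel :: ('x \<times> 'y \<times> 'z) measure)"
        using measurable_sets[OF proj S] by simp
      have "emeasure (distr (density lborel (\<lambda>v. ennreal (p v))) borel (\<lambda>w. (fst w, snd (snd w)))) S
         = (\<integral>\<^sup>+w. ennreal (p w) * indicator ((\<lambda>w. (fst w, snd (snd w))) -` S) w \<partial>lborel)"
        using proj S pre ep by (subst emeasure_distr) (auto simp: emeasure_density)
      also have "\<dots> = (\<integral>\<^sup>+v. \<integral>\<^sup>+y. ennreal (p (fst v, y, snd v)) * indicator S v \<partial>lborel \<partial>lborel)"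
        by (subst nn_integral_marginal_swap[OF borel_measurable_times_ennreal[OF ep borel_measurable_indicator[OF pre]]])
           (auto intro!: nn_integral_cong simp: indicator_def)
      also have "\<dots> = (\<integral>\<^sup>+v. ennreal (q v) * indicator S v \<partial>lborel)"
        unfolding q_ennreal by (intro nn_integral_cong nn_integral_multc) measurable
      also have "\<dots> = emeasure (density lborel (\<lambda>v. ennreal (q v))) S"
        using q_meas S by (subst emeasure_density) auto
      finally show "emeasure (distr (density lborel (\<lambda>v. ennreal (p v))) borel (\<lambda>w. (fst w, snd (snd w)))) S
        = emeasure (density lborel (\<lambda>v. ennreal (q v))) S" .
    qed simp
    finally show ?thesis .
  qed
  have S2: "kernel_sample M Xs Zs q C K B"
  proof unfold_locales
    show "indep_vars (\<lambda>_. borel) (\<lambda>i \<omega>. (Xs i \<omega>, Zs i \<omega>)) {1..}"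
      using indep_vars_compose2[OF iid proj] by simp
    \<comment> \<open>Integrating \<open>q\<close> over \<open>x\<close> integrates \<open>p\<close>
      over \<open>(x, y)\<close>, so the bound needed here is the one on the marginal density of the
      third component.\<close>
    show "(\<integral>\<^sup>+x. ennreal (q (x, v)) \<partial>lborel) \<le> ennreal C" for v
    proof -
      have "(\<integral>\<^sup>+x. ennreal (q (x, v)) \<partial>lborel) = (\<integral>\<^sup>+x. \<integral>\<^sup>+y. ennreal (p (x, y, v)) \<partial>lborel \<partial>lborel)"
        by (simp add: q_ennreal)
      also have "\<dots> = (\<integral>\<^sup>+w. ennreal (p (fst w, snd w, v)) \<partial>(lborel \<Otimes>\<^sub>M lborel))"
        by (subst lborel.nn_integral_fst[symmetric]) auto
      also have "\<dots> \<le> ennreal C" using C0(3)[of v] C by (simp add: lborel_prod)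
      finally show ?thesis .
    qed
  qed (use law2 q_nonneg q_meas C K_nonneg B K_norm2 in auto)
  interpret S1: kernel_sample M Xs W p C K B by (rule S1)
  interpret S2: kernel_sample M Xs Zs q C K B by (rule S2)

  \<comment> \<open>Bandwidths and conditional distributions of the first observation\<close>
  have A3: "filterlim (\<lambda>n. real n * h1 n ^ DIM('y \<times> 'z)) at_top sequentially"
      "filterlim (\<lambda>n. real n * h2 n ^ DIM('z)) at_top sequentially"
      "(\<lambda>n. real n * h1 n ^ (DIM('y \<times> 'z) + 4)) \<longlonglongrightarrow> 0"
      "(\<lambda>n. real n * h2 n ^ (DIM('z) + 4)) \<longlonglongrightarrow> 0"
    using assms(13) by (auto simp: assumption_A3_def)
  have h1_0: "h1 \<longlonglongrightarrow> 0" by (rule bandwidth_tendsto_0[OF assms(9) A3(1,3)])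
  have h2_0: "h2 \<longlonglongrightarrow> 0" by (rule bandwidth_tendsto_0[OF assms(10) A3(2,4)])

  have XZ: "(\<lambda>\<omega>. (X \<omega>, Z \<omega>)) \<in> M \<rightarrow>\<^sub>M borel" "(\<lambda>\<omega>. (Xs 1 \<omega>, Zs 1 \<omega>)) \<in> M \<rightarrow>\<^sub>M borel"
    using measurable_compose[OF XYZ proj] measurable_compose[OF XYZs[of 1] proj] by auto
  have lawXZ: "distr M borel (\<lambda>\<omega>. (Xs 1 \<omega>, Zs 1 \<omega>)) = distr M borel (\<lambda>\<omega>. (X \<omega>, Z \<omega>))"
  proof -
    have "distr M borel (\<lambda>\<omega>. (Xs 1 \<omega>, Zs 1 \<omega>))
        = distr (distr M borel (\<lambda>\<omega>. (Xs 1 \<omega>, Ys 1 \<omega>, Zs 1 \<omega>))) borel (\<lambda>w. (fst w, snd (snd w)))"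
      by (subst distr_distr[OF proj XYZs[OF order_refl]]) (simp add: o_def)
    also have "\<dots> = distr (distr M borel (\<lambda>\<omega>. (X \<omega>, Y \<omega>, Z \<omega>))) borel (\<lambda>w. (fst w, snd (snd w)))"
      unfolding law[OF order_refl] ..
    also have "\<dots> = distr M borel (\<lambda>\<omega>. (X \<omega>, Z \<omega>))"
      by (subst distr_distr[OF proj XYZ]) (simp add: o_def)
    finally show ?thesis .
  qed
  have rcd1: "regular_cond_dist M (Xs 1) (W 1) \<kappa>1"
    unfolding W_def by (rule regular_cond_dist_cong_law[OF assms(6) XYZ XYZs law]) simp_all
  have rcd2: "regular_cond_dist M (Xs 1) (Zs 1) \<kappa>2"
    by (rule regular_cond_dist_cong_law[OF assms(7) XZ lawXZ])
  have \<kappa>1: "\<kappa>1 \<in> borel \<rightarrow>\<^sub>M subprob_algebra borel" and \<kappa>2: "\<kappa>2 \<in> borel \<rightarrow>\<^sub>M subprob_algebra borel"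
    using assms(6,7) by (auto simp: regular_cond_dist_def intro: measurable_prob_algebraD)

  \<comment> \<open>Estimated and limiting divergence of a single summand\<close>
  define Bh where "Bh n s \<omega> = ball_divergence (kernel_cond_dist K (h1 n) n (\<lambda>i. Xs i \<omega>) (\<lambda>i. W i \<omega>) (W s \<omega>))
      (kernel_cond_dist K (h2 n) n (\<lambda>i. Xs i \<omega>) (\<lambda>i. Zs i \<omega>) (Zs s \<omega>))" for n s \<omega>
  define b where "b w = ball_divergence (\<kappa>1 w) (\<kappa>2 (snd w))" for w
  define e where "e n = expectation (\<lambda>\<omega>. \<bar>Bh n 1 \<omega> - b (W 1 \<omega>)\<bar>)" for n
  have e: "e \<longlonglongrightarrow> 0"
    unfolding e_def[abs_def] Bh_def b_def
    using ball_divergence_kernel_L1[OF S1 S2 assms(9) h1_0 A3(1) assms(10) h2_0 A3(2) rcd1 rcd2]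
    by (simp add: W_def)

  have b_meas[measurable]: "b \<in> borel_measurable borel"
  proof -
    have "snd \<in> (borel :: ('y \<times> 'z) measure) \<rightarrow>\<^sub>M borel" unfolding borel_prod[symmetric] by measurable
    from measurable_ball_divergence[OF \<kappa>1 measurable_compose[OF this \<kappa>2]]
    show ?thesis by (simp add: b_def[abs_def])
  qed
  have b_bd: "0 \<le> b w" "b w \<le> 2" for w
    unfolding b_def using measurable_space[OF \<kappa>1, of w] measurable_space[OF \<kappa>2, of "snd w"]
    by (auto simp: borel_subprob_iff intro: ball_divergence_bounds)
  have Bh_bd: "0 \<le> Bh n s \<omega>" "Bh n s \<omega> \<le> 2" for n s \<omega>
    unfolding Bh_def by (intro ball_divergence_bounds kernel_cond_dist_borel_subprob K_nonneg)+
  have Bh_meas: "Bh n s \<in> borel_measurable M" if "s \<in> {1..n}" for n s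
    unfolding Bh_def[abs_def] using that
    by (intro measurable_ball_divergence kernel_cond_dist_measurable K_nonneg S1.K_measurable S2.K_measurable
        S1.measurable_X S1.measurable_V S2.measurable_V assms(9,10)) auto

  \<comment> \<open>Equal expected error of all summands\<close>
  have exch: "expectation (\<lambda>\<omega>. \<bar>Bh n s \<omega> - b (W s \<omega>)\<bar>) = e n" if s: "s \<in> {1..n}" for n s
  proof -
    \<comment> \<open>The transposition of 1 and \<open>s\<close> brings the \<open>s\<close>-th
      point to the distinguished position 1. It is its own inverse, hence its own witness of
      bijectivity.\<close>
    define \<pi> :: "nat \<Rightarrow> nat" where "\<pi> i = (if i = 1 then s else if i = s then 1 else i)" for i
    have \<pi>: "bij_betw \<pi> {1..n} {1..n}"
      by (rule bij_betw_byWitness[where f'=\<pi>]) (use s in \<open>auto simp: \<pi>_def\<close>)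
    define I where "I = {1..n}"
    define \<xi> where "\<xi> i \<omega> = (Xs i \<omega>, W i \<omega>)" for i \<omega>
    have 1: "1 \<in> I" using s by (auto simp: I_def)
    define \<Phi> :: "(nat \<Rightarrow> 'x \<times> 'y \<times> 'z) \<Rightarrow> real" where "\<Phi> t = \<bar>ball_divergence
        (kernel_cond_dist K (h1 n) n (\<lambda>i. fst (t i)) (\<lambda>i. snd (t i)) (snd (t 1)))
        (kernel_cond_dist K (h2 n) n (\<lambda>i. fst (t i)) (\<lambda>i. snd (snd (t i))) (snd (snd (t 1)))) - b (snd (t 1))\<bar>" for t
    have comp: "(\<lambda>t. t i) \<in> PiM I (\<lambda>_. borel :: ('x \<times> 'y \<times> 'z) measure) \<rightarrow>\<^sub>M borel" if "i \<in> I" for i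
      using that by (rule measurable_component_singleton)
    have pr: "fst \<in> (borel :: ('x \<times> 'y \<times> 'z) measure) \<rightarrow>\<^sub>M borel" "snd \<in> (borel :: ('x \<times> 'y \<times> 'z) measure) \<rightarrow>\<^sub>M borel"
      "(\<lambda>w. snd (snd w)) \<in> (borel :: ('x \<times> 'y \<times> 'z) measure) \<rightarrow>\<^sub>M borel"
      unfolding borel_prod[symmetric] by measurable
    note cpr = measurable_compose[OF comp pr(1)] measurable_compose[OF comp pr(2)] measurable_compose[OF comp pr(3)]
    have \<Phi>: "\<Phi> \<in> borel_measurable (PiM I (\<lambda>_. borel))"
      unfolding \<Phi>_def[abs_def]
      by (intro borel_measurable_abs borel_measurable_diff measurable_ball_divergence kernel_cond_dist_measurable
          K_nonneg S1.K_measurable S2.K_measurable cpr assms(9,10) measurable_compose[OF cpr(2) b_meas])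
         (use 1 in \<open>auto simp: I_def\<close>)
    have ind: "indep_vars (\<lambda>_. borel) \<xi> I"
      unfolding \<xi>_def[abs_def] by (rule indep_vars_subset[OF S1.indep]) (auto simp: I_def)
    \<comment> \<open>Relabelling the sample leaves both estimates unchanged, so permuting the tuple
      only moves the evaluation point. A general \<open>\<rho>\<close> covers the transposition and
      the identity alike; the latter is needed because tuples are restricted to
      \<open>I\<close>.\<close>
    have val: "\<Phi> (\<lambda>i\<in>I. \<xi> (\<rho> i) \<omega>) = \<bar>Bh n (\<rho> 1) \<omega> - b (W (\<rho> 1) \<omega>)\<bar>" if \<rho>: "bij_betw \<rho> {1..n} {1..n}" for \<rho> \<omega>
    proof -
      have "kernel_cond_dist K (h1 n) n (\<lambda>i. fst ((\<lambda>i\<in>I. \<xi> (\<rho> i) \<omega>) i)) (\<lambda>i. snd ((\<lambda>i\<in>I. \<xi> (\<rho> i) \<omega>) i)) (W (\<rho> 1) \<omega>)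
          = kernel_cond_dist K (h1 n) n (\<lambda>i. Xs i \<omega>) (\<lambda>i. W i \<omega>) (W (\<rho> 1) \<omega>)"
        by (rule kernel_cond_dist_reindex[OF K_nonneg \<rho>]) (auto simp: I_def \<xi>_def)
      moreover have "kernel_cond_dist K (h2 n) n (\<lambda>i. fst ((\<lambda>i\<in>I. \<xi> (\<rho> i) \<omega>) i)) (\<lambda>i. snd (snd ((\<lambda>i\<in>I. \<xi> (\<rho> i) \<omega>) i))) (Zs (\<rho> 1) \<omega>)
          = kernel_cond_dist K (h2 n) n (\<lambda>i. Xs i \<omega>) (\<lambda>i. Zs i \<omega>) (Zs (\<rho> 1) \<omega>)"
        by (rule kernel_cond_dist_reindex[OF K_nonneg \<rho>]) (auto simp: I_def \<xi>_def W_def)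
      moreover have "(\<lambda>i\<in>I. \<xi> (\<rho> i) \<omega>) 1 = (Xs (\<rho> 1) \<omega>, W (\<rho> 1) \<omega>)" "snd (W (\<rho> 1) \<omega>) = Zs (\<rho> 1) \<omega>"
        using 1 by (auto simp: \<xi>_def W_def)
      ultimately show ?thesis
        unfolding \<Phi>_def Bh_def by (simp only: snd_conv)
    qed
    have "expectation (\<lambda>\<omega>. \<Phi> (\<lambda>i\<in>I. \<xi> (\<pi> i) \<omega>)) = expectation (\<lambda>\<omega>. \<Phi> (\<lambda>i\<in>I. \<xi> i \<omega>))"
    proof (rule expectation_iid_reindex[OF ind])
      show "I \<noteq> {}" using 1 by auto
      show "bij_betw \<pi> I I" using \<pi> by (simp add: I_def)
      show "distr M borel (\<xi> i) = density lborel (\<lambda>w. ennreal (p w))" if "i \<in> I" for i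
        unfolding \<xi>_def[abs_def] by (rule S1.law) (use that in \<open>auto simp: I_def\<close>)
      show "\<Phi> \<in> borel_measurable (PiM I (\<lambda>_. borel))" by (rule \<Phi>)
    qed
    then have "expectation (\<lambda>\<omega>. \<bar>Bh n (\<pi> 1) \<omega> - b (W (\<pi> 1) \<omega>)\<bar>) = expectation (\<lambda>\<omega>. \<bar>Bh n (id 1) \<omega> - b (W (id 1) \<omega>)\<bar>)"
      unfolding val[OF \<pi>, symmetric] val[OF bij_betw_id, symmetric] by (simp only: id_apply)
    then show ?thesis by (simp add: \<pi>_def e_def)
  qed

  \<comment> \<open>Weighted terms, their integrability and their mean\<close>
  obtain Ca where a: "a \<in> borel_measurable borel" "\<And>w. 0 \<le> a w" "\<And>w. a w \<le> Ca"
    using assms(8) by (auto simp: weight_function_def)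
  note [measurable] = a(1)
  have Ca: "0 \<le> Ca" using order_trans[OF a(2,3)] .
  define \<zeta> where "\<zeta> = cond_ball_divergence M Y Z \<kappa>1 \<kappa>2 a"
  define T where "T n \<omega> = zeta_hat K (h1 n) (h2 n) a n (\<lambda>i. Xs i \<omega>) (\<lambda>i. Ys i \<omega>) (\<lambda>i. Zs i \<omega>)" for n \<omega>
  have T: "T n \<omega> = 1 / real n * (\<Sum>s=1..n. Bh n s \<omega> * a (W s \<omega>))" for n \<omega>
    by (simp add: T_def zeta_hat_def Bh_def W_def)
  have Wm[measurable]: "W i \<in> M \<rightarrow>\<^sub>M borel" if "i \<ge> 1" for i
    using that by (rule S1.measurable_V)
  have aW: "(\<lambda>\<omega>. a (W i \<omega>)) \<in> borel_measurable M" "(\<lambda>\<omega>. b (W i \<omega>)) \<in> borel_measurable M" if "i \<ge> 1" for i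
    using measurable_compose[OF Wm[OF that] a(1)] measurable_compose[OF Wm[OF that] b_meas] by auto
  have term_meas: "(\<lambda>\<omega>. Bh n s \<omega> * a (W s \<omega>)) \<in> borel_measurable M" if "s \<in> {1..n}" for n s
    using that by (intro borel_measurable_times Bh_meas aW) auto
  have T_meas: "T n \<in> borel_measurable M" for n
    unfolding T[abs_def] by (intro borel_measurable_times borel_measurable_sum borel_measurable_const term_meas)
  have ba: "\<bar>b w * a w\<bar> \<le> 2 * Ca" for w
    using b_bd[of w] a(2,3)[of w] by (simp add: abs_mult mult_mono)
  have Bha: "\<bar>Bh n s \<omega> * a (W s \<omega>)\<bar> \<le> 2 * Ca" for n s \<omega>
    using Bh_bd[of n s \<omega>] a(2,3)[of "W s \<omega>"] by (simp add: abs_mult mult_mono)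
  have term_int: "integrable M (\<lambda>\<omega>. Bh n s \<omega> * a (W s \<omega>))" if "s \<in> {1..n}" for n s
    by (rule integrable_const_bound[of _ "2 * Ca"]) (use Bha term_meas[OF that] in auto)
  have ba_int: "integrable M (\<lambda>\<omega>. b (W s \<omega>) * a (W s \<omega>))" if "s \<in> {1..n}" for n s
    by (rule integrable_const_bound[of _ "2 * Ca"]) (use ba aW[of s] that in auto)
  have T_int: "integrable M (T n)" for n
    unfolding T[abs_def] by (intro integrable_mult_right Bochner_Integration.integrable_sum term_int)

  have \<zeta>: "expectation (\<lambda>\<omega>. b (W i \<omega>) * a (W i \<omega>)) = \<zeta>" if i: "i \<ge> 1" for i
  proof -
    have m: "(\<lambda>w. b (snd w) * a (snd w)) \<in> borel_measurable (borel :: ('x \<times> 'y \<times> 'z) measure)"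
    proof -
      have [measurable]: "snd \<in> (borel :: ('x \<times> 'y \<times> 'z) measure) \<rightarrow>\<^sub>M borel"
        unfolding borel_prod[symmetric] by measurable
      show ?thesis by measurable
    qed
    have "expectation (\<lambda>\<omega>. b (W i \<omega>) * a (W i \<omega>))
        = (LINT w|distr M borel (\<lambda>\<omega>. (Xs i \<omega>, Ys i \<omega>, Zs i \<omega>)). b (snd w) * a (snd w))"
      by (subst integral_distr[OF XYZs[OF i] m]) (simp add: W_def)
    also have "\<dots> = expectation (\<lambda>\<omega>. b (Y \<omega>, Z \<omega>) * a (Y \<omega>, Z \<omega>))"
      unfolding law[OF i] by (subst integral_distr[OF XYZ m]) simp
    finally show ?thesis by (simp add: \<zeta>_def cond_ball_divergence_def b_def)
  qed
  have ind: "indep_vars (\<lambda>_. borel) (\<lambda>i \<omega>. b (W i \<omega>) * a (W i \<omega>)) {1..}"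
  proof -
    have "(\<lambda>w. b (snd w) * a (snd w)) \<in> borel_measurable (borel :: ('x \<times> 'y \<times> 'z) measure)"
    proof -
      have [measurable]: "snd \<in> (borel :: ('x \<times> 'y \<times> 'z) measure) \<rightarrow>\<^sub>M borel"
        unfolding borel_prod[symmetric] by measurable
      show ?thesis by measurable
    qed
    from indep_vars_compose2[OF S1.indep this] show ?thesis by simp
  qed

  \<comment> \<open>Error bound in mean and conclusion\<close>
  have bound: "expectation (\<lambda>\<omega>. \<bar>T n \<omega> - \<zeta>\<bar>) \<le> Ca * e n + 2 * Ca / sqrt (real n)" if n: "n \<ge> 1" for n
  proof -
    \<comment> \<open>\<open>R\<close> has the limiting divergences in place of the estimated ones,
      so its summands are independent and identically distributed with mean
      \<open>\<zeta>\<close>.\<close>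
    define R where "R \<omega> = 1 / real n * (\<Sum>s=1..n. b (W s \<omega>) * a (W s \<omega>))" for \<omega>
    have R_int: "integrable M R"
      unfolding R_def[abs_def] by (intro integrable_mult_right Bochner_Integration.integrable_sum ba_int)
    have d_int: "integrable M (\<lambda>\<omega>. \<bar>Bh n s \<omega> - b (W s \<omega>)\<bar>)" if s: "s \<in> {1..n}" for s
    proof (rule integrable_const_bound[of _ 2])
      have "\<bar>Bh n s \<omega> - b (W s \<omega>)\<bar> \<le> 2" for \<omega>
        using Bh_bd[of n s \<omega>] b_bd[of "W s \<omega>"] by (simp add: abs_le_iff)
      then show "AE \<omega> in M. norm \<bar>Bh n s \<omega> - b (W s \<omega>)\<bar> \<le> 2" by simp
    qed (use Bh_meas[OF s] aW[of s] s in auto)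
    have "\<bar>T n \<omega> - R \<omega>\<bar> \<le> 1 / real n * (\<Sum>s=1..n. Ca * \<bar>Bh n s \<omega> - b (W s \<omega>)\<bar>)" for \<omega>
    proof -
      have "\<bar>T n \<omega> - R \<omega>\<bar> = 1 / real n * \<bar>\<Sum>s=1..n. (Bh n s \<omega> - b (W s \<omega>)) * a (W s \<omega>)\<bar>"
        unfolding T R_def
        by (simp add: right_diff_distrib[symmetric] sum_subtractf[symmetric] left_diff_distrib[symmetric] abs_mult diff_divide_distrib[symmetric])
      also have "\<dots> \<le> 1 / real n * (\<Sum>s=1..n. Ca * \<bar>Bh n s \<omega> - b (W s \<omega>)\<bar>)"
      proof (intro mult_left_mono order_trans[OF sum_abs] sum_mono)
        fix s
        show "\<bar>(Bh n s \<omega> - b (W s \<omega>)) * a (W s \<omega>)\<bar> \<le> Ca * \<bar>Bh n s \<omega> - b (W s \<omega>)\<bar>"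
          using a(2,3)[of "W s \<omega>"] by (simp add: abs_mult mult.commute mult_right_mono)
      qed simp
      finally show ?thesis .
    qed
    then have "expectation (\<lambda>\<omega>. \<bar>T n \<omega> - R \<omega>\<bar>) \<le> expectation (\<lambda>\<omega>. 1 / real n * (\<Sum>s=1..n. Ca * \<bar>Bh n s \<omega> - b (W s \<omega>)\<bar>))"
      by (intro integral_mono integrable_abs Bochner_Integration.integrable_diff T_int R_int
          integrable_mult_right Bochner_Integration.integrable_sum d_int)
    \<comment> \<open>Each of the \<open>n\<close> dependent terms has expected error
      \<open>e n\<close> by exchangeability, and linearity of expectation is enough to average
      them.\<close>
    also have "\<dots> = 1 / real n * (\<Sum>s=1..n. Ca * e n)"
      using d_int exch by (simp add: Bochner_Integration.integral_sum)
    also have "\<dots> = Ca * e n" using n by simp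
    finally have TR: "expectation (\<lambda>\<omega>. \<bar>T n \<omega> - R \<omega>\<bar>) \<le> Ca * e n" .
    \<comment> \<open>The summands are bounded by \<open>2 * Ca\<close>: the ball divergence is at
      most 2 and the weight at most \<open>Ca\<close>.\<close>
    have R\<zeta>: "expectation (\<lambda>\<omega>. \<bar>R \<omega> - \<zeta>\<bar>) \<le> 2 * Ca / sqrt (real n)"
      unfolding R_def by (rule iid_mean_L1_bound[OF ind]) (use ba Ca \<zeta> n in auto)
    have "expectation (\<lambda>\<omega>. \<bar>T n \<omega> - \<zeta>\<bar>) \<le> expectation (\<lambda>\<omega>. \<bar>T n \<omega> - R \<omega>\<bar> + \<bar>R \<omega> - \<zeta>\<bar>)"
      using T_int R_int by (intro integral_mono) auto
    also have "\<dots> = expectation (\<lambda>\<omega>. \<bar>T n \<omega> - R \<omega>\<bar>) + expectation (\<lambda>\<omega>. \<bar>R \<omega> - \<zeta>\<bar>)"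
      using T_int R_int by simp
    finally show ?thesis using TR R\<zeta> by simp
  qed
  have "(\<lambda>n. 2 * Ca / sqrt (real n)) \<longlonglongrightarrow> 0"
    by (rule real_tendsto_divide_at_top[OF tendsto_const filterlim_compose[OF sqrt_at_top filterlim_real_sequentially]])
  then have "(\<lambda>n. Ca * e n + 2 * Ca / sqrt (real n)) \<longlonglongrightarrow> 0"
    using tendsto_add[OF tendsto_mult_right_zero[OF e]] by simp
  then have "tendsto_in_prob M T \<zeta>"
    by (intro tendsto_in_prob_if_L1[OF prob_space_axioms T_meas T_int bound])
  then show ?thesis by (simp add: T_def[abs_def] \<zeta>_def)
qed

end
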